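(* Let $\mathrm{V}$ be a finite vertex set, let $\mathfrak{G}$ be the class of all CPDAGs over $\mathrm{V}$, and let $\mathcal{L}=(\mathfrak{G},\preceq)$ be the poset with $\mathcal{G}_1\preceq\mathcal{G}_2$ if and only if $\mathcal{M}^{\mathrm{o}}_{\mathrm{CPDAG}}(\mathcal{G}_1)\subseteq\mathcal{M}^{\mathrm{o}}_{\mathrm{CPDAG}}(\mathcal{G}_2)$. For all $\mathcal{G}_s,\mathcal{G}_t\in\mathfrak{G}$, $$d_{\mathcal{L}}(\mathcal{G}_s,\mathcal{G}_t)\le\min\{d_{\mathcal{L},\downarrow\uparrow}(\mathcal{G}_s,\mathcal{G}_t),\,d_{\mathcal{L},\uparrow\downarrow}(\mathcal{G}_s,\mathcal{G}_t)\}$$ and $$d_{\mathcal{L}}(\mathcal{G}_s,\mathcal{G}_t)\ge|\mathrm{sk}(\mathcal{G}_s)\triangle\mathrm{sk}(\mathcal{G}_t)|+2\,m_{\mathrm{op}}(\mathrm{S}(\mathcal{G}_s,\mathcal{G}_t)).$$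
   Context: Graphs. Two DAGs over $\mathrm{V}$ are Markov equivalent if they have the same d-separations (equivalently, the same skeleton and the same v-structures). A CPDAG $\mathcal{G}$ represents a Markov equivalence class $[\mathcal{G}]$ of DAGs: it has the common skeleton, an edge is directed if it has the same direction in every DAG of the class, and undirected otherwise. $\mathrm{sk}(\mathcal{G})$ is the set of adjacent (unordered) vertex pairs. $\mathrm{v\text{-}str}(\mathcal{G})$ is the set of triplets $(a,b,c)$ with $a\to b\leftarrow c$ in $\mathcal{G}$ and $a,c$ nonadjacent; $(a,b,c)$ and $(c,b,a)$ are identified. Model. For each $v\in\mathrm{V}$ let $\mathcal{X}_v$ be a measurable space with a $\sigma$-finite measure $\mu_v$ that is nondegenerate (there are two disjoint measurable sets of positive $\mu_v$-measure), $\mu=\prod_v\mu_v$. $\mathcal{M}^{\mathrm{o}}_{\mathrm{CPDAG}}(\mathcal{G})$ is the set of laws $P$ of $X=(X_v)_{v\in\mathrm{V}}$ on $\prod_v\mathcal{X}_v$, absolutely continuous with respect to $\mu$, such that for any (equivalently every) $\mathcal{D}\in[\mathcal{G}]$ and all disjoint $\mathrm{A},\mathrm{B},\mathrm{C}\subset\mathrm{V}$: if $\mathrm{A}$ and $\mathrm{B}$ are d-separated by $\mathrm{C}$ in $\mathcal{D}$, then $X_{\mathrm{A}}$ and $X_{\mathrm{B}}$ are conditionally independent given $X_{\mathrm{C}}$ under $P$. Distances. $x\lessdot y$ ($y$ covers $x$) if $x\prec y$ with nothing strictly between. A path is a sequence in which of any two consecutive elements one covers the other. $d_{\mathcal{L}}$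 is the minimum length of a path between the two graphs; $d_{\mathcal{L},\downarrow\uparrow}$ and $d_{\mathcal{L},\uparrow\downarrow}$ are the minimum lengths of paths of the form $\mathcal{G}_s=x_0\gtrdot\cdots\gtrdot x_{i^*}\lessdot\cdots\lessdot x_d=\mathcal{G}_t$, respectively $\mathcal{G}_s=x_0\lessdot\cdots\lessdot x_{i^*}\gtrdot\cdots\gtrdot x_d=\mathcal{G}_t$, $0\le i^*\le d$. Lower bound. $\mathrm{S}(\mathcal{G}_s,\mathcal{G}_t)$ is the set of triplets $(a,b,c)\in\mathrm{V}^3$ with $(a,b),(b,c)\in\mathrm{sk}(\mathcal{G}_s)\cap\mathrm{sk}(\mathcal{G}_t)$, $(a,c)\notin\mathrm{sk}(\mathcal{G}_s)\cup\mathrm{sk}(\mathcal{G}_t)$, and $(a,b,c)\in\mathrm{v\text{-}str}(\mathcal{G}_s)\triangle\mathrm{v\text{-}str}(\mathcal{G}_t)$. For a pair of vertices $(i,j)$ and $\mathrm{T}\subseteq\mathrm{S}(\mathcal{G}_s,\mathcal{G}_t)$ define the operations $\mathrm{OP}_{(i,j),\mathrm{CE}}(\mathrm{T})=\mathrm{T}\setminus\{(i,k,j):k\in\mathrm{V}\}$ and $\mathrm{OP}_{(i,j),\mathrm{ER}}(\mathrm{T})=\mathrm{T}\setminus\{(i,j,k),(j,i,k):k\in\mathrm{V}\}$. $m_{\mathrm{op}}(\mathrm{T})$ is the smallest $m\ge 0$ such that there are operations $\mathrm{op}_1,\dots,\mathrm{op}_m$, each of one of these two forms for some pair $(i,j)$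 depending on the operation, with $\mathrm{op}_1\circ\cdots\circ\mathrm{op}_m(\mathrm{T})=\emptyset$. *)

theory Defs
  imports "HOL-Probability.Probability"
begin

definition dags :: "'v set \<Rightarrow> ('v \<times> 'v) set set" where
  "dags V = {D. D \<subseteq> V \<times> V \<and> acyclic D}"

definition adjacent :: "('v \<times> 'v) set \<Rightarrow> 'v \<Rightarrow> 'v \<Rightarrow> bool" where
  "adjacent D a b \<longleftrightarrow> (a, b) \<in> D \<or> (b, a) \<in> D"

definition trail :: "('v \<times> 'v) set \<Rightarrow> 'v \<Rightarrow> 'v list \<Rightarrow> 'v \<Rightarrow> bool" where
  "trail D a p b \<longleftrightarrow> p \<noteq> [] \<and> hd p = a \<and> last p = b \<and> distinct p \<and>
     (\<forall>i. Suc i < length p \<longrightarrow> adjacent D (p ! i) (p ! Suc i))"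

text \<open>A collider unblocks a trail if it or one of its descendants lies in \<open>C\<close>
  (every vertex is a descendant of itself); a non-collider unblocks it if it is not in \<open>C\<close>.\<close>

definition active_trail :: "('v \<times> 'v) set \<Rightarrow> 'v set \<Rightarrow> 'v list \<Rightarrow> bool" where
  "active_trail D C p \<longleftrightarrow>
     (\<forall>i. Suc (Suc i) < length p \<longrightarrow>
        (if (p ! i, p ! Suc i) \<in> D \<and> (p ! Suc (Suc i), p ! Suc i) \<in> D
         then \<exists>c\<in>C. (p ! Suc i, c) \<in> D\<^sup>*
         else p ! Suc i \<notin> C))"

definition d_separated :: "('v \<times> 'v) set \<Rightarrow> 'v set \<Rightarrow> 'v set \<Rightarrow> 'v set \<Rightarrow> bool" where
  "d_separated D A B C \<longleftrightarrow>
     (\<forall>a\<in>A. \<forall>b\<in>B. \<forall>p. trail D a p b \<longrightarrow> \<not> active_trail D C p)"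

definition disjoint_triples :: "'v set \<Rightarrow> ('v set \<times> 'v set \<times> 'v set) set" where
  "disjoint_triples V = {(A, B, C). A \<subseteq> V \<and> B \<subseteq> V \<and> C \<subseteq> V \<and>
     A \<inter> B = {} \<and> A \<inter> C = {} \<and> B \<inter> C = {}}"

definition markov_equiv :: "'v set \<Rightarrow> (('v \<times> 'v) set \<times> ('v \<times> 'v) set) set" where
  "markov_equiv V = {(D1, D2). D1 \<in> dags V \<and> D2 \<in> dags V \<and>
     (\<forall>(A, B, C) \<in> disjoint_triples V. d_separated D1 A B C \<longleftrightarrow> d_separated D2 A B C)}"

record 'v mixed_graph =
  directed :: "('v \<times> 'v) set"
  undirected :: "'v set set"

definition cpdag_of_class :: "('v \<times> 'v) set set \<Rightarrow> 'v mixed_graph" where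
  "cpdag_of_class K =
     \<lparr>directed = {(a, b). \<forall>D\<in>K. (a, b) \<in> D},
      undirected = {{a, b} | a b. (\<forall>D\<in>K. adjacent D a b) \<and>
        \<not> (\<forall>D\<in>K. (a, b) \<in> D) \<and> \<not> (\<forall>D\<in>K. (b, a) \<in> D)}\<rparr>"

definition cpdags :: "'v set \<Rightarrow> 'v mixed_graph set" where
  "cpdags V = cpdag_of_class ` (dags V // markov_equiv V)"

definition dag_class :: "'v set \<Rightarrow> 'v mixed_graph \<Rightarrow> ('v \<times> 'v) set set" where
  "dag_class V G = {D \<in> dags V. cpdag_of_class (markov_equiv V `` {D}) = G}"

definition sk :: "'v mixed_graph \<Rightarrow> 'v set set" where
  "sk G = {{a, b} | a b. (a, b) \<in> directed G} \<union> undirected G"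

text \<open>The triplets \<open>(a, b, c)\<close> and \<open>(c, b, a)\<close> are identified, so a triplet is
  stored as its unordered pair of endpoints together with its middle vertex.\<close>

type_synonym 'v triplet = "'v set \<times> 'v"

definition triplet :: "'v \<Rightarrow> 'v \<Rightarrow> 'v \<Rightarrow> 'v triplet" where
  "triplet a b c = ({a, c}, b)"

definition v_str :: "'v mixed_graph \<Rightarrow> 'v triplet set" where
  "v_str G = {triplet a b c | a b c. a \<noteq> c \<and>
     (a, b) \<in> directed G \<and> (c, b) \<in> directed G \<and> {a, c} \<notin> sk G}"

definition nondegenerate :: "'x measure \<Rightarrow> bool" where
  "nondegenerate m \<longleftrightarrow> (\<exists>A\<in>sets m. \<exists>B\<in>sets m. A \<inter> B = {} \<and> emeasure m A > 0 \<and> emeasure m B > 0)"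

definition cond_indep_var ::
  "'o measure \<Rightarrow> 'a measure \<Rightarrow> ('o \<Rightarrow> 'a) \<Rightarrow> 'b measure \<Rightarrow> ('o \<Rightarrow> 'b) \<Rightarrow>
   'c measure \<Rightarrow> ('o \<Rightarrow> 'c) \<Rightarrow> bool" where
  "cond_indep_var P Ma X Mb Y Mc Z \<longleftrightarrow>
     (let \<sigma>Z = vimage_algebra (space P) Z Mc in
      \<forall>E \<in> sets (vimage_algebra (space P) X Ma). \<forall>F \<in> sets (vimage_algebra (space P) Y Mb).
        AE \<omega> in P. real_cond_exp P \<sigma>Z (indicator (E \<inter> F)) \<omega> =
          real_cond_exp P \<sigma>Z (indicator E) \<omega> * real_cond_exp P \<sigma>Z (indicator F) \<omega>)"

definition cpdag_model :: "'v set \<Rightarrow> ('v \<Rightarrow> 'x measure) \<Rightarrow> 'v mixed_graph \<Rightarrow> ('v \<Rightarrow> 'x) measure set" where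
  "cpdag_model V \<mu> G = {P. prob_space P \<and> sets P = sets (PiM V \<mu>) \<and>
     absolutely_continuous (PiM V \<mu>) P \<and>
     (\<forall>D \<in> dag_class V G. \<forall>(A, B, C) \<in> disjoint_triples V. d_separated D A B C \<longrightarrow>
        cond_indep_var P (PiM A \<mu>) (\<lambda>x. restrict x A) (PiM B \<mu>) (\<lambda>x. restrict x B)
          (PiM C \<mu>) (\<lambda>x. restrict x C))}"

definition cpdag_le :: "'v set \<Rightarrow> ('v \<Rightarrow> 'x measure) \<Rightarrow> 'v mixed_graph \<Rightarrow> 'v mixed_graph \<Rightarrow> bool" where
  "cpdag_le V \<mu> G1 G2 \<longleftrightarrow> cpdag_model V \<mu> G1 \<subseteq> cpdag_model V \<mu> G2"

definition covered_by :: "'a set \<Rightarrow> ('a \<Rightarrow> 'a \<Rightarrow> bool) \<Rightarrow> 'a \<Rightarrow> 'a \<Rightarrow> bool" where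
  "covered_by L le x y \<longleftrightarrow> x \<in> L \<and> y \<in> L \<and> le x y \<and> x \<noteq> y \<and>
     \<not> (\<exists>z\<in>L. le x z \<and> x \<noteq> z \<and> le z y \<and> z \<noteq> y)"

text \<open>The distances are \<open>\<infinity>\<close> (infimum of the empty set) if there is no path of the required form.
  A path of length \<open>d\<close> consists of the \<open>d + 1\<close> elements \<open>x 0, \<dots>, x d\<close>.\<close>

definition dist_L :: "'a set \<Rightarrow> ('a \<Rightarrow> 'a \<Rightarrow> bool) \<Rightarrow> 'a \<Rightarrow> 'a \<Rightarrow> enat" where
  "dist_L L le s t = Inf {enat d | d x. (\<forall>i\<le>d. x i \<in> L) \<and> x 0 = s \<and> x d = t \<and>
     (\<forall>i<d. covered_by L le (x i) (x (Suc i)) \<or> covered_by L le (x (Suc i)) (x i))}"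

definition dist_down_up :: "'a set \<Rightarrow> ('a \<Rightarrow> 'a \<Rightarrow> bool) \<Rightarrow> 'a \<Rightarrow> 'a \<Rightarrow> enat" where
  "dist_down_up L le s t = Inf {enat d | d x. (\<forall>i\<le>d. x i \<in> L) \<and> x 0 = s \<and> x d = t \<and>
     (\<exists>k\<le>d. (\<forall>i<k. covered_by L le (x (Suc i)) (x i)) \<and>
             (\<forall>i. k \<le> i \<and> i < d \<longrightarrow> covered_by L le (x i) (x (Suc i))))}"

definition dist_up_down :: "'a set \<Rightarrow> ('a \<Rightarrow> 'a \<Rightarrow> bool) \<Rightarrow> 'a \<Rightarrow> 'a \<Rightarrow> enat" where
  "dist_up_down L le s t = Inf {enat d | d x. (\<forall>i\<le>d. x i \<in> L) \<and> x 0 = s \<and> x d = t \<and>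
     (\<exists>k\<le>d. (\<forall>i<k. covered_by L le (x i) (x (Suc i))) \<and>
             (\<forall>i. k \<le> i \<and> i < d \<longrightarrow> covered_by L le (x (Suc i)) (x i)))}"

definition S_triplets :: "'v set \<Rightarrow> 'v mixed_graph \<Rightarrow> 'v mixed_graph \<Rightarrow> 'v triplet set" where
  "S_triplets V Gs Gt = {triplet a b c | a b c. a \<in> V \<and> b \<in> V \<and> c \<in> V \<and>
     {a, b} \<in> sk Gs \<inter> sk Gt \<and> {b, c} \<in> sk Gs \<inter> sk Gt \<and> {a, c} \<notin> sk Gs \<union> sk Gt \<and>
     triplet a b c \<in> sym_diff (v_str Gs) (v_str Gt)}"

definition OP_CE :: "'v set \<Rightarrow> 'v \<Rightarrow> 'v \<Rightarrow> 'v triplet set \<Rightarrow> 'v triplet set" where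
  "OP_CE V i j T = T - {triplet i k j | k. k \<in> V}"

definition OP_ER :: "'v set \<Rightarrow> 'v \<Rightarrow> 'v \<Rightarrow> 'v triplet set \<Rightarrow> 'v triplet set" where
  "OP_ER V i j T = T - ({triplet i j k | k. k \<in> V} \<union> {triplet j i k | k. k \<in> V})"

definition m_op :: "'v set \<Rightarrow> 'v triplet set \<Rightarrow> nat" where
  "m_op V T = (LEAST m. \<exists>ops. length ops = m \<and>
     set ops \<subseteq> {OP_CE V i j | i j. i \<in> V \<and> j \<in> V} \<union> {OP_ER V i j | i j. i \<in> V \<and> j \<in> V} \<and>
     foldr (\<circ>) ops id T = {})"

end

theory Submission
  imports Defs "HOL-Library.Z2"
begin

text \<open>The order on CPDAGs is inclusion of d-connections: a d-connection given \<open>C\<close> is witnessed by a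
  mixture of product measures indexed by a linear space over the field with two elements, which
  lies in the model and violates the corresponding conditional independence. Inclusion of
  d-connections is generated by single edge additions and covered edge reversals (Meek's
  conjecture, proved by Chickering), so a cover changes the skeleton by at most one edge, and it
  cannot change the status of a triple that is unshielded on both sides, because this status is read
  off from any set separating the end points. Hence along a path every triplet in \<open>S\<close> needs one of its
  three vertex pairs, which does not lie in the symmetric difference of the skeletons, to change at
  least twice, and a single operation for that pair removes all triplets it accounts for.\<close>

section \<open>d-connection and moral graphs\<close>

text \<open>Three obstacles shape the proof. Nondegeneracy guarantees only two disjoint sets of
  positive measure, and laws need densities, so in general a coordinate cannot be a function of
  other coordinates. Each coordinate therefore encodes a latent bit, and only the bits obey linear
  equations; conditional independence becomes a statement about fibres of a finite vector space. The
  equations live on one trail and on directed tails from its colliders into \<open>C\<close>; these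
  must not touch each other, so a minimal walk is needed there, while DAGs are compared through the
  search \<open>reach\<close>, whose states can be simulated in another graph. Meek's conjecture is
  proved by removing a sink \<open>Y\<close> of the larger graph. Making \<open>Y\<close> a sink of
  the smaller graph is only controlled on \<open>V - {Y}\<close>, so the inclusion is carried along
  on that set alone and the parents of \<open>Y\<close> are repaired separately. Finally,
  \<open>dag_class\<close> collects the DAGs with a given CPDAG, so it has to be shown that a CPDAG
  determines its Markov equivalence class.\<close>

definition anc :: "('v \<times> 'v) set \<Rightarrow> 'v set \<Rightarrow> 'v set" where
  "anc D C = {v. \<exists>c\<in>C. (v, c) \<in> D\<^sup>*}"

text \<open>The states of the Bayes-ball search: the flag records whether the current vertex was entered
  through an arrowhead. The start vertex counts as entered through a tail.\<close>

inductive reach :: "('v \<times> 'v) set \<Rightarrow> 'v set \<Rightarrow> 'v \<Rightarrow> 'v \<Rightarrow> bool \<Rightarrow> bool"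
  for D C a where
  start: "reach D C a a False"
| up: "reach D C a v False \<Longrightarrow> v \<notin> C \<Longrightarrow> (u, v) \<in> D \<Longrightarrow> reach D C a u False"
| down: "reach D C a v d \<Longrightarrow> v \<notin> C \<Longrightarrow> (v, w) \<in> D \<Longrightarrow> reach D C a w True"
| collide: "reach D C a v True \<Longrightarrow> v \<in> anc D C \<Longrightarrow> (u, v) \<in> D \<Longrightarrow> reach D C a u False"

definition conn :: "('v \<times> 'v) set \<Rightarrow> 'v set \<Rightarrow> 'v \<Rightarrow> 'v \<Rightarrow> bool" where
  "conn D C a b \<longleftrightarrow> (\<exists>d. reach D C a b d)"

lemma ancI: "(v, c) \<in> D\<^sup>* \<Longrightarrow> c \<in> C \<Longrightarrow> v \<in> anc D C"
  by (auto simp: anc_def)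

lemma subset_anc: "C \<subseteq> anc D C"
  by (auto simp: anc_def)

lemma anc_parent: "v \<in> anc D C \<Longrightarrow> (u, v) \<in> D \<Longrightarrow> u \<in> anc D C"
  by (auto simp: anc_def intro: converse_rtrancl_into_rtrancl)

lemma anc_ancestor: "(u, v) \<in> D\<^sup>* \<Longrightarrow> v \<in> anc D C \<Longrightarrow> u \<in> anc D C"
  by (auto simp: anc_def intro: rtrancl_trans)

lemma anc_mono: "D \<subseteq> D' \<Longrightarrow> C \<subseteq> C' \<Longrightarrow> anc D C \<subseteq> anc D' C'"
  unfolding anc_def using rtrancl_mono by blast

text \<open>A directed path from a vertex with no descendant in \<open>C\<close> avoids
  \<open>C\<close>, so \<open>down\<close> applies at each of its vertices. That a true flag stays
  true is recorded for arguments that continue from an arrowhead.\<close>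

lemma reach_descend:
  assumes "(v, w) \<in> D\<^sup>*" "reach D C a v d" "v \<notin> anc D C"
  shows "w \<notin> anc D C \<and> (\<exists>d'. reach D C a w d' \<and> (d \<longrightarrow> d'))"
proof -
  have "(w, x) \<in> D\<^sup>* \<Longrightarrow> x \<notin> C" for x
    using assms(1,3) by (meson ancI rtrancl_trans)
  moreover have "\<exists>d'. reach D C a w d' \<and> (d \<longrightarrow> d')" using assms
  proof (induction rule: rtrancl_induct)
    case (step y z)
    have "y \<notin> C" using step by (meson ancI)
    then show ?case using step reach.down by metis
  qed auto
  ultimately show ?thesis by (auto simp: anc_def)
qed

lemma reach_ascend:
  assumes "(v, a) \<in> D\<^sup>*" "v \<notin> anc D C"
  shows "reach D C a v False"
  using assms
proof (induction rule: converse_rtrancl_induct)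
  case base show ?case by (rule reach.start)
next
  case (step y z)
  have z: "z \<notin> anc D C" using step by (meson anc_parent)
  then have "z \<notin> C" using subset_anc by fastforce
  then show ?case using step z reach.up by metis
qed

lemma reach_mono_graph:
  assumes "reach D C a v d" "D \<subseteq> D'"
  shows "reach D' C a v d"
  using assms(1)
  by induction (use assms(2) anc_mono[OF assms(2), of C C] in \<open>auto intro: reach.intros\<close>)

lemma conn_mono_graph: "conn D C a b \<Longrightarrow> D \<subseteq> D' \<Longrightarrow> conn D' C a b"
  unfolding conn_def using reach_mono_graph by metis

text \<open>The graph of Lauritzen's criterion: the moral graph of the part of \<open>D\<close> on
  \<open>S\<close>, with \<open>C\<close> removed. The common child \<open>k\<close> may itself lie
  in \<open>C\<close>, since conditioning opens a collider.\<close>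

definition moral :: "('v \<times> 'v) set \<Rightarrow> 'v set \<Rightarrow> 'v set \<Rightarrow> ('v \<times> 'v) set" where
  "moral D S C = {(v, w). v \<in> S - C \<and> w \<in> S - C \<and>
     ((v, w) \<in> D \<or> (w, v) \<in> D \<or> (\<exists>k\<in>S. (v, k) \<in> D \<and> (w, k) \<in> D))}"

lemma sym_moral: "sym (moral D S C)"
  by (auto simp: moral_def sym_def)

text \<open>Each vertex of the moral path is reached from some vertex of \<open>A\<close>, not
  necessarily from \<open>a\<close>. If a turn is needed at a vertex \<open>k\<close> that is no
  ancestor of \<open>C\<close>, then \<open>k\<close> has a descendant in \<open>A\<close> or
  \<open>B\<close>. Descending to \<open>B\<close> would give a connection; from a descendant in
  \<open>A\<close> the search restarts and ascends to \<open>k\<close>.\<close>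

lemma moral_imp_conn:
  assumes path: "(a, b) \<in> (moral D (anc D (A \<union> B \<union> C)) C)\<^sup>*"
    and "a \<in> A" "b \<in> B" and disj: "A \<inter> C = {}" "B \<inter> C = {}"
  shows "\<exists>a\<in>A. \<exists>b\<in>B. conn D C a b"
proof (rule ccontr)
  assume "\<not> ?thesis"
  then have no: "\<not> reach D C a' b' d" if "a' \<in> A" "b' \<in> B" for a' b' d
    using that by (auto simp: conn_def)
  have turn: "\<exists>a'\<in>A. reach D C a' u False"
    if k: "k \<in> anc D (A \<union> B \<union> C)" "reach D C a0 k True" "a0 \<in> A" and uk: "(u, k) \<in> D" for k u a0
  proof (cases "k \<in> anc D C")
    case True
    then show ?thesis using k uk by (meson reach.collide)
  next
    case False
    then have kC: "k \<notin> C" using subset_anc by fastforce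
    from False k(1) consider b' where "b' \<in> B" "(k, b') \<in> D\<^sup>*" | a' where "a' \<in> A" "(k, a') \<in> D\<^sup>*"
      by (auto simp: anc_def)
    then show ?thesis
    proof cases
      case 1
      then show ?thesis using reach_descend[OF _ k(2) False] no k(3) by meson
    next
      case 2
      then have "reach D C a' k False" using False by (intro reach_ascend)
      then show ?thesis using kC uk 2 by (meson reach.up)
    qed
  qed
  have "\<exists>a'\<in>A. \<exists>d. reach D C a' v d" if "(a, v) \<in> (moral D (anc D (A \<union> B \<union> C)) C)\<^sup>*" for v
    using that
  proof (induction rule: rtrancl_induct)
    case base
    show ?case using \<open>a \<in> A\<close> reach.start by metis
  next
    case (step v w)
    then obtain a' d where r: "a' \<in> A" "reach D C a' v d" by auto
    from step(2) have v: "v \<in> anc D (A \<union> B \<union> C)" "v \<notin> C" "w \<notin> C"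
      and e: "(v, w) \<in> D \<or> (w, v) \<in> D \<or> (\<exists>k\<in>anc D (A \<union> B \<union> C). (v, k) \<in> D \<and> (w, k) \<in> D)"
      by (auto simp: moral_def)
    from e consider "(v, w) \<in> D" | "(w, v) \<in> D"
      | k where "k \<in> anc D (A \<union> B \<union> C)" "(v, k) \<in> D" "(w, k) \<in> D" by auto
    then show ?case
    proof cases
      case 1
      then show ?thesis using r v by (meson reach.down)
    next
      case 2
      show ?thesis
      proof (cases d)
        case True
        then have "reach D C a' v True" using r by simp
        then show ?thesis using turn[OF v(1) _ r(1) 2] by blast
      next
        case False
        then have "reach D C a' v False" using r by simp
        then show ?thesis using reach.up[OF _ v(2) 2] r(1) by blast
      qed
    next
      case 3
      have "reach D C a' k True" using reach.down[OF r(2) v(2) 3(2)] .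
      then show ?thesis using turn[OF 3(1) _ r(1) 3(3)] by blast
    qed
  qed
  then show False using path no \<open>b \<in> B\<close> by metis
qed

text \<open>A vertex entered through an arrowhead need not lie in the ancestral set
  \<open>S\<close>. The invariant therefore speaks of the parent \<open>u\<close> through which it
  was entered, and promises a moral path to \<open>u\<close> only in case the vertex lies in
  \<open>S\<close>. Going up again marries two parents, going down continues along an edge.\<close>

lemma conn_imp_moral:
  assumes "conn D C a b" "a \<notin> C" "b \<notin> C"
  shows "(a, b) \<in> (moral D (anc D ({a, b} \<union> C)) C)\<^sup>*"
proof -
  define S where "S = anc D ({a, b} \<union> C)"
  have par: "u \<in> S" if "v \<in> S" "(u, v) \<in> D" for u v
    using that unfolding S_def by (meson anc_parent)
  have CS: "anc D C \<subseteq> S" unfolding S_def by (intro anc_mono) auto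
  have "if d then \<exists>u. (u, v) \<in> D \<and> u \<notin> C \<and> (v \<in> S \<longrightarrow> (a, u) \<in> (moral D S C)\<^sup>*)
        else v \<in> S \<and> (v \<notin> C \<longrightarrow> (a, v) \<in> (moral D S C)\<^sup>*)"
    if "reach D C a v d" for v d using that
  proof induction
    case start
    then show ?case by (auto simp: S_def anc_def)
  next
    case (up v u)
    then have "u \<in> S" "u \<notin> C \<Longrightarrow> (v, u) \<in> moral D S C"
      using par by (auto simp: moral_def)
    then show ?case using up by (auto intro: rtrancl_into_rtrancl)
  next
    case (down v d w)
    have "(a, v) \<in> (moral D S C)\<^sup>*" if "w \<in> S"
    proof (cases d)
      case True
      then obtain u where u: "(u, v) \<in> D" "u \<notin> C" "v \<in> S \<longrightarrow> (a, u) \<in> (moral D S C)\<^sup>*"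
        using down by auto
      moreover have "v \<in> S" using par that down by blast
      moreover from this have "(u, v) \<in> moral D S C" using u down par by (auto simp: moral_def)
      ultimately show ?thesis by (auto intro: rtrancl_into_rtrancl)
    next
      case False
      then show ?thesis using down by auto
    qed
    then show ?case using down by auto
  next
    case (collide v u)
    then obtain u' where u': "(u', v) \<in> D" "u' \<notin> C" "v \<in> S \<longrightarrow> (a, u') \<in> (moral D S C)\<^sup>*"
      by auto
    have "v \<in> S" using CS collide by auto
    moreover from this have "u \<in> S" "u' \<in> S" using par u' collide by auto
    moreover have "u \<notin> C \<Longrightarrow> (u', u) \<in> moral D S C"
      using u' calculation collide by (auto simp: moral_def)
    ultimately show ?case using u' by (auto intro: rtrancl_into_rtrancl)
  qed
  note inv = this
  obtain d where d: "reach D C a b d" using assms by (auto simp: conn_def)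
  have bS: "b \<in> S" by (auto simp: S_def anc_def)
  show ?thesis
  proof (cases d)
    case True
    then obtain u where u: "(u, b) \<in> D" "u \<notin> C" "(a, u) \<in> (moral D S C)\<^sup>*"
      using inv[OF d] bS by auto
    then have "(u, b) \<in> moral D S C" using bS par assms by (auto simp: moral_def)
    then show ?thesis using u by (auto simp: S_def intro: rtrancl_into_rtrancl)
  next
    case False
    then show ?thesis using inv[OF d] assms by (auto simp: S_def)
  qed
qed

text \<open>The rules of \<open>reach\<close> treat the two ends differently, so symmetry is
  obtained from the moral graph, where it is obvious.\<close>

lemma conn_sym:
  assumes "conn D C a b" "a \<notin> C" "b \<notin> C"
  shows "conn D C b a"
proof -
  have "(b, a) \<in> (moral D (anc D ({b} \<union> {a} \<union> C)) C)\<^sup>*"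
    using conn_imp_moral[OF assms] sym_moral sym_rtrancl
    by (metis insert_commute insert_is_Un symD sup_assoc)
  then show ?thesis using moral_imp_conn[of b a D "{b}" "{a}" C] assms by auto
qed

text \<open>Weak union for d-separation, read contrapositively: a collider that is open only because
  of \<open>S\<close> has a directed path to some \<open>s\<close> in \<open>S\<close> that avoids
  \<open>C\<close>, so \<open>s\<close> is reached.\<close>

lemma conn_weak_union:
  assumes "conn D (C \<union> S) a b"
  shows "conn D C a b \<or> (\<exists>s\<in>S. conn D C a s)"
proof (rule ccontr)
  assume no: "\<not> ?thesis"
  have "reach D C a v d" if "reach D (C \<union> S) a v d" for v d using that
  proof induction
    case (collide v u)
    show ?case
    proof (cases "v \<in> anc D C")
      case True
      then show ?thesis using collide by (meson reach.collide)
    next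
      case False
      then obtain s where "s \<in> S" "(v, s) \<in> D\<^sup>*" using collide by (auto simp: anc_def)
      then show ?thesis using reach_descend[OF _ collide.IH False] no by (auto simp: conn_def)
    qed
  qed (auto intro: reach.intros)
  then show False using assms no by (auto simp: conn_def)
qed

text \<open>Contraction, read contrapositively: enlarging \<open>C\<close> by \<open>S\<close> keeps
  open colliders open and blocks only non-colliders in \<open>S\<close>, and these are reached
  themselves.\<close>

lemma conn_contraction:
  assumes "conn D C a b"
  shows "conn D (C \<union> S) a b \<or> (\<exists>s\<in>S - C. conn D C a s)"
proof (rule ccontr)
  assume no: "\<not> ?thesis"
  have "reach D (C \<union> S) a v d" if "reach D C a v d" for v d using that
  proof induction
    case (up v u)
    then have "v \<notin> S" using no by (auto simp: conn_def)
    then show ?case using up by (auto intro: reach.up)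
  next
    case (down v d w)
    then have "v \<notin> S" using no by (auto simp: conn_def)
    then show ?case using down by (auto intro: reach.down)
  next
    case (collide v u)
    then show ?case using anc_mono[of D D C "C \<union> S"] by (auto intro: reach.collide)
  qed (rule reach.start)
  then show False using assms no by (auto simp: conn_def)
qed

section \<open>Comparing d-connections of two DAGs\<close>

text \<open>\<open>U\<close> may be smaller than the vertex sets of the graphs. Vertices outside
  \<open>U\<close> are then never conditioned on, so the comparison concerns the marginals on
  \<open>U\<close>.\<close>

definition conn_le :: "'v set \<Rightarrow> ('v \<times> 'v) set \<Rightarrow> ('v \<times> 'v) set \<Rightarrow> bool" where
  "conn_le U G H \<longleftrightarrow>
     (\<forall>C a b. C \<subseteq> U \<longrightarrow> a \<in> U - C \<longrightarrow> b \<in> U - C \<longrightarrow> a \<noteq> b \<longrightarrow> conn G C a b \<longrightarrow> conn H C a b)"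

lemma conn_leD:
  "conn_le U G H \<Longrightarrow> conn G C a b \<Longrightarrow> C \<subseteq> U \<Longrightarrow> a \<in> U \<Longrightarrow> b \<in> U \<Longrightarrow> a \<notin> C \<Longrightarrow> b \<notin> C \<Longrightarrow> a \<noteq> b
   \<Longrightarrow> conn H C a b"
  unfolding conn_le_def by blast

lemma conn_le_refl: "conn_le U G G"
  by (auto simp: conn_le_def)

lemma conn_le_trans: "conn_le U G H \<Longrightarrow> conn_le U H K \<Longrightarrow> conn_le U G K"
  unfolding conn_le_def by blast

lemma conn_le_mono: "G \<subseteq> H \<Longrightarrow> conn_le U G H"
  unfolding conn_le_def using conn_mono_graph by metis

lemma reach_trans: "reach D C u b d \<Longrightarrow> reach D C a u False \<Longrightarrow> reach D C a b d"
  by (induction rule: reach.induct) (auto intro: reach.intros)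

text \<open>The local Markov property. From \<open>b\<close> the search sees only \<open>b\<close>,
  its parents, which are blocked because they are entered through tails, and proper descendants of
  \<open>b\<close>. A descendant that opens as a collider would be an ancestor of a parent of
  \<open>b\<close> and close a directed cycle.\<close>

lemma not_conn_parents:
  assumes ac: "acyclic K" and "(b, a) \<notin> K\<^sup>*" "(a, b) \<notin> K"
  shows "\<not> conn K {u. (u, b) \<in> K} b a"
proof
  assume "conn K {u. (u, b) \<in> K} b a"
  then obtain d where "reach K {u. (u, b) \<in> K} b a d" by (auto simp: conn_def)
  moreover have "(v = b \<and> \<not> d) \<or> ((v, b) \<in> K \<and> \<not> d) \<or> ((b, v) \<in> K\<^sup>+ \<and> d)"
    if "reach K {u. (u, b) \<in> K} b v d" for v d using that
  proof induction
    case (collide v u)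
    then have "(b, v) \<in> K\<^sup>+" using ac by (auto simp: acyclic_def)
    moreover obtain c where "(v, c) \<in> K\<^sup>*" "(c, b) \<in> K" using collide by (auto simp: anc_def)
    ultimately have "(b, b) \<in> K\<^sup>+" by (meson rtrancl_into_trancl1 trancl_rtrancl_trancl trancl_trans r_into_trancl)
    then show ?case using ac by (auto simp: acyclic_def)
  next
    case (down v d w)
    then show ?case by (auto intro: trancl_into_trancl)
  qed auto
  ultimately show False using assms(2,3) by (auto dest: trancl_into_rtrancl)
qed

text \<open>The semigraphoid argument from local to global for one sink \<open>Y\<close>. The
  assumptions on \<open>G\<close> are combined by symmetry, weak union and contraction only; all
  graphical reasoning happens in \<open>K\<close>, where \<open>Y\<close> can pass a connection on
  only as a conditioned collider.\<close>

lemma conn_le_sink: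
  assumes Y: "Y \<in> U" and sink: "\<And>w. (Y, w) \<notin> K" and KU: "K \<subseteq> U \<times> U"
    and loc: "\<And>a. a \<in> U \<Longrightarrow> (a, Y) \<notin> K \<Longrightarrow> a \<noteq> Y \<Longrightarrow> \<not> conn G {u. (u, Y) \<in> K} Y a"
    and le: "conn_le (U - {Y}) G {(u, v) \<in> K. v \<noteq> Y}"
  shows "conn_le U G K"
proof -
  define P where "P = {u. (u, Y) \<in> K}"
  have P: "P \<subseteq> U - {Y}" using sink KU by (auto simp: P_def)
  have sub: "{(u, v) \<in> K. v \<noteq> Y} \<subseteq> K" by auto
  have off: "\<not> conn G C a b"
    if "\<not> conn K C a b" "C \<subseteq> U - {Y}" "a \<in> U - {Y}" "b \<in> U - {Y}" "a \<notin> C" "b \<notin> C" "a \<noteq> b" for C a b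
    using conn_leD[OF le _ that(2-)] conn_mono_graph[OF _ sub] that(1) by blast
  have toY: "\<not> conn G C a Y"
    if nc: "\<not> conn K C a Y" and C: "C \<subseteq> U - {Y}" and a: "a \<in> U - {Y}" "a \<notin> C" for C a
  proof
    assume c: "conn G C a Y"
    \<comment> \<open>In \<open>K\<close> a connection to a parent of \<open>Y\<close> outside
      \<open>C\<close> would go on to \<open>Y\<close>. Hence \<open>a\<close> is separated from
      \<open>P - C\<close> in \<open>G\<close> as well, contraction brings \<open>P\<close> into the
      conditioning set, and weak union leaves \<open>P\<close> alone, against
      \<open>loc\<close>.\<close>
    have noP: "\<not> conn K C a p" if "p \<in> P - C" for p
    proof
      assume "conn K C a p"
      then obtain d where "reach K C a p d" by (auto simp: conn_def)
      then have "reach K C a Y True" using that by (auto simp: P_def intro: reach.down)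
      then show False using nc by (auto simp: conn_def)
    qed
    have aP: "a \<notin> P" using noP[of a] a reach.start by (fastforce simp: conn_def)
    have "\<not> conn G C a p" if "p \<in> P - C" for p
      by (rule off[OF noP[OF that] C]) (use that a aP P in auto)
    then have "conn G (C \<union> P) a Y" using conn_contraction[OF c, of P] by blast
    moreover have "a \<notin> C \<union> P" "Y \<notin> C \<union> P" using a aP C P by auto
    ultimately have "conn G (C \<union> P) Y a" by (rule conn_sym)
    then have "conn G (P \<union> (C - P)) Y a" by (simp add: Un_commute)
    from conn_weak_union[OF this] show False
      using loc a aP C by (auto simp: P_def)
  qed
  have K_insert: "reach K (insert Y C) a v d \<and> (v = Y \<longrightarrow> d)" if "reach K C a v d" "a \<noteq> Y" for C a v d
    using that
  proof induction
    case (collide v u)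
    then show ?case using anc_mono[of K K C "insert Y C"] sink by (auto intro: reach.collide)
  next
    case (up v u)
    then show ?case using sink by (auto intro: reach.up)
  next
    case (down v d w)
    then have "v \<noteq> Y" using sink by auto
    then show ?case using down by (auto intro: reach.down)
  qed (auto intro: reach.start)
  have "\<not> conn G C a b"
    if nc: "\<not> conn K C a b" and C: "C \<subseteq> U" and ab: "a \<in> U" "b \<in> U" "a \<notin> C" "b \<notin> C" "a \<noteq> b" for C a b
  proof -
    consider "Y \<notin> C" "a \<noteq> Y" "b \<noteq> Y" | "b = Y" | "a = Y" | "Y \<in> C" "a \<noteq> Y" "b \<noteq> Y" by blast
    then show ?thesis
    proof cases
      case 1
      then show ?thesis using off nc C ab by auto
    next
      case 2
      then show ?thesis using toY[OF nc[unfolded 2]] C ab by auto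
    next
      case 3
      have "\<not> conn K C b Y" using nc ab conn_sym 3 by metis
      then have "\<not> conn G C b Y" using toY C ab 3 by auto
      then show ?thesis using ab conn_sym 3 by metis
    next
      case 4
      define C' where "C' = C - {Y}"
      have CC': "C = insert Y C'" "C = C' \<union> {Y}" and C': "C' \<subseteq> U - {Y}" "a \<notin> C'" "b \<notin> C'"
        using 4 C ab by (auto simp: C'_def)
      have "\<not> conn K C' a b" using K_insert[of C' a b] 4 nc CC'(1) unfolding conn_def by metis
      then have Gab: "\<not> conn G C' a b" using off C' ab 4 by auto
      \<comment> \<open>If both end points were connected to the sink \<open>Y\<close>, conditioning
        on \<open>Y\<close> would open the collider there and join them. The end point that is
        separated from \<open>Y\<close> is the one to which weak union is applied.\<close>
      have "\<not> conn K C' a Y \<or> \<not> conn K C' b Y"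
      proof (rule ccontr)
        assume "\<not> ?thesis"
        then obtain d1 d2 where r: "reach K C' a Y d1" "reach K C' b Y d2" by (auto simp: conn_def)
        have aY: "reach K C a Y True" using K_insert[OF r(1)] 4 CC' by auto
        from r(2) obtain u where u: "(u, Y) \<in> K" "u \<notin> C'" "conn K C' b u"
          using 4 sink by (cases rule: reach.cases) (auto simp: conn_def)
        have uY: "u \<noteq> Y" using u sink by auto
        have "conn K C b u" using u(3) K_insert[of C' b u] CC'(1) 4 unfolding conn_def by metis
        then obtain d where "reach K C u b d"
          using conn_sym u uY ab CC' by (metis conn_def insert_iff)
        moreover have "reach K C a u False"
          using aY u(1) 4 subset_anc by (meson reach.collide subsetD)
        ultimately show False using nc reach_trans by (metis conn_def)
      qed
      then show ?thesis
      proof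
        assume "\<not> conn K C' a Y"
        then have "\<not> conn G C' a Y" using toY C' ab 4 by auto
        then show ?thesis using conn_weak_union[of G C' "{Y}" a b] Gab CC' by auto
      next
        assume "\<not> conn K C' b Y"
        then have "\<not> conn G C' b Y" using toY C' ab 4 by auto
        moreover have "\<not> conn G C' b a" using Gab conn_sym C' by metis
        ultimately have "\<not> conn G C b a" using conn_weak_union[of G C' "{Y}" b a] CC' by auto
        then show ?thesis using conn_sym ab by metis
      qed
    qed
  qed
  then show ?thesis unfolding conn_le_def by blast
qed

text \<open>The last vertex in the order \<open>f\<close> is a sink of \<open>K\<close>, so
  \<open>conn_le_sink\<close> peels it off. An inclusion is thereby reduced to one separation per
  pair: a vertex from a predecessor that is not its parent, given its parents.\<close>

lemma conn_le_local_markov: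
  fixes f :: "'v \<Rightarrow> nat"
  assumes "finite U" "K \<subseteq> U \<times> U" "inj_on f U" "\<And>u v. (u, v) \<in> K \<Longrightarrow> f u < f v"
    and "\<And>W a. W \<in> U \<Longrightarrow> a \<in> U \<Longrightarrow> f a < f W \<Longrightarrow> (a, W) \<notin> K \<Longrightarrow> \<not> conn G {u. (u, W) \<in> K} W a"
  shows "conn_le U G K"
  using assms
proof (induction "card U" arbitrary: U K)
  case 0
  then show ?case by (auto simp: conn_le_def)
next
  case (Suc n)
  then have "U \<noteq> {}" by auto
  obtain Y where Y: "Y \<in> U" "\<And>u. u \<in> U \<Longrightarrow> f u \<le> f Y"
    using Max_in[of "f ` U"] Max_ge[of "f ` U"] Suc.prems(1) \<open>U \<noteq> {}\<close> by fastforce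
  have sink: "(Y, w) \<notin> K" for w using Y(2) Suc.prems(2,4) by (meson SigmaD2 leD subsetD)
  have K': "{u. (u, W) \<in> {(u, v) \<in> K. v \<noteq> Y}} = {u. (u, W) \<in> K}" if "W \<noteq> Y" for W
    using that by auto
  show ?case
  proof (rule conn_le_sink[OF Y(1) sink Suc.prems(2)])
    fix a assume "a \<in> U" "(a, Y) \<notin> K" "a \<noteq> Y"
    moreover from this have "f a < f Y" using Y Suc.prems(3) by (metis inj_onD le_neq_implies_less)
    ultimately show "\<not> conn G {u. (u, Y) \<in> K} Y a" using Suc.prems(5) Y by auto
  next
    show "conn_le (U - {Y}) G {(u, v) \<in> K. v \<noteq> Y}"
    proof (rule Suc.hyps(1))
      show "n = card (U - {Y})" using Suc.hyps(2) Y Suc.prems(1) by simp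
      show "{(u, v) \<in> K. v \<noteq> Y} \<subseteq> (U - {Y}) \<times> (U - {Y})" using Suc.prems(2) sink by auto
      show "inj_on f (U - {Y})" using Suc.prems(3) by (auto simp: inj_on_def)
    next
      fix W a assume "W \<in> U - {Y}" "a \<in> U - {Y}" "f a < f W" "(a, W) \<notin> {(u, v) \<in> K. v \<noteq> Y}"
      then show "\<not> conn G {u. (u, W) \<in> {(u, v) \<in> K. v \<noteq> Y}} W a"
        using Suc.prems(5)[of W a] K'[of W] by auto
    qed (use Suc.prems in auto)
  qed
qed

section \<open>Reversal of a covered edge\<close>

lemma anc_delete_edge:
  assumes cov: "{u. (u, y) \<in> D} = insert x {u. (u, x) \<in> D}"
    and "v \<in> anc D C" "v \<noteq> x"
  shows "v \<in> anc (insert (y, x) (D - {(x, y)})) C"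
proof -
  define D' where "D' = insert (y, x) (D - {(x, y)})"
  obtain c where c: "c \<in> C" "(v, c) \<in> D\<^sup>*" using assms by (auto simp: anc_def)
  \<comment> \<open>Every parent of \<open>x\<close> is also a parent of \<open>y\<close>, so a path
    through \<open>x\<close> to \<open>y\<close> can step to \<open>y\<close> directly. Only paths
    that start at \<open>x\<close> may be lost.\<close>
  have "(v, w) \<in> D'\<^sup>* \<and> (w = x \<longrightarrow> (v, y) \<in> D'\<^sup>*)" if "(v, w) \<in> D\<^sup>*" for w using that
  proof (induction rule: rtrancl_induct)
    case base
    then show ?case using assms by auto
  next
    case (step z w)
    show ?case
    proof (cases "z = x")
      case True
      then show ?thesis using step by (cases "w = y") (auto simp: D'_def intro: rtrancl_into_rtrancl)
    next
      case False
      then have "(z, w) \<in> D'" "w = x \<Longrightarrow> (z, y) \<in> D'" using step cov by (auto simp: D'_def)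
      then show ?thesis using step by (auto intro: rtrancl_into_rtrancl)
    qed
  qed
  then show ?thesis using c unfolding D'_def[symmetric] by (meson ancI)
qed

text \<open>The search in \<open>D\<close> is simulated in \<open>D'\<close>. Apart from the edge
  between them, \<open>x\<close> and \<open>y\<close> have the same parents, so entering one of them
  from another parent enters both. Colliders stay usable: if \<open>x\<close> ceases to be an
  ancestor of \<open>C\<close>, then \<open>y\<close> still is one.\<close>

lemma covered_reversal_conn:
  assumes ac: "acyclic D" and xy: "(x, y) \<in> D"
    and cov: "{u. (u, y) \<in> D} = insert x {u. (u, x) \<in> D}"
    and D': "D' = insert (y, x) (D - {(x, y)})"
    and "conn D C a b"
  shows "conn D' C a b"
proof -
  have irr: "(u, u) \<notin> D" for u using ac by (auto simp: acyclic_def)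
  have neq: "x \<noteq> y" "(y, x) \<notin> D" using xy irr ac by (auto simp: acyclic_def dest: trancl_into_trancl[OF r_into_trancl])
  have anc: "v \<in> anc D C \<Longrightarrow> v \<noteq> x \<Longrightarrow> v \<in> anc D' C" for v
    using anc_delete_edge[OF cov] D' by auto
  have ancx: "x \<in> anc D C \<Longrightarrow> x \<in> anc D' C \<or> y \<in> anc D' C"
  proof -
    assume "x \<in> anc D C"
    then obtain c where c: "c \<in> C" "(x, c) \<in> D\<^sup>*" by (auto simp: anc_def)
    from c(2) show ?thesis
    proof (cases rule: converse_rtranclE)
      case base
      then show ?thesis using c subset_anc by fastforce
    next
      case (step z)
      then have z: "z \<in> anc D C" "z \<noteq> x" using c irr by (auto simp: anc_def)
      then show ?thesis
        using anc[OF z] step(1) anc_parent[of z D' C x] D' by (cases "z = y") auto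
    qed
  qed
  have Q: "(u, x) \<in> D \<Longrightarrow> (u, y) \<in> D' \<and> (u, x) \<in> D'" "(u, y) \<in> D \<Longrightarrow> u = x \<or> (u, y) \<in> D' \<and> (u, x) \<in> D'" for u
    using cov neq irr unfolding D' by auto
  have e: "(u, v) \<in> D \<Longrightarrow> (u, v) \<noteq> (x, y) \<Longrightarrow> (u, v) \<in> D'" "(y, x) \<in> D'" for u v by (auto simp: D')
  let ?R = "reach D' C a"
  let ?top = "?R x True \<and> ?R y True"
  \<comment> \<open>\<open>I v d\<close> lists what \<open>D'\<close> may have reached once
    \<open>D\<close> has reached \<open>v\<close> with flag \<open>d\<close>. It differs from
    \<open>reach\<close> only at \<open>x\<close> and \<open>y\<close>: in \<open>D\<close> a tail
    state of \<open>x\<close> may come from \<open>y\<close>, and an arrowhead state of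
    \<open>y\<close> from \<open>x\<close>, along the edge that points the other way in
    \<open>D'\<close>.\<close>
  define I where "I = (\<lambda>v d. if v = x then (if d then ?top
        else ?R x False \<or> (?R y False \<and> y \<notin> C) \<or> (?top \<and> y \<in> anc D C))
      else if v = y then (if d then ?top \<or> (?R x False \<and> x \<notin> C) \<or> (?R y False \<and> y \<notin> C) else ?R y False)
      else ?R v d)"
  have Ix: "I x True \<longleftrightarrow> ?top" "I x False \<longleftrightarrow> ?R x False \<or> (?R y False \<and> y \<notin> C) \<or> (?top \<and> y \<in> anc D C)"
    and Iy: "I y True \<longleftrightarrow> ?top \<or> (?R x False \<and> x \<notin> C) \<or> (?R y False \<and> y \<notin> C)" "I y False \<longleftrightarrow> ?R y False"
    and Io: "v \<noteq> x \<Longrightarrow> v \<noteq> y \<Longrightarrow> I v d \<longleftrightarrow> ?R v d" for v d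
    using neq by (auto simp: I_def)
  have yx: "?R y d \<Longrightarrow> y \<notin> C \<Longrightarrow> ?R x True" for d using e(2) reach.down by metis
  have xy': "?R x False \<Longrightarrow> x \<notin> C \<Longrightarrow> ?R y False" using e(2) reach.up by metis
  have y_up: "?R y True \<Longrightarrow> y \<in> anc D C \<Longrightarrow> (u, x) \<in> D \<Longrightarrow> ?R u False" for u
    using anc neq Q by (metis reach.collide)
  have "I v d" if "reach D C a v d" for v d using that
  proof induction
    case start
    then show ?case using reach.start[of D' C a] by (cases "a = x"; cases "a = y") (auto simp: I_def)
  next
    case (up v u)
    consider "v = x" | "v = y" "u = x" | "v = y" "u \<noteq> x" | "v \<noteq> x" "v \<noteq> y" by blast
    then show ?case
    proof cases
      case 1
      have u: "u \<noteq> x" "u \<noteq> y" "(u, x) \<in> D'" "(u, y) \<in> D'" "(u, x) \<in> D" using up 1 neq irr Q by auto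
      have "?R u False" using up(4)[unfolded 1 Ix] u up(2)[unfolded 1] y_up reach.up by metis
      then show ?thesis using u Io by auto
    next
      case 2
      then show ?thesis using up Iy Ix by auto
    next
      case 3
      have u: "u \<noteq> x" "u \<noteq> y" "(u, y) \<in> D'" using up 3 neq irr Q by auto
      then show ?thesis using up 3 Iy Io reach.up by metis
    next
      case 4
      then have r: "?R u False" using up Io e by (metis prod.inject reach.up)
      then show ?thesis using Ix Iy Io by (cases "u = x"; cases "u = y") auto
    qed
  next
    case (down v d w)
    have w: "(v = x \<and> w = y) \<or> (v = x \<and> w \<noteq> y \<and> w \<noteq> x) \<or> (v = y \<and> w \<noteq> x \<and> w \<noteq> y) \<or> (v \<noteq> x \<and> v \<noteq> y)"
      using down irr neq by auto
    then consider "v = x" "w = y" | "v = x" "w \<noteq> y" "w \<noteq> x" | "v = y" "w \<noteq> x" "w \<noteq> y"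
      | "v \<noteq> x" "v \<noteq> y" by blast
    then show ?case
    proof cases
      case 1
      then show ?thesis using down Ix Iy by (cases d) auto
    next
      case 2
      have "\<exists>d. ?R x d" using down(4)[unfolded 2] Ix yx by (cases d) auto
      then have "?R w True" using down 2 e reach.down by (metis prod.inject)
      then show ?thesis using Io 2 by auto
    next
      case 3
      have "\<exists>d. ?R y d" using down(4)[unfolded 3] Iy xy' by (cases d) auto
      then have "?R w True" using down 3 e reach.down neq by (metis prod.inject)
      then show ?thesis using Io 3 by auto
    next
      case 4
      have r: "?R v d" using down 4 Io by auto
      have rw: "?R w True" using r down 4 e reach.down by (metis prod.inject)
      moreover have ?top if "w = x \<or> w = y"
        using that r down(2,3) 4 Q reach.down by metis
      ultimately show ?thesis using Ix Iy Io by (cases "w = x"; cases "w = y") auto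
    qed
  next
    case (collide v u)
    consider "v = x" | "v = y" "u = x" | "v = y" "u \<noteq> x" | "v \<noteq> x" "v \<noteq> y" by blast
    then show ?case
    proof cases
      case 1
      have u: "u \<noteq> x" "u \<noteq> y" "(u, x) \<in> D'" "(u, y) \<in> D'" using collide 1 neq irr Q by auto
      have "?R u False" using collide 1 u Ix ancx reach.collide by metis
      then show ?thesis using u Io by auto
    next
      case 2
      then show ?thesis using collide Ix Iy by auto
    next
      case 3
      have u: "u \<noteq> x" "u \<noteq> y" "(u, x) \<in> D'" "(u, y) \<in> D'" using collide 3 neq irr Q by auto
      have "y \<in> anc D' C" using anc collide 3 neq by auto
      then have "?R u False"
        using collide(4)[unfolded 3 Iy] u reach.collide reach.up by metis
      then show ?thesis using u Io by auto
    next
      case 4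
      then have "?R u False" using collide Io e anc by (metis prod.inject reach.collide)
      then show ?thesis using Ix Iy Io by (cases "u = x"; cases "u = y") auto
    qed
  qed
  then obtain d where "I b d" using assms(5) by (auto simp: conn_def)
  then have "\<exists>d. ?R b d"
    using Ix Iy Io yx xy' by (cases "b = x"; cases "b = y"; cases d) metis+
  then show ?thesis by (auto simp: conn_def)
qed

text \<open>A vertex \<open>Y\<close> outside \<open>U\<close> is never conditioned on, so an edge \<open>X \<rightarrow> Z\<close> can be replaced by the
  chain \<open>X \<rightarrow> Y \<rightarrow> Z\<close>, with the same arrowheads at its ends.\<close>

lemma conn_le_shortcut:
  assumes le: "conn_le U G K" and Y: "Y \<notin> U" and YZ: "(Y, Z) \<in> G"
  shows "conn_le U (G \<union> {(X, Z) | X. (X, Y) \<in> G}) K"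
proof -
  define G1 where "G1 = G \<union> {(X, Z) | X. (X, Y) \<in> G}"
  have G1: "(u, v) \<in> G1 \<Longrightarrow> (u, v) \<in> G \<or> v = Z \<and> (u, Y) \<in> G" for u v by (auto simp: G1_def)
  have "G1\<^sup>* \<subseteq> (G\<^sup>*)\<^sup>*"
  proof (rule rtrancl_mono)
    have "(u, Z) \<in> G\<^sup>*" if "(u, Y) \<in> G" for u
      using that YZ by (meson r_into_rtrancl rtrancl_trans)
    then show "G1 \<subseteq> G\<^sup>*" by (auto dest!: G1)
  qed
  then have anc: "v \<in> anc G1 C \<Longrightarrow> v \<in> anc G C" for v C unfolding anc_def by auto
  have "reach G C a v d" if "reach G1 C a v d" "Y \<notin> C" for C a v d using that
  proof induction
    case (up v u)
    then consider "(u, v) \<in> G" | "v = Z" "(u, Y) \<in> G" using G1 by blast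
    then show ?case
    proof cases
      case 2
      have "reach G C a Y False" using up 2 YZ reach.up by metis
      then show ?thesis using up 2 reach.up by metis
    qed (use up reach.up in metis)
  next
    case (down v d w)
    then consider "(v, w) \<in> G" | "w = Z" "(v, Y) \<in> G" using G1 by blast
    then show ?case
    proof cases
      case 2
      have "reach G C a Y True" using down 2 YZ reach.down by metis
      then show ?thesis using down 2 YZ reach.down by metis
    qed (use down reach.down in metis)
  next
    case (collide v u)
    then consider "(u, v) \<in> G" | "v = Z" "(u, Y) \<in> G" using G1 by blast
    then show ?case
    proof cases
      case 2
      have "reach G C a Y False" using collide anc 2 YZ reach.collide by metis
      then show ?thesis using collide 2 reach.up by metis
    qed (use collide anc reach.collide in metis)
  qed (rule reach.start)
  then have "conn_le U G1 G" using Y unfolding conn_le_def conn_def by blast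
  from conn_le_trans[OF this le] show ?thesis unfolding G1_def .
qed

text \<open>All new edges end in \<open>Y\<close>, so the part of a path before its first new edge
  and the part after its last one both lie in \<open>G\<close>.\<close>

lemma rtrancl_add_parents:
  assumes "(u, v) \<in> (G \<union> {(X, Y) | X. X \<in> A})\<^sup>*"
  shows "(u, v) \<in> G\<^sup>* \<or> (\<exists>X\<in>A. (u, X) \<in> G\<^sup>* \<and> (Y, v) \<in> G\<^sup>*)"
  using assms
proof (induction rule: rtrancl_induct)
  case (step v w)
  show ?case
  proof (cases "(v, w) \<in> G")
    case True
    then show ?thesis using step.IH by (meson rtrancl_into_rtrancl)
  next
    case False
    then have "w = Y" "v \<in> A" using step by auto
    then show ?thesis using step.IH by blast
  qed
qed auto

text \<open>For the local statement of \<open>W\<close> in \<open>K\<close> with conditioning set \<open>C\<close> there are three cases. If \<open>W\<close> does not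
  come after \<open>D\<close>, no descendant of \<open>Y\<close> is conditioned on. If \<open>Z\<close> has a descendant in \<open>C\<close>, then the open
  collider at \<open>Z\<close> replaces every new edge. Otherwise every walk from \<open>W\<close> that reaches a new edge
  could continue through \<open>Z\<close> to \<open>D\<close>, although \<open>W\<close> and \<open>D\<close> are separated.\<close>

lemma conn_le_add_parents:
  fixes f :: "'v \<Rightarrow> nat"
  assumes U: "finite U" "Y \<notin> U" and G: "acyclic G" "G \<subseteq> insert Y U \<times> insert Y U"
    and YZ: "(Y, Z) \<in> G" and PaY: "\<And>X. (X, Y) \<in> G \<Longrightarrow> (X, Z) \<in> G"
    and K: "K \<subseteq> U \<times> U" "acyclic K" "inj_on f U" "\<And>u v. (u, v) \<in> K \<Longrightarrow> f u < f v"
    and le: "conn_le U G K"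
    and D: "(Z, D) \<in> G\<^sup>*" "\<And>r. (Y, r) \<in> G\<^sup>+ \<Longrightarrow> f D \<le> f r"
    and Z: "\<And>X. (X, Z) \<in> G \<Longrightarrow> X \<noteq> Y \<Longrightarrow> (Y, X) \<notin> G\<^sup>+"
    and G2: "G2 = G \<union> {(X, Y) | X. X \<in> {X. (X, Z) \<in> G \<and> X \<noteq> Y}}"
  shows "conn_le U G2 K"
proof (rule conn_le_local_markov[OF U(1) K(1,3,4)])
  fix W a assume Wa: "W \<in> U" "a \<in> U" "f a < f W" "(a, W) \<notin> K"
  define C where "C = {u. (u, W) \<in> K}"
  define R where "R = {r. (Y, r) \<in> G\<^sup>+}"
  have fK: "(u, v) \<in> K\<^sup>* \<Longrightarrow> f u \<le> f v" for u v
    by (induction rule: rtrancl_induct) (use K(4) in \<open>auto dest: less_imp_le order_trans\<close>)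
  have C: "C \<subseteq> U" "\<And>c. c \<in> C \<Longrightarrow> f c < f W" using K by (auto simp: C_def)
  have YC: "Y \<notin> C" "Y \<noteq> W" "Y \<noteq> a" using C U Wa by auto
  have Ksep: "\<not> conn K C W x" if "x \<in> U" "f x < f W" "(x, W) \<notin> K" for x
    using not_conn_parents[OF K(2), of W x] that fK[of W x] by (auto simp: C_def)
  have sep: "\<not> conn G C W x" if "x \<in> U" "f x < f W" "(x, W) \<notin> K" for x
    using conn_leD[OF le _ C(1) Wa(1) that(1)] Ksep[OF that] that C(2)[of W] by (auto simp: C_def)
  have G2e: "(u, v) \<in> G2 \<Longrightarrow> (u, v) \<in> G \<or> v = Y \<and> (u, Z) \<in> G \<and> u \<noteq> Y" for u v by (auto simp: G2)
  have G2Y: "(u, Y) \<in> G2 \<Longrightarrow> (u, Z) \<in> G" for u using PaY by (auto simp: G2)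
  have path: "(u, v) \<in> G2\<^sup>* \<Longrightarrow> (u, v) \<in> G\<^sup>* \<or> (\<exists>X. (X, Z) \<in> G \<and> X \<noteq> Y \<and> (u, X) \<in> G\<^sup>* \<and> (Y, v) \<in> G\<^sup>*)" for u v
    using rtrancl_add_parents[of u v G Y] unfolding G2 by blast
  have ZD: "D \<in> R" using YZ D(1) by (auto simp: R_def intro: rtrancl_into_trancl2)
  have RU: "R \<subseteq> U"
  proof
    fix r assume "r \<in> R"
    then have "(Y, r) \<in> G\<^sup>+" by (simp add: R_def)
    moreover from this have "r \<in> insert Y U" using G(2) by (auto dest: tranclD2)
    ultimately show "r \<in> U" using G(1) by (auto simp: acyclic_def)
  qed
  have YR: "Y \<notin> R" using U RU by auto
  have Rstep: "(u, v) \<in> G \<Longrightarrow> u \<in> insert Y R \<Longrightarrow> v \<in> R" for u v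
    by (auto simp: R_def intro: trancl_into_trancl)
  have "\<not> conn G2 C W a"
  proof (cases "f W \<le> f D")
    case True
    \<comment> \<open>In this case \<open>C\<close> and \<open>a\<close> precede \<open>D\<close> in
      the order \<open>f\<close>, and \<open>D\<close> is the earliest proper descendant of
      \<open>Y\<close>.\<close>
    have out: "c \<notin> insert Y R" if "c \<in> insert a C" for c
      using that C Wa D(2) True YC by (fastforce simp: R_def)
    have Rdown: "x \<in> insert Y R" if "(v, x) \<in> G\<^sup>*" "v \<in> insert Y R" for v x
      using that by (induction rule: rtrancl_induct) (use Rstep in blast)+
    have disj: "v \<notin> anc G C" if "v \<in> insert Y R" for v
      using Rdown[OF _ that] out by (auto simp: anc_def)
    have anc2: "v \<in> anc G C \<and> v \<notin> insert Y R" if "v \<in> anc G2 C" for v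
    proof -
      from that obtain c where c: "c \<in> C" "(v, c) \<in> G2\<^sup>*" by (auto simp: anc_def)
      moreover have "(Y, c) \<notin> G\<^sup>*" using Rdown[of Y c] out c by auto
      ultimately have "v \<in> anc G C" using path[of v c] by (auto simp: anc_def)
      then show ?thesis using disj by auto
    qed
    have ZC: "Z \<notin> anc G C" using disj Rstep YZ by blast
    have D_of_Z: "reach G C a D True" if "reach G C a Z True"
      using reach_descend[OF D(1) that ZC] by auto
    \<comment> \<open>A walk enters \<open>insert Y R\<close> only downwards and never leaves it,
      because nothing there is an ancestor of \<open>C\<close>. Inside it suffices to know that the
      current vertex or \<open>D\<close> is reached in \<open>G\<close>, since the goal
      \<open>W\<close> lies in \<open>R\<close> only if it equals \<open>D\<close>.\<close>
    have inv: "(v \<notin> insert Y R \<and> reach G C a v d) \<or>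
        (v \<in> insert Y R \<and> d \<and> (v \<in> R \<and> reach G C a v True \<or> reach G C a D True))"
      if "reach G2 C a v d" for v d using that
    proof induction
      case start
      then show ?case using out by (auto intro: reach.start)
    next
      case (up v u)
      then have v: "v \<notin> insert Y R" "reach G C a v False" by auto
      then have uv: "(u, v) \<in> G" using G2e up by auto
      then have "u \<notin> insert Y R" using Rstep v by blast
      then show ?case using reach.up[OF v(2) up(2) uv] by simp
    next
      case (down v d w)
      show ?case
      proof (cases "v \<in> insert Y R")
        case True
        have "(v, w) \<in> G" using G2e[OF down(3)] Z True by (auto simp: R_def)
        then have "w \<in> R" using Rstep True by auto
        moreover have "reach G C a w True \<or> reach G C a D True"
          using reach.down[of G C a v True w] down(2,4) True \<open>(v, w) \<in> G\<close> by blast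
        ultimately show ?thesis by auto
      next
        case False
        then have r: "reach G C a v d" using down by auto
        show ?thesis
        proof (cases "w = Y")
          case True
          then have "reach G C a D True" using D_of_Z reach.down[OF r down(2)] G2Y down(3) by auto
          then show ?thesis using True by auto
        next
          case False
          then have "reach G C a w True" using reach.down[OF r down(2)] G2e down(3) by auto
          then show ?thesis using False by auto
        qed
      qed
    next
      case (collide v u)
      then have v: "v \<notin> insert Y R" "v \<in> anc G C" "reach G C a v True" using anc2 by blast+
      then have uv: "(u, v) \<in> G" using G2e collide by auto
      then have "u \<notin> insert Y R" using Rstep v by blast
      then show ?case using reach.collide[OF v(3,2) uv] by simp
    qed
    have "W = D" if "W \<in> R"
    proof -
      have "f W = f D" using D(2) that True by (auto simp: R_def intro: antisym)
      then show ?thesis using K(3) Wa RU ZD by (auto dest: inj_onD)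
    qed
    then have "conn G C a W" if "conn G2 C a W"
      using that inv YC unfolding conn_def by blast
    then show ?thesis
      using sep[OF Wa(2,3,4)] conn_sym Wa C(2)[of W] by (metis C_def mem_Collect_eq less_irrefl)
  next
    case False
    show ?thesis
    proof (cases "Z \<in> anc G C")
      case True
      have anc2: "v \<in> anc G C" if v: "v \<in> anc G2 C" for v
      proof -
        from v obtain c where "c \<in> C" "(v, c) \<in> G2\<^sup>*" by (auto simp: anc_def)
        then consider "(v, c) \<in> G\<^sup>*" | X where "(X, Z) \<in> G" "(v, X) \<in> G\<^sup>*" using path[of v c] by blast
        then show ?thesis
          by cases (use \<open>c \<in> C\<close> ancI True anc_parent anc_ancestor in metis)+
      qed
      \<comment> \<open>The open collider at \<open>Z\<close> sends the search back to every parent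
        of \<open>Z\<close>, in particular to \<open>Y\<close> and to all new parents of
        \<open>Y\<close>.\<close>
      have YF: "reach G C W u False" if "reach G C W Y d" "(u, Y) \<in> G2" for u d
        using reach.collide[OF reach.down[OF that(1) YC(1) YZ] True G2Y[OF that(2)]] .
      have ZF: "reach G C W u False" if "reach G C W Z True" "(u, Z) \<in> G" for u
        using reach.collide[OF that(1) True that(2)] .
      \<comment> \<open>The arrowhead state of \<open>Y\<close> may have no counterpart in
        \<open>G\<close>. It is represented by the arrowhead state of \<open>Z\<close>, from which
        the open collider leads on to the same vertices.\<close>
      have inv: "if v = Y \<and> d then reach G C W Z True else reach G C W v d"
        if "reach G2 C W v d" for v d using that
      proof induction
        case (up v u)
        then have v: "reach G C W v False" by auto
        show ?case
        proof (cases "v = Y")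
          case True
          then show ?thesis using YF v up by auto
        next
          case False
          then show ?thesis using reach.up[OF v] up G2e by auto
        qed
      next
        case (down v d w)
        show ?case
        proof (cases "v = Y")
          case True
          have Yd: "\<exists>d'. reach G C W Y d'" using down(4) True ZF YZ by (cases d) auto
          have "(Y, w) \<in> G" "w \<noteq> Y" using G2e[OF down(3)] True G(1) by (auto simp: acyclic_def)
          then show ?thesis using Yd YC(1) reach.down[of G C W Y _ w] by auto
        next
          case False
          then have v: "reach G C W v d" using down by auto
          show ?thesis using reach.down[OF v down(2)] G2e[OF down(3)] G2Y down(3) by (cases "w = Y") auto
        qed
      next
        case (collide v u)
        show ?case
        proof (cases "v = Y")
          case True
          then show ?thesis using ZF G2Y collide by auto
        next
          case False
          then show ?thesis using reach.collide[of G C W v u] anc2 collide G2e by auto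
        qed
      qed (use reach.start YC in auto)
      have "conn G C W a" if "conn G2 C W a" using that inv YC unfolding conn_def by metis
      then show ?thesis using sep[OF Wa(2,3,4)] by auto
    next
      case ZC: False
      have "D \<notin> C" using ZC D(1) by (auto simp: anc_def)
      then have "\<not> conn G C W D" using sep[of D] ZD RU False by (auto simp: C_def)
      \<comment> \<open>Reaching \<open>Z\<close> would mean reaching \<open>D\<close> below it,
        from which \<open>W\<close> is separated. As every new edge leads from a parent of
        \<open>Z\<close> to \<open>Y\<close>, no new edge is ever traversed.\<close>
      then have noZ: "\<not> reach G C W Z d" for d
        using reach_descend[OF D(1) _ ZC] by (auto simp: conn_def)
      have noY: "\<not> reach G C W Y d" for d using noZ reach.down[OF _ YC(1) YZ] by blast
      have noX: "\<not> reach G C W X d" if "(X, Z) \<in> G" "X \<notin> C" for X d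
        using noZ reach.down[OF _ that(2,1)] by blast
      have inv: "reach G C W v d" if "reach G2 C W v d" for v d using that
      proof induction
        case (up v u)
        then have "v \<noteq> Y" using noY by auto
        then show ?case using reach.up[OF up(4,2)] G2e up by auto
      next
        case (down v d w)
        then have "w \<noteq> Y" using noX G2Y by auto
        then show ?case using reach.down[OF down(4,2)] G2e down by auto
      next
        case (collide v u)
        then have vY: "v \<noteq> Y" using noY by auto
        \<comment> \<open>New edges could also open a collider. Its directed path to
          \<open>C\<close> would then lead to a parent \<open>X\<close> of \<open>Z\<close>; rolling
          down to \<open>X\<close> inside \<open>G\<close> contradicts \<open>noX\<close>.\<close>
        have "v \<in> anc G C"
        proof (rule ccontr)
          assume vC: "v \<notin> anc G C"
          moreover obtain c where c: "c \<in> C" "(v, c) \<in> G2\<^sup>*"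
            using collide(2) by (auto simp: anc_def)
          ultimately have "(v, c) \<notin> G\<^sup>*" by (auto simp: anc_def)
          with path[OF c(2)] obtain X where X: "(X, Z) \<in> G" "(v, X) \<in> G\<^sup>*" by auto
          obtain d' where d': "X \<notin> anc G C" "reach G C W X d'"
            using reach_descend[OF X(2) collide(4) vC] by blast
          then have "X \<notin> C" using subset_anc by fastforce
          then show False using noX[OF X(1)] d'(2) by blast
        qed
        then show ?case using reach.collide[OF collide(4)] G2e collide vY by auto
      qed (rule reach.start)
      then have "conn G C W a" if "conn G2 C W a" using that unfolding conn_def by metis
      then show ?thesis using sep[OF Wa(2,3,4)] by auto
    qed
  qed
  then show "\<not> conn G2 {u. (u, W) \<in> K} W a" by (simp add: C_def)
qed

section \<open>Elementary transitions between DAGs\<close>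

definition graph_step :: "'v set \<Rightarrow> (('v \<times> 'v) set \<times> ('v \<times> 'v) set) set" where
  "graph_step V = {(D, D'). D \<in> dags V \<and> D' \<in> dags V \<and>
     ((\<exists>e. D' = insert e D) \<or>
      (\<exists>x y. (x, y) \<in> D \<and> {u. (u, y) \<in> D} = insert x {u. (u, x) \<in> D} \<and>
         D' = insert (y, x) (D - {(x, y)})))}"

lemma graph_step_conn_le:
  assumes "(D, D') \<in> graph_step V"
  shows "conn_le U D D'"
proof -
  from assms consider "D \<subseteq> D'" | x y where "(x, y) \<in> D" "{u. (u, y) \<in> D} = insert x {u. (u, x) \<in> D}"
    "D' = insert (y, x) (D - {(x, y)})" "acyclic D"
    unfolding graph_step_def dags_def by blast
  then show ?thesis
  proof cases
    case 1
    then show ?thesis by (rule conn_le_mono)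
  next
    case 2
    from covered_reversal_conn[OF 2(4,1,2,3)] show ?thesis by (simp add: conn_le_def)
  qed
qed

lemma graph_steps_conn_le: "(D, D') \<in> (graph_step V)\<^sup>* \<Longrightarrow> conn_le U D D'"
proof (induction rule: rtrancl_induct)
  case (step D' D'')
  then show ?case using conn_le_trans[OF _ graph_step_conn_le] by blast
qed (rule conn_le_refl)

lemma dags_subset: "D \<subseteq> D' \<Longrightarrow> D' \<in> dags V \<Longrightarrow> D \<in> dags V"
  by (auto simp: dags_def intro: acyclic_subset)

lemma finite_dag: "finite V \<Longrightarrow> D \<in> dags V \<Longrightarrow> finite D"
  by (auto simp: dags_def intro: finite_subset)

lemma graph_steps_supergraph:
  assumes "finite V" "D \<subseteq> D'" "D' \<in> dags V"
  shows "(D, D') \<in> (graph_step V)\<^sup>*"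
proof -
  have "finite (D' - D)" using finite_dag assms by blast
  then show ?thesis using assms(2)
  proof (induction "D' - D" arbitrary: D rule: finite_induct)
    case empty
    then show ?case by auto
  next
    case (insert e F)
    have "insert e D \<subseteq> D'" using insert.hyps(4) insert.prems by auto
    then have "insert e D \<in> dags V" "D \<in> dags V"
      using insert.prems dags_subset[OF _ assms(3)] by auto
    then have "(D, insert e D) \<in> graph_step V" unfolding graph_step_def by blast
    moreover have "(insert e D, D') \<in> (graph_step V)\<^sup>*"
      using insert.hyps(2,4) insert.prems by (intro insert.hyps(3)) auto
    ultimately show ?case by (rule converse_rtrancl_into_rtrancl)
  qed
qed

section \<open>The inclusion order is generated by edge additions and covered reversals\<close>

lemma graph_step_reverse:
  "D \<in> dags V \<Longrightarrow> D' \<in> dags V \<Longrightarrow> (x, y) \<in> D \<Longrightarrow> {u. (u, y) \<in> D} = insert x {u. (u, x) \<in> D} \<Longrightarrow>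
    D' = insert (y, x) (D - {(x, y)}) \<Longrightarrow> (D, D') \<in> graph_step V"
  unfolding graph_step_def mem_Collect_eq prod.case
  by (intro conjI disjI2 exI[of _ x] exI[of _ y]; assumption)

lemma dag_topological:
  assumes "finite V" "D \<in> dags V"
  obtains f :: "'v \<Rightarrow> nat" where "inj_on f V" "\<And>u v. (u, v) \<in> D \<Longrightarrow> f u < f v"
proof -
  have "\<exists>f :: 'v \<Rightarrow> nat. inj_on f V \<and> (\<forall>(u, v) \<in> D. f u < f v)" using assms
  proof (induction V arbitrary: D rule: finite_psubset_induct)
    case (psubset V)
    show ?case
    proof (cases "V = {}")
      case True
      then show ?thesis using psubset by (auto simp: dags_def)
    next
      case False
      have fin: "finite D" using finite_dag psubset by blast
      have wf: "wf (D\<inverse>)" using fin psubset(3) by (auto simp: dags_def finite_acyclic_wf_converse)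
      obtain Y where Y: "Y \<in> V" "\<And>w. (Y, w) \<in> D \<Longrightarrow> w \<notin> V"
        using wfE_min[OF wf] False by (metis converse_iff ex_in_conv)
      then have sink: "\<And>w. (Y, w) \<notin> D" using psubset(3) by (auto simp: dags_def)
      have "{(u, v) \<in> D. v \<noteq> Y} \<in> dags (V - {Y})"
        using psubset(3) sink by (auto simp: dags_def intro: acyclic_subset)
      then obtain f :: "'v \<Rightarrow> nat" where f: "inj_on f (V - {Y})" "\<forall>(u, v) \<in> {(u, v) \<in> D. v \<noteq> Y}. f u < f v"
        using psubset.IH[of "V - {Y}"] Y by blast
      define g where "g = f(Y := Suc (\<Sum>v\<in>V. f v))"
      have lt: "f v < g Y" if "v \<in> V" for v
        using that psubset(1) by (auto simp: g_def less_Suc_eq_le intro: member_le_sum)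
      have "inj_on g V"
      proof (rule inj_onI)
        fix u v assume uv: "u \<in> V" "v \<in> V" "g u = g v"
        have "g w = f w" if "w \<noteq> Y" for w using that by (simp add: g_def)
        then show "u = v" using uv lt[of u] lt[of v] f(1) Y(1)
          by (cases "u = Y"; cases "v = Y") (auto dest: inj_onD)
      qed
      moreover have "g u < g v" if "(u, v) \<in> D" for u v
        using that f(2) lt[of u] sink psubset(3) by (auto simp: g_def dags_def split: if_splits)
      ultimately show ?thesis by auto
    qed
  qed
  then show ?thesis using that by blast
qed

text \<open>For acyclicity after a reversal: a cycle through the reversed edge needs a second
  directed path from \<open>u\<close> to \<open>v\<close>, which enters \<open>v\<close> through
  another parent.\<close>

lemma rtrancl_avoid_edge:
  assumes "(u, v) \<in> (G - {(u, v)})\<^sup>*" "u \<noteq> v"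
  obtains x where "(x, v) \<in> G" "x \<noteq> u" "(u, x) \<in> G\<^sup>*"
proof -
  from assms obtain x where "(u, x) \<in> (G - {(u, v)})\<^sup>*" "(x, v) \<in> G - {(u, v)}"
    by (auto elim: rtranclE)
  moreover from this have "(u, x) \<in> G\<^sup>*" using rtrancl_mono[of "G - {(u, v)}" G] by auto
  ultimately show ?thesis using that by auto
qed

text \<open>\<open>D\<close> is the first proper descendant of \<open>Y\<close> in the order of \<open>K\<close>, and \<open>Z\<close> is a minimal child of \<open>Y\<close> with
  descendant \<open>D\<close>. Completing the parents of \<open>Y\<close> and \<open>Z\<close> to each other makes \<open>Y \<rightarrow> Z\<close> covered, so that
  it can be reversed.\<close>

lemma make_sink_step:
  fixes f :: "'v \<Rightarrow> nat"
  assumes V: "finite V" "Y \<in> V" and U: "U = V - {Y}"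
    and K: "K \<in> dags U" "inj_on f U" "\<forall>(u, v)\<in>K. f u < f v"
    and G: "G \<in> dags V" and le: "conn_le U G K"
    and P: "\<forall>N. adjacent G N Y \<longrightarrow> N \<in> P"
      "\<forall>X Z. (X, Z) \<in> G \<longrightarrow> (Y, Z) \<in> G \<longrightarrow> X \<in> insert Y P"
    and child: "(Y, w) \<in> G"
  obtains G' Z where "(G, G') \<in> (graph_step V)\<^sup>*" "G' \<in> dags V" "conn_le U G' K"
    "\<forall>N. adjacent G' N Y \<longrightarrow> N \<in> P" "\<forall>X Z. (X, Z) \<in> G' \<longrightarrow> (Y, Z) \<in> G' \<longrightarrow> X \<in> insert Y P"
    "(Y, Z) \<in> G" "{z. (Y, z) \<in> G'} = {z. (Y, z) \<in> G} - {Z}"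
proof -
  have ac: "acyclic G" and GV: "G \<subseteq> V \<times> V" using G by (auto simp: dags_def)
  have irr: "(v, v) \<notin> G\<^sup>+" for v using ac by (auto simp: acyclic_def)
  define R where "R = {r. (Y, r) \<in> G\<^sup>+}"
  have RV: "R \<subseteq> V" using GV by (auto simp: R_def dest: tranclD2)
  have "w \<in> R" using child by (auto simp: R_def)
  then obtain D where D: "D \<in> R" "\<And>r. r \<in> R \<Longrightarrow> f D \<le> f r"
    using Min_in[of "f ` R"] Min_le[of "f ` R"] finite_subset[OF RV V(1)] by fastforce
  define Zs where "Zs = {z. (Y, z) \<in> G \<and> (z, D) \<in> G\<^sup>*}"
  have "Zs \<noteq> {}" using D(1) by (auto simp: R_def Zs_def dest: tranclD)
  moreover have "wf (G\<^sup>+)" using finite_acyclic_wf[OF finite_dag[OF V(1) G] ac] wf_trancl by blast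
  ultimately obtain Z where Z: "Z \<in> Zs" "\<And>z. (z, Z) \<in> G\<^sup>+ \<Longrightarrow> z \<notin> Zs"
    by (metis wfE_min ex_in_conv)
  have YZ: "(Y, Z) \<in> G" "(Z, D) \<in> G\<^sup>*" using Z(1) by (auto simp: Zs_def)
  have YneZ: "Y \<noteq> Z" using YZ(1) irr by auto
  have ZV: "Z \<in> V" using YZ GV by auto
  \<comment> \<open>A parent \<open>X\<close> of \<open>Z\<close> below \<open>Y\<close> would lie
    below some child \<open>z\<close> of \<open>Y\<close>, and this \<open>z\<close> would be a
    member of \<open>Zs\<close> above \<open>Z\<close>. The absence of such parents keeps the
    completion acyclic.\<close>
  have noXY: "(Y, X) \<notin> G\<^sup>+" if "(X, Z) \<in> G" for X
  proof
    assume "(Y, X) \<in> G\<^sup>+"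
    then obtain z where z: "(Y, z) \<in> G" "(z, X) \<in> G\<^sup>*" by (auto dest: tranclD)
    then have "(z, Z) \<in> G\<^sup>+" using that by (meson rtrancl_into_trancl1)
    moreover from this have "z \<in> Zs" using z YZ by (auto simp: Zs_def dest: trancl_into_rtrancl)
    ultimately show False using Z(2) by auto
  qed
  \<comment> \<open>\<open>G1\<close> gives \<open>Z\<close> all parents of \<open>Y\<close>, and
    \<open>G2\<close> gives \<open>Y\<close> all other parents of \<open>Z\<close>. The first
    addition is harmless on \<open>U\<close>, being a shortcut through the unconditioned
    \<open>Y\<close>; the second one is where the choice of \<open>D\<close> and \<open>Z\<close> is
    needed.\<close>
  define G1 where "G1 = G \<union> {(X, Z) | X. (X, Y) \<in> G}"
  have "{(X, Z) | X. (X, Y) \<in> G} \<subseteq> G\<^sup>+" using YZ(1) by (auto intro: trancl_into_trancl)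
  then have G1sub: "G \<subseteq> G1" "G1 \<subseteq> G\<^sup>+" by (auto simp: G1_def)
  then have tr1: "G1\<^sup>+ = G\<^sup>+" 
    by (metis subset_antisym trancl_mono_subset trancl_id trans_trancl)
  have G1e: "(u, v) \<in> G1 \<longleftrightarrow> (u, v) \<in> G \<or> v = Z \<and> (u, Y) \<in> G" for u v by (auto simp: G1_def)
  have le1: "conn_le U G1 K" unfolding G1_def using conn_le_shortcut[OF le _ YZ(1)] U by auto
  have ac1: "acyclic G1" using irr tr1 by (simp add: acyclic_def)
  have G1V: "G1 \<subseteq> V \<times> V" using GV ZV by (auto simp: G1_def)
  have noXY1: "(Y, X) \<notin> G1\<^sup>+" if "(X, Z) \<in> G1" for X
    using that noXY irr unfolding tr1 G1e by (meson trancl_into_trancl)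
  define G2 where "G2 = G1 \<union> {(X, Y) | X. X \<in> {X. (X, Z) \<in> G1 \<and> X \<noteq> Y}}"
  have G2e: "(u, v) \<in> G2 \<longleftrightarrow> (u, v) \<in> G1 \<or> v = Y \<and> (u, Z) \<in> G1 \<and> u \<noteq> Y" for u v by (auto simp: G2_def)
  have le2: "conn_le U G2 K"
  proof (rule conn_le_add_parents[OF _ _ ac1 _ _ _ _ _ K(2) _ le1 _ _ _ G2_def])
    show "G1 \<subseteq> insert Y U \<times> insert Y U" using G1V U V by auto
    show "(Y, Z) \<in> G1" using YZ G1e by simp
    show "\<And>X. (X, Y) \<in> G1 \<Longrightarrow> (X, Z) \<in> G1" using YneZ by (auto simp: G1e)
    show "(Z, D) \<in> G1\<^sup>*" using YZ(2) rtrancl_mono[OF G1sub(1)] by auto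
    show "\<And>r. (Y, r) \<in> G1\<^sup>+ \<Longrightarrow> f D \<le> f r" using D by (simp add: tr1 R_def)
    show "\<And>X. (X, Z) \<in> G1 \<Longrightarrow> X \<noteq> Y \<Longrightarrow> (Y, X) \<notin> G1\<^sup>+" using noXY1 by auto
  qed (use V U K in \<open>auto simp: dags_def\<close>)
  have G2V: "G2 \<subseteq> V \<times> V" using G1V V by (auto simp: G2_def)
  have tr2: "(u, v) \<in> G2\<^sup>* \<Longrightarrow> (u, v) \<in> G1\<^sup>* \<or> (\<exists>X. (X, Z) \<in> G1 \<and> X \<noteq> Y \<and> (u, X) \<in> G1\<^sup>* \<and> (Y, v) \<in> G1\<^sup>*)" for u v
    using rtrancl_add_parents[of u v G1 Y] unfolding G2_def by blast
  have noXY2: "(Y, X) \<notin> G2\<^sup>*" if "(X, Z) \<in> G1" "X \<noteq> Y" for X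
    using tr2[of Y X] noXY1 that by (metis rtranclD)
  have ac2: "acyclic G2"
  proof (rule acyclicI, intro allI notI)
    fix v assume "(v, v) \<in> G2\<^sup>+"
    then obtain u where u: "(v, u) \<in> G2\<^sup>*" "(u, v) \<in> G2" by (meson tranclD2)
    show False
    proof (cases "(u, v) \<in> G1")
      case True
      from tr2[OF u(1)] show False
      proof
        assume "(v, u) \<in> G1\<^sup>*"
        then show False using True ac1 by (meson acyclic_def rtrancl_into_trancl1)
      next
        assume "\<exists>X. (X, Z) \<in> G1 \<and> X \<noteq> Y \<and> (v, X) \<in> G1\<^sup>* \<and> (Y, u) \<in> G1\<^sup>*"
        then obtain X where "(X, Z) \<in> G1" "(v, X) \<in> G1\<^sup>*" "(Y, u) \<in> G1\<^sup>*" by auto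
        then show False using noXY1 True by (meson rtrancl_into_trancl1 trancl_rtrancl_trancl)
      qed
    next
      case False
      then show False using u noXY2 G2e by auto
    qed
  qed
  have G2d: "G2 \<in> dags V" using G2V ac2 by (simp add: dags_def)
  define G3 where "G3 = insert (Z, Y) (G2 - {(Y, Z)})"
  have YZ2: "(Y, Z) \<in> G2" using YZ G1e G2e by simp
  have pa: "{u. (u, Z) \<in> G2} = insert Y {u. (u, Y) \<in> G2}"
  proof -
    have "(u, Z) \<in> G2 \<longleftrightarrow> u = Y \<or> (u, Y) \<in> G2" for u
      using YneZ YZ irr by (auto simp: G2e G1e)
    then show ?thesis by auto
  qed
  have "acyclic G3"
  proof -
    have "(Y, Z) \<notin> (G2 - {(Y, Z)})\<^sup>*"
    proof
      assume "(Y, Z) \<in> (G2 - {(Y, Z)})\<^sup>*"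
      then obtain x where "(x, Z) \<in> G2" "x \<noteq> Y" "(Y, x) \<in> G2\<^sup>*"
        using rtrancl_avoid_edge YneZ by metis
      then show False using noXY2 G2e YneZ by auto
    qed
    then show ?thesis using ac2 by (auto simp: G3_def intro: acyclic_subset)
  qed
  then have G3d: "G3 \<in> dags V" using G2V V ZV by (auto simp: dags_def G3_def)
  have s3: "(G2, G3) \<in> graph_step V"
    using graph_step_reverse[OF G2d G3d YZ2 pa G3_def] .
  have ZY2: "(Z, Y) \<notin> G2" using YZ2 ac2 by (meson acyclic_def r_into_trancl trancl_trans)
  \<comment> \<open>The reversed edge is covered in \<open>G3\<close> too, so reversing it back
    shows that \<open>G3\<close> has no d-connection beyond those of \<open>G2\<close>.\<close>
  have "G2 = insert (Y, Z) (G3 - {(Z, Y)})" "(Z, Y) \<in> G3" using YZ2 ZY2 YneZ by (auto simp: G3_def)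
  moreover have "{u. (u, Y) \<in> G3} = insert Z {u. (u, Z) \<in> G3}"
    using pa YneZ ac2 by (auto simp: G3_def acyclic_def)
  ultimately have "(G3, G2) \<in> graph_step V" using graph_step_reverse G2d G3d by metis
  then have le3: "conn_le U G3 K" using conn_le_trans[OF graph_step_conn_le le2] by blast
  have "(G, G2) \<in> (graph_step V)\<^sup>*"
    using G1sub G2_def G2d V(1) by (intro graph_steps_supergraph) auto
  then have steps: "(G, G3) \<in> (graph_step V)\<^sup>*" using s3 by (rule rtrancl_into_rtrancl)
  have YneY: "(Y, Y) \<notin> G" using irr by auto
  have G3e: "(u, v) \<in> G3 \<longleftrightarrow> ((u, v) \<in> G \<and> (u, v) \<noteq> (Y, Z)) \<or> v = Z \<and> (u, Y) \<in> G \<or>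
      v = Y \<and> (u, Z) \<in> G \<and> u \<noteq> Y \<or> (u, v) = (Z, Y)" for u v
    using YneZ YneY by (auto simp: G3_def G2e G1e)
  have ZP: "Z \<in> P" using P(1) YZ(1) by (auto simp: adjacent_def)
  show ?thesis
  proof (rule that[OF steps G3d le3])
    \<comment> \<open>New neighbours of \<open>Y\<close> were parents of its child \<open>Z\<close>,
      and \<open>P\<close> was assumed to contain the other parents of children of \<open>Y\<close>.
      So the neighbourhood of \<open>Y\<close> never outgrows \<open>P\<close> while children are
      turned into parents.\<close>
    show "\<forall>N. adjacent G3 N Y \<longrightarrow> N \<in> P"
      using P ZP YZ YneY YneZ unfolding adjacent_def G3e by blast
    show "\<forall>X z. (X, z) \<in> G3 \<longrightarrow> (Y, z) \<in> G3 \<longrightarrow> X \<in> insert Y P"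
      using P YneZ YneY unfolding G3e adjacent_def by blast
    show "(Y, Z) \<in> G" by fact
    show "{z. (Y, z) \<in> G3} = {z. (Y, z) \<in> G} - {Z}" using YneZ YneY by (auto simp: G3e)
  qed
qed

text \<open>Each application of \<open>make_sink_step\<close> removes exactly one child of
  \<open>Y\<close> and adds none, so it terminates with a sink.\<close>

lemma make_sink:
  fixes f :: "'v \<Rightarrow> nat"
  assumes V: "finite V" "Y \<in> V" and U: "U = V - {Y}"
    and K: "K \<in> dags U" "inj_on f U" "\<forall>(u, v)\<in>K. f u < f v"
    and G: "G \<in> dags V" and le: "conn_le U G K"
    and P: "\<forall>N. adjacent G N Y \<longrightarrow> N \<in> P"
      "\<forall>X Z. (X, Z) \<in> G \<longrightarrow> (Y, Z) \<in> G \<longrightarrow> X \<in> insert Y P"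
  obtains G' where "(G, G') \<in> (graph_step V)\<^sup>*" "G' \<in> dags V" "conn_le U G' K"
    "\<And>N. (N, Y) \<in> G' \<Longrightarrow> N \<in> P" "\<And>w. (Y, w) \<notin> G'"
proof -
  have "\<exists>G'. (G, G') \<in> (graph_step V)\<^sup>* \<and> G' \<in> dags V \<and> conn_le U G' K \<and>
    (\<forall>N. (N, Y) \<in> G' \<longrightarrow> N \<in> P) \<and> (\<forall>w. (Y, w) \<notin> G')"
    using G le P
  proof (induction "card {z. (Y, z) \<in> G}" arbitrary: G rule: less_induct)
    case less
    show ?case
    proof (cases "\<exists>w. (Y, w) \<in> G")
      case False
      then show ?thesis using less.prems by (intro exI[of _ G]) (auto simp: adjacent_def)
    next
      case True
      then obtain w where "(Y, w) \<in> G" by blast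
      from make_sink_step[OF V U K less.prems this] obtain G' Z where G':
        "(G, G') \<in> (graph_step V)\<^sup>*" "G' \<in> dags V" "conn_le U G' K"
        "\<forall>N. adjacent G' N Y \<longrightarrow> N \<in> P" "\<forall>X Z. (X, Z) \<in> G' \<longrightarrow> (Y, Z) \<in> G' \<longrightarrow> X \<in> insert Y P"
        "(Y, Z) \<in> G" "{z. (Y, z) \<in> G'} = {z. (Y, z) \<in> G} - {Z}" by blast
      have "{z. (Y, z) \<in> G} \<subseteq> V" using less.prems(1) by (auto simp: dags_def)
      then have "finite {z. (Y, z) \<in> G}" using V(1) finite_subset by blast
      then have "card {z. (Y, z) \<in> G'} < card {z. (Y, z) \<in> G}"
        unfolding G'(7) using G'(6) by (intro card_Diff1_less) auto
      from less.hyps[OF this G'(2-5)] show ?thesis using G'(1) by (meson rtrancl_trans)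
    qed
  qed
  then show ?thesis using that by blast
qed

text \<open>Vertices other than \<open>Y\<close> keep their parents, so covered edges stay covered,
  and a sink closes no cycle.\<close>

lemma graph_step_add_sink:
  assumes Y: "Y \<in> V" and P: "P \<subseteq> V - {Y}" and st: "(D, D') \<in> graph_step (V - {Y})"
  shows "(D \<union> P \<times> {Y}, D' \<union> P \<times> {Y}) \<in> graph_step V"
proof -
  have dag: "D \<union> P \<times> {Y} \<in> dags V" if "D \<in> dags (V - {Y})" for D
  proof -
    have DV: "D \<subseteq> (V - {Y}) \<times> (V - {Y})" "acyclic D" using that by (auto simp: dags_def)
    have "(u, v) \<in> (D \<union> P \<times> {Y})\<^sup>+ \<Longrightarrow> u \<noteq> Y \<and> (v \<noteq> Y \<longrightarrow> (u, v) \<in> D\<^sup>+)" for u v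
      by (induction rule: trancl_induct) (use DV P in \<open>auto intro: trancl_into_trancl\<close>)
    then have "acyclic (D \<union> P \<times> {Y})" using DV(2) by (auto simp: acyclic_def)
    then show ?thesis using DV P Y by (auto simp: dags_def)
  qed
  from st have D: "D \<in> dags (V - {Y})" "D' \<in> dags (V - {Y})" by (auto simp: graph_step_def)
  from st consider e where "D' = insert e D"
    | x y where "(x, y) \<in> D" "{u. (u, y) \<in> D} = insert x {u. (u, x) \<in> D}"
      "D' = insert (y, x) (D - {(x, y)})"
    by (auto simp: graph_step_def)
  then show ?thesis
  proof cases
    case 1
    then have "D' \<union> P \<times> {Y} = insert e (D \<union> P \<times> {Y})" by auto
    then show ?thesis using dag D unfolding graph_step_def by blast
  next
    case 2
    then have xy: "x \<noteq> Y" "y \<noteq> Y" using D by (auto simp: dags_def)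
    show ?thesis
    proof (rule graph_step_reverse[OF dag[OF D(1)] dag[OF D(2)]])
      show "(x, y) \<in> D \<union> P \<times> {Y}" using 2(1) by simp
      show "{u. (u, y) \<in> D \<union> P \<times> {Y}} = insert x {u. (u, x) \<in> D \<union> P \<times> {Y}}" using 2(2) xy by auto
      show "D' \<union> P \<times> {Y} = insert (y, x) (D \<union> P \<times> {Y} - {(x, y)})" using 2(3) xy by auto
    qed
  qed
qed

lemma graph_steps_add_sink:
  assumes "Y \<in> V" "P \<subseteq> V - {Y}" "(D, D') \<in> (graph_step (V - {Y}))\<^sup>*"
  shows "(D \<union> P \<times> {Y}, D' \<union> P \<times> {Y}) \<in> (graph_step V)\<^sup>*"
  using assms(3)
proof (induction rule: rtrancl_induct)
  case (step D' D'')
  then show ?case using graph_step_add_sink[OF assms(1,2)] by (meson rtrancl_into_rtrancl)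
qed simp

text \<open>\<open>Y\<close> is last in an order of \<open>H\<close>, so \<open>H\<close> consists
  of a DAG \<open>K\<close> on \<open>V - {Y}\<close> and the edges from \<open>P\<close> to
  \<open>Y\<close>. Once \<open>Y\<close> is a sink of \<open>G\<close> with parents inside
  \<open>P\<close>, its parents are completed to \<open>P\<close>, and the induction hypothesis
  transforms the rest into \<open>K\<close> beside the unchanged sink.\<close>

theorem conn_le_graph_steps:
  assumes "finite V" "G \<in> dags V" "H \<in> dags V" "conn_le V G H"
  shows "(G, H) \<in> (graph_step V)\<^sup>*"
  using assms
proof (induction "card V" arbitrary: V G H)
  case 0
  then show ?case by (auto simp: dags_def)
next
  case (Suc n)
  obtain f :: "'a \<Rightarrow> nat" where f: "inj_on f V" "\<And>u v. (u, v) \<in> H \<Longrightarrow> f u < f v"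
    using dag_topological Suc.prems by metis
  have "V \<noteq> {}" using Suc by auto
  then obtain Y where Y: "Y \<in> V" "\<And>u. u \<in> V \<Longrightarrow> f u \<le> f Y"
    using Max_in[of "f ` V"] Max_ge[of "f ` V"] Suc.prems(1) by fastforce
  have sink: "(Y, w) \<notin> H" for w
    using Y(2) Suc.prems(3) f(2) by (fastforce simp: dags_def)
  define U where "U = V - {Y}"
  define K where "K = {(u, v) \<in> H. v \<noteq> Y}"
  define P where "P = {u. (u, Y) \<in> H}"
  have HV: "H \<subseteq> V \<times> V" and GV: "G \<subseteq> V \<times> V" and irrG: "(v, v) \<notin> G" for v
    using Suc.prems by (auto simp: dags_def acyclic_def)
  have PU: "P \<subseteq> U" using sink HV by (auto simp: P_def U_def)
  have HK: "H = K \<union> P \<times> {Y}" by (auto simp: K_def P_def)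
  have K: "K \<in> dags U"
    using Suc.prems(3) sink by (auto simp: K_def U_def dags_def intro: acyclic_subset)
  \<comment> \<open>A sink of \<open>H\<close> that is not conditioned on is a dead end of the
    search, so it can be deleted.\<close>
  have leK: "conn H C a b \<Longrightarrow> conn K C a b" if "C \<subseteq> U" "b \<noteq> Y" "a \<noteq> Y" for C a b
  proof -
    have "v \<noteq> Y \<and> reach K C a v d \<or> v = Y \<and> d" if "reach H C a v d" for v d using that
    proof induction
      case (up v u)
      then have "(u, v) \<in> K" "reach K C a v False" by (auto simp: K_def)
      moreover from this have "u \<noteq> Y" using sink by (auto simp: K_def)
      ultimately show ?case using reach.up[of K C a v u] up(2) by simp
    next
      case (down v d w)
      then have v: "reach K C a v d" using sink by auto
      show ?case using reach.down[OF v down(2), of w] down(3) by (auto simp: K_def)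
    next
      case (collide v u)
      obtain c where c: "c \<in> C" "(v, c) \<in> H\<^sup>*" using collide by (auto simp: anc_def)
      have "(v, x) \<in> K\<^sup>* \<or> x = Y" if "(v, x) \<in> H\<^sup>*" for x using that
        by (induction rule: rtrancl_induct) (use sink in \<open>auto simp: K_def intro: rtrancl_into_rtrancl\<close>)
      then have "(v, c) \<in> K\<^sup>*" using c \<open>C \<subseteq> U\<close> by (auto simp: U_def)
      moreover have "v \<noteq> Y" using c \<open>C \<subseteq> U\<close> sink by (auto simp: U_def elim: converse_rtranclE)
      ultimately have "v \<in> anc K C" "(u, v) \<in> K" "reach K C a v True"
        using collide c by (auto simp: K_def anc_def)
      moreover from this have "u \<noteq> Y" using sink by (auto simp: K_def)
      ultimately show ?case using reach.collide[of K C a v u] by simp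
    next
      case start
      show ?case using \<open>a \<noteq> Y\<close> reach.start[of K C a] by simp
    qed
    then show "conn H C a b \<Longrightarrow> conn K C a b" using \<open>b \<noteq> Y\<close> unfolding conn_def by blast
  qed
  have le: "conn_le U G K"
    unfolding conn_le_def
  proof (intro allI impI)
    fix C a b assume "C \<subseteq> U" "a \<in> U - C" "b \<in> U - C" "a \<noteq> b" "conn G C a b"
    then show "conn K C a b"
      using conn_leD[OF Suc.prems(4), of C a b] leK[of C b a] by (auto simp: U_def)
  qed
  \<comment> \<open>\<open>G\<close> inherits the local Markov property of \<open>H\<close> at
    \<open>Y\<close>: whatever \<open>G\<close> connects with \<open>Y\<close> given
    \<open>P\<close> belongs to \<open>P\<close>. Neighbours of \<open>Y\<close> are connected in
    this way, and so are the other parents of its children, as these children lie in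
    \<open>P\<close>.\<close>
  have sepP: "x \<in> P" if "conn G P Y x" "x \<in> V" "x \<noteq> Y" for x
  proof (rule ccontr)
    assume "x \<notin> P"
    then have "conn H P Y x" using conn_leD[OF Suc.prems(4) that(1)] that PU Y by (auto simp: U_def)
    moreover have "(Y, x) \<notin> H\<^sup>*" using sink that by (auto elim: converse_rtranclE)
    ultimately show False
      using not_conn_parents[of H Y x] Suc.prems(3) \<open>x \<notin> P\<close> by (auto simp: P_def dags_def)
  qed
  have YP: "Y \<notin> P" using PU by (auto simp: U_def)
  have s0: "reach G P Y Y False" by (rule reach.start)
  have P1: "\<forall>N. adjacent G N Y \<longrightarrow> N \<in> P"
  proof (intro allI impI)
    fix N assume that: "adjacent G N Y"
    have "conn G P Y N" using that reach.up[OF s0 YP] reach.down[OF s0 YP]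
      unfolding conn_def adjacent_def by blast
    then show "N \<in> P" using sepP that GV irrG by (auto simp: adjacent_def)
  qed
  have P2: "\<forall>X Z. (X, Z) \<in> G \<longrightarrow> (Y, Z) \<in> G \<longrightarrow> X \<in> insert Y P"
  proof (intro allI impI)
    fix X Z assume that: "(X, Z) \<in> G" "(Y, Z) \<in> G"
    have "Z \<in> P" using P1 that by (auto simp: adjacent_def)
    then have "Z \<in> anc G P" using subset_anc by fastforce
    then have "reach G P Y X False"
      using reach.collide[OF reach.down[OF s0 YP that(2)] _ that(1)] by simp
    then show "X \<in> insert Y P" using sepP[of X] that GV by (auto simp: conn_def)
  qed
  have fU: "inj_on f U" using f(1) by (auto simp: U_def inj_on_def)
  have fK: "\<forall>(u, v)\<in>K. f u < f v" using f(2) by (auto simp: K_def)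
  obtain G' where G': "(G, G') \<in> (graph_step V)\<^sup>*" "G' \<in> dags V" "conn_le U G' K"
    "\<And>N. (N, Y) \<in> G' \<Longrightarrow> N \<in> P" "\<And>w. (Y, w) \<notin> G'"
    using make_sink[OF Suc.prems(1) Y(1) U_def K fU fK Suc.prems(2) le P1 P2] by blast
  define G0 where "G0 = {(u, v) \<in> G'. v \<noteq> Y}"
  have G0: "G0 \<in> dags U" using G'(2,5) by (auto simp: G0_def U_def dags_def intro: acyclic_subset)
  have "conn_le U G0 K"
    by (rule conn_le_trans[OF conn_le_mono G'(3)]) (auto simp: G0_def)
  then have "(G0, K) \<in> (graph_step U)\<^sup>*"
    using Suc.hyps(1)[of U G0 K] Suc.hyps(2) Suc.prems(1) Y(1) G0 K by (simp add: U_def)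
  then have s: "(G0 \<union> P \<times> {Y}, H) \<in> (graph_step V)\<^sup>*"
    unfolding HK using Y(1) PU graph_steps_add_sink by (metis U_def)
  have "G0 \<union> P \<times> {Y} \<in> dags V"
    using s Suc.prems(3) by (cases rule: converse_rtranclE) (auto simp: graph_step_def)
  moreover have "G' \<subseteq> G0 \<union> P \<times> {Y}" using G'(4) by (auto simp: G0_def)
  ultimately have "(G', G0 \<union> P \<times> {Y}) \<in> (graph_step V)\<^sup>*"
    using graph_steps_supergraph Suc.prems(1) by blast
  then show ?case using G'(1) s by (meson rtrancl_trans)
qed

section \<open>Open walks and active trails\<close>

definition collider :: "('v \<times> 'v) set \<Rightarrow> 'v \<Rightarrow> 'v \<Rightarrow> 'v \<Rightarrow> bool" where
  "collider D x y z \<longleftrightarrow> (x, y) \<in> D \<and> (z, y) \<in> D"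

definition open_at :: "('v \<times> 'v) set \<Rightarrow> 'v set \<Rightarrow> 'v \<Rightarrow> 'v \<Rightarrow> 'v \<Rightarrow> bool" where
  "open_at D C x y z \<longleftrightarrow> (if collider D x y z then y \<in> anc D C else y \<notin> C)"

fun open_walk :: "('v \<times> 'v) set \<Rightarrow> 'v set \<Rightarrow> 'v list \<Rightarrow> bool" where
  "open_walk D C (x # y # z # p) \<longleftrightarrow> adjacent D x y \<and> open_at D C x y z \<and> open_walk D C (y # z # p)"
| "open_walk D C [x, y] \<longleftrightarrow> adjacent D x y"
| "open_walk D C _ \<longleftrightarrow> True"

fun colliders :: "('v \<times> 'v) set \<Rightarrow> 'v list \<Rightarrow> nat" where
  "colliders D (x # y # z # p) = (if collider D x y z then 1 else 0) + colliders D (y # z # p)"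
| "colliders D _ = 0"

lemma collider_sym: "collider D x y z = collider D z y x"
  by (auto simp: collider_def)

lemma open_at_sym: "open_at D C x y z = open_at D C z y x"
  by (simp add: open_at_def collider_sym)

lemma adjacent_sym: "adjacent D x y = adjacent D y x"
  by (auto simp: adjacent_def)

lemma open_walk_append:
  "open_walk D C (xs @ v # ys) \<longleftrightarrow> open_walk D C (xs @ [v]) \<and> open_walk D C (v # ys) \<and>
     (xs \<noteq> [] \<longrightarrow> ys \<noteq> [] \<longrightarrow> open_at D C (last xs) v (hd ys))"
proof (induction xs)
  case Nil
  then show ?case by simp
next
  case (Cons x xs)
  show ?case
  proof (cases xs)
    case Nil
    then show ?thesis by (cases ys) auto
  next
    case (Cons x' xs')
    then show ?thesis using Cons.IH by (cases xs') auto
  qed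
qed

lemma colliders_append:
  "colliders D (xs @ v # ys) = colliders D (xs @ [v]) + colliders D (v # ys) +
     (if xs \<noteq> [] \<and> ys \<noteq> [] \<and> collider D (last xs) v (hd ys) then 1 else 0)"
proof (induction xs)
  case Nil
  then show ?case by simp
next
  case (Cons x xs)
  show ?case
  proof (cases xs)
    case Nil
    then show ?thesis by (cases ys) auto
  next
    case (Cons x' xs')
    then show ?thesis using Cons.IH by (cases xs') auto
  qed
qed

lemma open_walk_rev: "open_walk D C (rev p) = open_walk D C p"
proof (induction p)
  case (Cons x p)
  show ?case
  proof (cases p)
    case (Cons y q)
    then have "open_walk D C (rev (x # p)) = open_walk D C (rev q @ y # [x])" by simp
    also have "\<dots> \<longleftrightarrow> open_walk D C p \<and> adjacent D x y \<and> (q \<noteq> [] \<longrightarrow> open_at D C x y (hd q))"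
      unfolding open_walk_append[of D C "rev q" y "[x]"]
      using Cons.IH Cons by (auto simp: last_rev adjacent_sym open_at_sym)
    also have "\<dots> = open_walk D C (x # p)" using Cons by (cases q) auto
    finally show ?thesis .
  qed simp
qed simp

lemma colliders_rev: "colliders D (rev p) = colliders D p"
proof (induction p)
  case (Cons x p)
  show ?case
  proof (cases p)
    case (Cons y q)
    then have "colliders D (rev (x # p)) = colliders D (rev q @ y # [x])" by simp
    also have "\<dots> = colliders D p + (if q \<noteq> [] \<and> collider D x y (hd q) then 1 else 0)"
      unfolding colliders_append[of D "rev q" y "[x]"]
      using Cons.IH Cons by (auto simp: last_rev collider_sym)
    also have "\<dots> = colliders D (x # p)" using Cons by (cases q) auto
    finally show ?thesis .
  qed simp
qed simp

text \<open>Along the arrows from \<open>v\<close>, the first vertex at which the walk meets an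
  opposing arrow is an open collider below \<open>v\<close>. If there is none, the walk is a
  directed path.\<close>

lemma open_walk_forward:
  assumes "open_walk D C (v # y # r)" "(v, y) \<in> D"
  shows "(v, last (y # r)) \<in> D\<^sup>+ \<or> (v \<in> anc D C \<and> 1 \<le> colliders D (v # y # r))"
  using assms
proof (induction r arbitrary: v y)
  case (Cons z r)
  show ?case
  proof (cases "(z, y) \<in> D")
    case True
    then have "y \<in> anc D C" "collider D v y z" using Cons.prems by (auto simp: open_at_def collider_def)
    then show ?thesis using anc_parent[OF _ Cons.prems(2)] by auto
  next
    case False
    then have "(y, z) \<in> D" using Cons.prems by (cases r) (auto simp: adjacent_def)
    then have "(y, last (z # r)) \<in> D\<^sup>+ \<or> (y \<in> anc D C \<and> 1 \<le> colliders D (y # z # r))"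
      using Cons by auto
    then show ?thesis
    proof
      assume "(y, last (z # r)) \<in> D\<^sup>+"
      then show ?thesis using Cons.prems(2) by (auto intro: trancl_into_trancl2)
    next
      assume "y \<in> anc D C \<and> 1 \<le> colliders D (y # z # r)"
      then show ?thesis using anc_parent[OF _ Cons.prems(2)] by auto
    qed
  qed
qed auto

lemma reach_open_walk:
  assumes "acyclic D" "reach D C a v d"
  shows "\<exists>p. p \<noteq> [] \<and> hd p = a \<and> last p = v \<and> open_walk D C p \<and>
    (p = [a] \<and> \<not> d \<or> (\<exists>q u. p = q @ [u, v] \<and> (if d then (u, v) \<in> D else (v, u) \<in> D)))"
  using assms(2)
proof induction
  case start
  then show ?case by (intro exI[of _ "[a]"]) auto
next
  case (up v u)
  then obtain p where p: "p \<noteq> []" "hd p = a" "last p = v" "open_walk D C p"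
    "p = [a] \<or> (\<exists>q u. p = q @ [u, v] \<and> (v, u) \<in> D)" by auto
  have asym: "(x, y) \<in> D \<Longrightarrow> (y, x) \<notin> D" for x y
    using assms(1) by (meson acyclic_def r_into_trancl trancl_trans)
  from p(5) have "open_walk D C (p @ [u])"
  proof
    assume "p = [a]"
    then show ?thesis using p up by (auto simp: adjacent_def)
  next
    assume "\<exists>q u. p = q @ [u, v] \<and> (v, u) \<in> D"
    then obtain q t where q: "p = q @ [t, v]" "(v, t) \<in> D" by auto
    then have "open_at D C t v u" using up asym by (auto simp: open_at_def collider_def)
    then show ?thesis using open_walk_append[of D C "q @ [t]" v "[u]"] p q up by (auto simp: adjacent_def)
  qed
  moreover obtain q where "p = q @ [v]" using p by (metis append_butlast_last_id)
  moreover have "hd (p @ [u]) = a" using p by simp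
  ultimately show ?case using up(3) by (intro exI[of _ "p @ [u]"]) auto
next
  case (down v d w)
  then obtain p where p: "p \<noteq> []" "hd p = a" "last p = v" "open_walk D C p" by auto
  have asym: "(x, y) \<in> D \<Longrightarrow> (y, x) \<notin> D" for x y
    using assms(1) by (meson acyclic_def r_into_trancl trancl_trans)
  obtain q where q: "p = q @ [v]" using p by (metis append_butlast_last_id)
  have "open_at D C (last q) v w" using down asym by (auto simp: open_at_def collider_def)
  then have "open_walk D C (p @ [w])"
    using open_walk_append[of D C q v "[w]"] p q down by (auto simp: adjacent_def)
  moreover have "hd (p @ [w]) = a" using p by simp
  ultimately show ?case using q down(3) by (intro exI[of _ "p @ [w]"]) auto
next
  case (collide v u)
  then obtain p where p: "p \<noteq> []" "hd p = a" "last p = v" "open_walk D C p"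
    "\<exists>q t. p = q @ [t, v] \<and> (t, v) \<in> D" by auto
  then obtain q t where q: "p = q @ [t, v]" "(t, v) \<in> D" by blast
  then have "open_at D C t v u" using collide by (auto simp: open_at_def collider_def)
  then have "open_walk D C (p @ [u])"
    using open_walk_append[of D C "q @ [t]" v "[u]"] p q collide by (auto simp: adjacent_def)
  moreover have "hd (p @ [u]) = a" using p by simp
  ultimately show ?case using q(1) collide(3) by (intro exI[of _ "p @ [u]"]) auto
qed

lemma open_walk_reach:
  assumes "acyclic D" "open_walk D C p" "p \<noteq> []" "hd p \<notin> C"
  shows "\<exists>d. reach D C (hd p) (last p) d \<and>
    (\<forall>q u. p = q @ [u, last p] \<longrightarrow> d = ((u, last p) \<in> D))"
  using assms(2-)
proof (induction p rule: rev_induct)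
  case (snoc w p)
  show ?case
  proof (cases "p = []")
    case True
    then show ?thesis using reach.start[of D C w] by auto
  next
    case False
    define v where "v = last p"
    obtain q where q: "p = q @ [v]" using False v_def by (metis append_butlast_last_id)
    have ow: "open_walk D C p" "adjacent D v w" "q \<noteq> [] \<longrightarrow> open_at D C (last q) v w"
      using snoc.prems(1) open_walk_append[of D C q v "[w]"] q by auto
    have "hd p \<notin> C" using snoc.prems False by auto
    then obtain d where d: "reach D C (hd p) v d" "\<And>q u. p = q @ [u, v] \<Longrightarrow> d = ((u, v) \<in> D)"
      using snoc.IH ow False v_def by auto
    have dq: "if q = [] then p = [v] \<and> v \<notin> C else d = ((last q, v) \<in> D)"
      using d(2)[of "butlast q" "last q"] q snoc.prems by auto
    have "reach D C (hd p) w ((v, w) \<in> D)"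
    proof (cases "q = [] \<or> \<not> collider D (last q) v w")
      case True
      then have vC: "v \<notin> C" using dq ow(3) by (auto simp: open_at_def split: if_splits)
      show ?thesis
      proof (cases "(v, w) \<in> D")
        case True
        then show ?thesis using reach.down[OF d(1) vC] by simp
      next
        case False
        then have wv: "(w, v) \<in> D" using ow(2) by (auto simp: adjacent_def)
        have "reach D C (hd p) v False"
        proof (cases "q = []")
          case True
          then show ?thesis using q reach.start[of D C v] by simp
        next
          case False
          then show ?thesis using d(1) dq True wv \<open>q = [] \<or> _\<close> by (auto simp: collider_def)
        qed
        then show ?thesis using reach.up[OF _ vC wv] False by simp
      qed
    next
      case False
      then have "v \<in> anc D C" and wv: "(w, v) \<in> D" and "d"
        using dq ow(3) by (auto simp: open_at_def collider_def)
      moreover have "(v, w) \<notin> D" using wv assms(1) by (meson acyclic_def r_into_trancl trancl_trans)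
      ultimately show ?thesis using reach.collide[of D C "hd p" v w] d(1) by simp
    qed
    moreover have "hd (p @ [w]) = hd p" using False by simp
    ultimately show ?thesis using q by auto
  qed
qed simp

definition open_walks :: "('v \<times> 'v) set \<Rightarrow> 'v set \<Rightarrow> 'v \<Rightarrow> 'v \<Rightarrow> 'v list set" where
  "open_walks D C a b = {p. p \<noteq> [] \<and> hd p = a \<and> last p = b \<and> open_walk D C p}"

text \<open>Colliders are counted before vertices: a detour along tails may lengthen a walk but
  saves colliders. The length serves to exclude repeated vertices.\<close>

definition minimal_walk :: "('v \<times> 'v) set \<Rightarrow> 'v set \<Rightarrow> 'v \<Rightarrow> 'v \<Rightarrow> 'v list \<Rightarrow> bool" where
  "minimal_walk D C a b p \<longleftrightarrow> p \<in> open_walks D C a b \<and>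
     (\<forall>q\<in>open_walks D C a b. colliders D p \<le> colliders D q \<and>
        (colliders D q = colliders D p \<longrightarrow> length p \<le> length q))"

lemma minimal_walk_exists:
  assumes "acyclic D" "conn D C a b"
  obtains p where "minimal_walk D C a b p"
proof -
  obtain p0 where "p0 \<in> open_walks D C a b"
    using assms reach_open_walk[OF assms(1)] by (fastforce simp: conn_def open_walks_def)
  then obtain p1 where p1: "p1 \<in> open_walks D C a b"
    "\<And>q. q \<in> open_walks D C a b \<Longrightarrow> colliders D p1 \<le> colliders D q"
    using ex_has_least_nat[of "\<lambda>p. p \<in> open_walks D C a b" p0 "colliders D"] by auto
  let ?Q = "\<lambda>p. p \<in> open_walks D C a b \<and> colliders D p = colliders D p1"
  obtain p where "?Q p" "\<And>q. ?Q q \<Longrightarrow> length p \<le> length q"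
    using ex_has_least_nat[of ?Q p1 length] p1 by auto
  then have "minimal_walk D C a b p" unfolding minimal_walk_def using p1 by auto
  then show ?thesis by (rule that)
qed

lemma minimal_walk_rev:
  assumes "minimal_walk D C a b p"
  shows "minimal_walk D C b a (rev p)"
proof -
  have "rev q \<in> open_walks D C x y" if "q \<in> open_walks D C y x" for x y q
    using that by (auto simp: open_walks_def open_walk_rev hd_rev last_rev)
  then show ?thesis using assms
    by (auto simp: minimal_walk_def colliders_rev) (metis colliders_rev length_rev)+
qed

text \<open>Cutting out the loop between two visits of \<open>v\<close> gives a shorter walk. The
  point is that this walk is open and has no more colliders.\<close>

lemma minimal_walk_distinct:
  assumes ac: "acyclic D" and p: "minimal_walk D C a b p"
  shows "distinct p"
proof (rule ccontr)
  assume "\<not> distinct p"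
  then obtain xs v ys zs where dec: "p = xs @ [v] @ ys @ [v] @ zs" by (metis not_distinct_decomp)
  have asym: "(x, y) \<in> D \<Longrightarrow> (y, x) \<notin> D" for x y
    using ac by (meson acyclic_def r_into_trancl trancl_trans)
  have w: "open_walk D C p" using p by (auto simp: minimal_walk_def open_walks_def)
  define q where "q = xs @ v # zs"
  have hl: "q \<noteq> []" "hd q = a" "last q = b" using p dec
    by (cases xs; cases zs; auto simp: q_def minimal_walk_def open_walks_def)+
  have e1: "p = xs @ v # (ys @ v # zs)" using dec by auto
  have hd_ys: "hd (ys @ v # zs) = hd (ys @ [v])" by (cases ys) auto
  have w1: "open_walk D C (xs @ [v])" "open_walk D C ((v # ys) @ [v])" "open_walk D C (v # zs)"
    "xs \<noteq> [] \<Longrightarrow> open_at D C (last xs) v (hd (ys @ [v]))"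
    "zs \<noteq> [] \<Longrightarrow> open_at D C (last (v # ys)) v (hd zs)"
    using w hd_ys open_walk_append[of D C xs v "ys @ v # zs"] open_walk_append[of D C "v # ys" v zs]
    unfolding e1 by auto
  have c1: "colliders D p = colliders D (xs @ [v]) + colliders D ((v # ys) @ [v]) + colliders D (v # zs)
     + (if xs \<noteq> [] \<and> collider D (last xs) v (hd (ys @ [v])) then 1 else 0)
     + (if zs \<noteq> [] \<and> collider D (last (v # ys)) v (hd zs) then 1 else 0)"
    using hd_ys colliders_append[of D xs v "ys @ v # zs"] colliders_append[of D "v # ys" v zs]
    unfolding e1 by auto
  have c2: "colliders D q = colliders D (xs @ [v]) + colliders D (v # zs)
     + (if xs \<noteq> [] \<and> zs \<noteq> [] \<and> collider D (last xs) v (hd zs) then 1 else 0)"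
    unfolding q_def by (rule colliders_append)
  have nv: "\<not> adjacent D v v" using asym by (auto simp: adjacent_def)
  then obtain y ys' where ys: "ys = y # ys'" using w1(2) by (cases ys) auto
  have adj: "adjacent D v y" using w1(2) by (cases ys') (auto simp: ys)
  have adj': "adjacent D (last ys) v"
  proof -
    have "(v # ys) @ [v] = (v # butlast ys) @ last ys # [v]" using ys by simp
    then have "open_walk D C ((v # butlast ys) @ last ys # [v])" using w1(2) by argo
    then show ?thesis using open_walk_append[of D C "v # butlast ys" "last ys" "[v]"] by simp
  qed
  \<comment> \<open>If the cut makes \<open>v\<close> a collider, either \<open>v\<close> was one at
    one of its two visits, or the loop starts with an edge out of \<open>v\<close>. In the latter
    case the loop cannot be a directed cycle, so it contains a collider, which is saved, and
    \<open>v\<close> is an ancestor of \<open>C\<close>.\<close>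
  have key: "open_at D C (last xs) v (hd zs) \<and>
      (collider D (last xs) v (hd zs) \<longrightarrow> 1 \<le> colliders D ((v # ys) @ [v])
        + (if collider D (last xs) v (hd (ys @ [v])) then 1 else 0)
        + (if collider D (last (v # ys)) v (hd zs) then 1 else 0))"
    if ne: "xs \<noteq> []" "zs \<noteq> []"
  proof (cases "collider D (last xs) v (hd zs)")
    case False
    have "v \<notin> C"
    proof (cases "(last xs, v) \<in> D")
      case True
      then have "\<not> collider D (last ys) v (hd zs)" using False by (auto simp: collider_def)
      then show ?thesis using w1(5) ne ys by (auto simp: open_at_def)
    next
      case False
      then have "\<not> collider D (last xs) v y" by (auto simp: collider_def)
      then show ?thesis using w1(4) ne ys by (auto simp: open_at_def)
    qed
    then show ?thesis using False by (auto simp: open_at_def)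
  next
    case True
    show ?thesis
    proof (cases "(y, v) \<in> D \<or> (last ys, v) \<in> D")
      case t: True
      then have "collider D (last xs) v (hd (ys @ [v])) \<or> collider D (last (v # ys)) v (hd zs)"
        using True ys by (auto simp: collider_def)
      moreover from this have "v \<in> anc D C" using w1(4,5) ne by (auto simp: open_at_def)
      ultimately show ?thesis using True by (auto simp: open_at_def)
    next
      case False
      then have vy: "(v, y) \<in> D" using adj by (auto simp: adjacent_def)
      have "(v, last (y # ys' @ [v])) \<in> D\<^sup>+ \<or> v \<in> anc D C \<and> 1 \<le> colliders D (v # y # ys' @ [v])"
        using w1(2) ys by (intro open_walk_forward[OF _ vy]) simp
      then have "v \<in> anc D C \<and> 1 \<le> colliders D ((v # ys) @ [v])"
        using ac ys by (auto simp: acyclic_def)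
      then show ?thesis using True by (auto simp: open_at_def)
    qed
  qed
  have "open_walk D C q"
    unfolding q_def using open_walk_append[of D C xs v zs] w1(1,3) key by auto
  then have "q \<in> open_walks D C a b" using hl by (simp add: open_walks_def)
  moreover have "colliders D q \<le> colliders D p" unfolding c1 c2 using key by auto
  moreover have "length q < length p" by (simp add: q_def dec)
  ultimately show False using p unfolding minimal_walk_def by (metis le_antisym not_le)
qed

lemma open_walk_nth:
  "open_walk D C p \<longleftrightarrow> (\<forall>i. Suc i < length p \<longrightarrow> adjacent D (p ! i) (p ! Suc i)) \<and>
     (\<forall>i. Suc (Suc i) < length p \<longrightarrow> open_at D C (p ! i) (p ! Suc i) (p ! Suc (Suc i)))"
proof (induction D C p rule: open_walk.induct)
  case (1 D C x y z p)
  have split: "(\<forall>i. P i) \<longleftrightarrow> P 0 \<and> (\<forall>i. P (Suc i))" for P :: "nat \<Rightarrow> bool"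
    by (metis not0_implies_Suc)
  show ?case unfolding open_walk.simps 1
    by (subst (3) split, subst (4) split) auto
qed (auto simp: less_Suc_eq)

lemma active_trail_open_walk:
  assumes "trail D a p b"
  shows "active_trail D C p \<longleftrightarrow> open_walk D C p"
  using assms unfolding trail_def open_walk_nth active_trail_def open_at_def collider_def anc_def by auto

text \<open>Walks may repeat vertices and trails may not; a minimal open walk has no repetition and
  serves as the active trail.\<close>

lemma d_separated_iff_conn:
  assumes ac: "acyclic D" and disj: "A \<inter> C = {}" "B \<inter> C = {}"
  shows "d_separated D A B C \<longleftrightarrow> (\<forall>a\<in>A. \<forall>b\<in>B. \<not> conn D C a b)"
proof -
  have "(\<exists>p. trail D a p b \<and> active_trail D C p) \<longleftrightarrow> conn D C a b" if "a \<in> A" for a b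
  proof
    assume "\<exists>p. trail D a p b \<and> active_trail D C p"
    then obtain p where p: "trail D a p b" "open_walk D C p" using active_trail_open_walk by metis
    then show "conn D C a b"
      using open_walk_reach[OF ac p(2)] that disj by (fastforce simp: trail_def conn_def)
  next
    assume "conn D C a b"
    then obtain p where p: "minimal_walk D C a b p" using minimal_walk_exists[OF ac] by metis
    then have "open_walk D C p" "trail D a p b"
      using minimal_walk_distinct[OF ac p]
      by (auto simp: minimal_walk_def open_walks_def trail_def open_walk_nth)
    then show "\<exists>p. trail D a p b \<and> active_trail D C p" using active_trail_open_walk by metis
  qed
  then show ?thesis unfolding d_separated_def by blast
qed

section \<open>Linear models over the two-element field\<close>

declare add_bit_eq_xor [simp del] mult_bit_eq_and [simp del]

lemma bit_add_self: "(x :: bit) + x = 0"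
  by (cases "x = 0") auto

lemma bit_add_eq_0_iff: "(x :: bit) + y = 0 \<longleftrightarrow> x = y"
  by (cases "x = 0"; cases "y = 0") auto

text \<open>The chain of pointers \<open>nx\<close> from \<open>q\<close>, which stops at its first
  vertex in \<open>C\<close>.\<close>

inductive tail :: "('v \<Rightarrow> 'v) \<Rightarrow> 'v set \<Rightarrow> 'v \<Rightarrow> 'v \<Rightarrow> bool" for nx C q where
  base: "tail nx C q q"
| step: "tail nx C q v \<Longrightarrow> v \<notin> C \<Longrightarrow> tail nx C q (nx v)"

lemma tail_prepend: "tail nx C (nx v) w \<Longrightarrow> v \<notin> C \<Longrightarrow> tail nx C v w"
  by (induction rule: tail.induct) (auto intro: tail.intros)

lemma tail_tl: "tail nx C v w \<Longrightarrow> v \<noteq> w \<Longrightarrow> tail nx C (nx v) w"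
proof (induction rule: tail.induct)
  case (step w)
  then show ?case by (cases "v = w") (auto intro: tail.intros)
qed simp

lemma tail_linear: "tail nx C q u \<Longrightarrow> tail nx C q v \<Longrightarrow> tail nx C u v \<or> tail nx C v u"
proof (induction rule: tail.induct)
  case (step u)
  then consider "tail nx C u v" | "tail nx C v u" by auto
  then show ?case
  proof cases
    case 1
    then show ?thesis using tail_tl[of nx C u v] step.hyps(2) tail.step[OF tail.base] by metis
  next
    case 2
    then show ?thesis using tail.step step.hyps(2) by metis
  qed
qed simp

text \<open>\<open>nx\<close> moves an ancestor of \<open>C\<close> towards \<open>C\<close>, which gives every collider a directed tail ending
  in \<open>C\<close>. Minimality of the number of colliders keeps the tails disjoint from each other and from the
  rest of the trail, since any contact would be a shortcut.\<close>

locale open_trail =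
  fixes D :: "('v \<times> 'v) set" and C :: "'v set" and a b :: 'v and p :: "'v list" and nx :: "'v \<Rightarrow> 'v"
  assumes ac: "acyclic D" and fin: "finite D"
    and minimal: "minimal_walk D C a b p"
    and ab: "a \<notin> C" "b \<notin> C" "a \<noteq> b"
    and nx: "\<And>v. v \<in> anc D C \<Longrightarrow> v \<notin> C \<Longrightarrow> (v, nx v) \<in> D \<and> nx v \<in> anc D C"
begin

lemma asym: "(x, y) \<in> D \<Longrightarrow> (y, x) \<notin> D"
  using ac by (meson acyclic_def r_into_trancl trancl_trans)

lemma no_cycle: "(x, y) \<in> D\<^sup>* \<Longrightarrow> (y, x) \<notin> D\<^sup>+"
  using ac by (meson acyclic_def rtrancl_trancl_trancl)

lemma distinct: "distinct p"
  using minimal_walk_distinct[OF ac minimal] .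

lemma open_p: "open_walk D C p" and p_ne: "p \<noteq> []" and hd_p: "hd p = a" and last_p: "last p = b"
  using minimal by (auto simp: minimal_walk_def open_walks_def)

lemma tail_anc: "tail nx C q v \<Longrightarrow> q \<in> anc D C \<Longrightarrow> v \<in> anc D C \<and> (q, v) \<in> D\<^sup>*"
  by (induction rule: tail.induct) (use nx in \<open>auto intro: rtrancl_into_rtrancl\<close>)

lemma tail_walk:
  "tail nx C q v \<Longrightarrow> q \<in> anc D C \<Longrightarrow> v \<noteq> q \<Longrightarrow> q \<notin> C \<and> (\<exists>r. open_walk D C (q # r @ [v]) \<and>
     colliders D (q # r @ [v]) = 0 \<and> (q, hd (r @ [v])) \<in> D \<and> (last (q # r), v) \<in> D)"
proof (induction rule: tail.induct)
  case (step v)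
  have v: "(v, nx v) \<in> D" using nx tail_anc step by auto
  show ?case
  proof (cases "v = q")
    case True
    then show ?thesis using v step by (intro conjI exI[of _ "[]"]) (auto simp: adjacent_def)
  next
    case False
    then obtain r where r: "q \<notin> C" "open_walk D C (q # r @ [v])" "colliders D (q # r @ [v]) = 0"
      "(q, hd (r @ [v])) \<in> D" "(last (q # r), v) \<in> D" using step by auto
    have n: "\<not> collider D x v (nx v)" for x using v asym by (auto simp: collider_def)
    have "open_walk D C (q # (r @ [v]) @ [nx v])" "colliders D (q # (r @ [v]) @ [nx v]) = 0"
      using open_walk_append[of D C "q # r" v "[nx v]"] colliders_append[of D "q # r" v "[nx v]"]
        r v n step.hyps(2) by (auto simp: open_at_def adjacent_def)
    moreover have "(q, hd ((r @ [v]) @ [nx v])) \<in> D" using r(4) by (cases r) auto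
    ultimately show ?thesis using r(1) v by (intro conjI exI[of _ "r @ [v]"]) auto
  qed
qed simp

lemma tail_ends:
  assumes "v \<in> anc D C"
  shows "\<exists>c\<in>C. tail nx C v c"
proof -
  have "wf (D\<inverse>)" using ac fin by (simp add: finite_acyclic_wf_converse)
  then show ?thesis using assms
  proof (induction v)
    case (less v)
    then show ?case
      using nx[of v] tail_prepend[of nx C v] tail.base[of nx C v] by (cases "v \<in> C") auto
  qed
qed

text \<open>Two vertices of one tail are comparable, so if they had the same successor, the later
  one would lead back to a vertex before it and close a directed cycle.\<close>

lemma tail_nx_inj:
  assumes "tail nx C q u" "tail nx C q u'" "u \<notin> C" "u' \<notin> C" "nx u = nx u'" "q \<in> anc D C"
  shows "u = u'"
proof (rule ccontr)
  assume ne: "u \<noteq> u'"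
  have "False" if t: "tail nx C x y" "x \<noteq> y" "nx x = nx y" "x \<notin> C" "y \<notin> C" "x \<in> anc D C" for x y
  proof -
    have "tail nx C (nx x) y" using tail_tl t by metis
    moreover have "nx x \<in> anc D C" using nx[OF t(6,4)] by blast
    ultimately have "(nx x, y) \<in> D\<^sup>*" "y \<in> anc D C" using tail_anc by auto
    moreover have "(y, nx y) \<in> D" using nx t calculation by auto
    ultimately show False using t(3) no_cycle by (metis r_into_trancl)
  qed
  then show False
    using tail_linear[OF assms(1,2)] assms ne tail_anc by metis
qed

definition Q where
  "Q = {p ! Suc i | i. Suc (Suc i) < length p \<and> collider D (p ! i) (p ! Suc i) (p ! Suc (Suc i))}"

lemma Q_split:
  assumes "q \<in> Q" "p = xs @ q # ys"
  shows "xs \<noteq> [] \<and> ys \<noteq> [] \<and> collider D (last xs) q (hd ys)"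
proof -
  obtain i where i: "q = p ! Suc i" "Suc (Suc i) < length p"
    "collider D (p ! i) (p ! Suc i) (p ! Suc (Suc i))" using assms(1) by (auto simp: Q_def)
  have "p ! length xs = q" "length xs < length p" using assms(2) by auto
  then have l: "length xs = Suc i" using i distinct nth_eq_iff_index_eq by (metis Suc_lessD)
  then have "xs \<noteq> []" "ys \<noteq> []" using assms(2) i(2) by auto
  moreover from this have "last xs = p ! i" "hd ys = p ! Suc (Suc i)"
    using l assms(2) by (auto simp: last_conv_nth nth_append hd_conv_nth)
  ultimately show ?thesis using i by auto
qed

lemma Q_anc: "q \<in> Q \<Longrightarrow> q \<in> anc D C"
  using open_p unfolding Q_def open_walk_nth open_at_def by auto

text \<open>Replacing the segment from \<open>q\<close> to \<open>v\<close> by the tail saves the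
  collider \<open>q\<close>. By minimality this must be paid for by a new collider at
  \<open>v\<close>, and the segment has no collider inside; so it is directed from \<open>v\<close>
  back to \<open>q\<close> and closes a cycle with the tail.\<close>

lemma no_shortcut:
  assumes m: "minimal_walk D C a' b' (xs @ q # ys @ v # zs)"
    and xs: "xs \<noteq> []" and col: "collider D (last xs) q (hd (ys @ v # zs))"
    and t: "tail nx C q v" "q \<in> anc D C" "q \<noteq> v"
  shows False
proof -
  obtain r where r: "q \<notin> C" "open_walk D C (q # r @ [v])"
     "colliders D (q # r @ [v]) = 0" "(q, hd (r @ [v])) \<in> D" "(last (q # r), v) \<in> D"
    using tail_walk[OF t(1,2)] t(3) by auto
  have v: "v \<in> anc D C" "(q, v) \<in> D\<^sup>*" using tail_anc t by auto
  define P where "P = xs @ q # (ys @ v # zs)"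
  define N where "N = xs @ q # (r @ v # zs)"
  have P: "open_walk D C P" "hd P = a'" "last P = b'"
    using m by (auto simp: P_def minimal_walk_def open_walks_def)
  have hd_ys: "hd (ys @ v # zs) = hd (ys @ [v])" "hd (r @ v # zs) = hd (r @ [v])"
    by (cases ys; simp) (cases r; simp)
  have oP: "open_walk D C (xs @ [q])" "open_walk D C ((q # ys) @ [v])" "open_walk D C (v # zs)"
    "zs \<noteq> [] \<longrightarrow> open_at D C (last (q # ys)) v (hd zs)"
    using P(1) open_walk_append[of D C xs q "ys @ v # zs"] open_walk_append[of D C "q # ys" v zs]
    by (auto simp: P_def)
  have cP: "colliders D P = colliders D (xs @ [q]) + 1 + colliders D (q # ys @ [v]) + colliders D (v # zs)
     + (if zs \<noteq> [] \<and> collider D (last (q # ys)) v (hd zs) then 1 else 0)"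
    using colliders_append[of D xs q "ys @ v # zs"] colliders_append[of D "q # ys" v zs] xs col
    by (auto simp: P_def)
  have nq: "\<not> collider D x q (hd (r @ v # zs))" for x
    using r(4) asym hd_ys by (auto simp: collider_def)
  have cN: "colliders D N = colliders D (xs @ [q]) + colliders D (v # zs)
     + (if zs \<noteq> [] \<and> (hd zs, v) \<in> D then 1 else 0)"
    using colliders_append[of D xs q "r @ v # zs"] colliders_append[of D "q # r" v zs] nq r(3,5)
    by (auto simp: N_def collider_def)
  have "v \<notin> C" if "zs \<noteq> []" "(hd zs, v) \<notin> D"
    using oP(4) that by (auto simp: open_at_def collider_def)
  then have "zs \<noteq> [] \<longrightarrow> open_at D C (last (q # r)) v (hd zs)"
    using v by (auto simp: open_at_def collider_def r(5) simp del: last.simps)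
  then have "open_walk D C N"
    using open_walk_append[of D C xs q "r @ v # zs"] open_walk_append[of D C "q # r" v zs] r(1,2) oP nq
    by (auto simp: N_def open_at_def)
  moreover have "hd N = a'" "last N = b'" "N \<noteq> []"
    using P xs by (auto simp: N_def P_def hd_append)
  ultimately have "colliders D P \<le> colliders D N"
    using m by (auto simp: minimal_walk_def open_walks_def P_def)
  then have z: "zs \<noteq> []" "(hd zs, v) \<in> D" "\<not> collider D (last (q # ys)) v (hd zs)"
    "colliders D (q # ys @ [v]) = 0"
    unfolding cP cN by (auto split: if_splits)
  then have nd: "(last (q # ys), v) \<notin> D" by (auto simp: collider_def)
  obtain y w where w: "rev (q # ys) = y # w" by (cases "rev (q # ys)") auto
  have y: "y = last (q # ys)" using w by (metis hd_rev list.sel(1))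
  have rw: "rev (q # ys @ [v]) = v # y # w" using w by simp
  then have "open_walk D C (v # y # w)" "colliders D (v # y # w) = 0"
    using oP(2) z(4) open_walk_rev[of D C "q # ys @ [v]"] colliders_rev[of D "q # ys @ [v]"] by auto
  moreover from this have "(v, y) \<in> D" using nd y by (cases w) (auto simp: adjacent_def)
  ultimately have "(v, last (y # w)) \<in> D\<^sup>+" using open_walk_forward by fastforce
  moreover have "last (y # w) = q" using w by (metis last_rev list.sel(1))
  ultimately show False using no_cycle v(2) by metis
qed

lemma tail_on_trail:
  assumes "q \<in> Q" "tail nx C q v" "v \<in> set p" "q \<in> set p"
  shows "v = q"
proof (rule ccontr)
  assume ne: "v \<noteq> q"
  obtain xs ys where p: "p = xs @ q # ys" using assms(4) by (auto simp: in_set_conv_decomp)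
  have c: "xs \<noteq> []" "ys \<noteq> []" "collider D (last xs) q (hd ys)" using Q_split[OF assms(1) p] by auto
  consider "v \<in> set ys" | "v \<in> set xs" using assms(3) ne p by auto
  then show False
  proof cases
    case 1
    then obtain us ws where "ys = us @ v # ws" by (auto simp: in_set_conv_decomp)
    then show False using no_shortcut[of a b xs q us v ws] minimal p c assms Q_anc ne by auto
  next
    case 2
    then obtain us ws where x: "xs = us @ v # ws" by (auto simp: in_set_conv_decomp)
    have "rev p = rev ys @ q # rev ws @ v # rev us" using p x by simp
    moreover have "hd (rev ws @ v # rev us) = last xs" using x by (cases ws rule: rev_cases) auto
    moreover have "collider D (hd ys) q (last xs)" using c(3) collider_sym by metis
    ultimately show False
      using no_shortcut[of b a "rev ys" q "rev ws" v "rev us"] minimal_walk_rev[OF minimal]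
        c assms Q_anc ne by (auto simp: last_rev)
  qed
qed

lemma Q_set: "q \<in> Q \<Longrightarrow> q \<in> set p"
  by (auto simp: Q_def)

text \<open>Going down from \<open>q\<close> to \<open>v\<close> and up again to \<open>q'\<close>
  replaces the two colliders \<open>q\<close> and \<open>q'\<close> by at most the one at
  \<open>v\<close>, against minimality.\<close>

lemma tails_meet_aux:
  assumes q: "q \<in> Q" "q' \<in> Q" and t: "tail nx C q v" "tail nx C q' v" and p: "p = xs @ q # ys @ q' # zs"
  shows False
proof -
  have ne: "q \<noteq> q'" using distinct p by auto
  have v: "v \<noteq> q" "v \<noteq> q'" using tail_on_trail[OF q(1) t(1)] tail_on_trail[OF q(2) t(2)] Q_set q ne by metis+
  obtain r where r: "q \<notin> C" "open_walk D C (q # r @ [v])"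
     "colliders D (q # r @ [v]) = 0" "(q, hd (r @ [v])) \<in> D" "(last (q # r), v) \<in> D"
    using tail_walk[OF t(1) Q_anc[OF q(1)] v(1)] by auto
  obtain r' where r': "q' \<notin> C" "open_walk D C (q' # r' @ [v])"
     "colliders D (q' # r' @ [v]) = 0" "(q', hd (r' @ [v])) \<in> D" "(last (q' # r'), v) \<in> D"
    using tail_walk[OF t(2) Q_anc[OF q(2)] v(2)] by auto
  have va: "v \<in> anc D C" using tail_anc t Q_anc q by auto
  have c: "xs \<noteq> []" "collider D (last xs) q (hd (ys @ q' # zs))"
    "zs \<noteq> []" "collider D (last (q # ys)) q' (hd zs)"
    using Q_split[OF q(1), of xs "ys @ q' # zs"] Q_split[OF q(2), of "xs @ q # ys" zs] p by auto
  have oP: "open_walk D C (xs @ [q])" "open_walk D C (q' # zs)"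
    using open_p open_walk_append[of D C xs q "ys @ q' # zs"] open_walk_append[of D C "q # ys" q' zs]
    by (auto simp: p)
  have cP: "colliders D p \<ge> colliders D (xs @ [q]) + 2 + colliders D (q' # zs)"
    using colliders_append[of D xs q "ys @ q' # zs"] colliders_append[of D "q # ys" q' zs] c
    by (auto simp: p)
  have rv: "v # rev r' @ [q'] = rev (q' # r' @ [v])" by simp
  have o': "open_walk D C (v # rev r' @ [q'])" "colliders D (v # rev r' @ [q']) = 0"
    unfolding rv using r' by (simp_all only: open_walk_rev colliders_rev)
  have hr: "hd (rev r' @ q' # zs) = last (q' # r')" by (cases r' rule: rev_cases) auto
  have lr: "last (v # rev r') = hd (r' @ [v])" by (cases r') auto
  have hr2: "hd (r @ v # rev r' @ q' # zs) = hd (r @ [v])" by (cases r) auto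
  have nq: "\<not> collider D x q (hd (r @ v # rev r' @ q' # zs))" for x
    using r(4) asym unfolding hr2 by (auto simp: collider_def)
  have nq': "\<not> collider D (last (v # rev r')) q' x" for x
    using r'(4) asym unfolding lr by (auto simp: collider_def)
  have cv: "collider D (last (q # r)) v (hd (rev r' @ q' # zs))"
    unfolding hr using r(5) r'(5) by (simp add: collider_def)
  define N where "N = xs @ q # (r @ v # rev r' @ q' # zs)"
  have a1: "open_walk D C (v # rev r' @ q' # zs)"
    using open_walk_append[of D C "v # rev r'" q' zs] o' oP nq' r'(1) by (auto simp: open_at_def)
  have a2: "open_walk D C (q # r @ v # rev r' @ q' # zs)"
    using open_walk_append[of D C "q # r" v "rev r' @ q' # zs"] a1 r(2) cv va by (auto simp: open_at_def)
  have "open_walk D C N" unfolding N_def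
    using open_walk_append[of D C xs q "r @ v # rev r' @ q' # zs"] a2 oP nq r(1) by (auto simp: open_at_def)
  moreover have "hd N = a" "last N = b" "N \<noteq> []"
    using hd_p last_p by (auto simp: N_def p hd_append)
  ultimately have "colliders D p \<le> colliders D N"
    using minimal by (auto simp: minimal_walk_def open_walks_def)
  moreover have "colliders D (v # rev r' @ q' # zs) = colliders D (q' # zs)"
    using colliders_append[of D "v # rev r'" q' zs] o' nq' by auto
  then have "colliders D (q # r @ v # rev r' @ q' # zs) \<le> 1 + colliders D (q' # zs)"
    using colliders_append[of D "q # r" v "rev r' @ q' # zs"] r(3) by auto
  then have "colliders D N \<le> colliders D (xs @ [q]) + 1 + colliders D (q' # zs)"
    unfolding N_def using colliders_append[of D xs q "r @ v # rev r' @ q' # zs"] nq by auto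
  ultimately show False using cP by auto
qed

lemma tails_meet:
  assumes "q \<in> Q" "q' \<in> Q" "tail nx C q v" "tail nx C q' v"
  shows "q = q'"
proof (rule ccontr)
  assume ne: "q \<noteq> q'"
  obtain xs ys where p: "p = xs @ q # ys" using Q_set[OF assms(1)] by (auto simp: in_set_conv_decomp)
  consider "q' \<in> set ys" | "q' \<in> set xs" using Q_set[OF assms(2)] ne p by auto
  then show False
  proof cases
    case 1
    then obtain us ws where "ys = us @ q' # ws" by (auto simp: in_set_conv_decomp)
    then show False using tails_meet_aux[OF assms] p by auto
  next
    case 2
    then obtain us ws where "xs = us @ q' # ws" by (auto simp: in_set_conv_decomp)
    then show False using tails_meet_aux[OF assms(2,1,4,3)] p by auto
  qed
qed

definition trail_edges :: "('v \<times> 'v) set" where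
  "trail_edges = {(p ! i, p ! j) | i j. i < length p \<and> j < length p \<and> (j = Suc i \<or> i = Suc j) \<and>
     (p ! i, p ! j) \<in> D}"

definition tail_edges :: "('v \<times> 'v) set" where
  "tail_edges = {(u, nx u) | u. u \<notin> C \<and> (\<exists>q\<in>Q. tail nx C q u)}"

text \<open>The parents that enter the linear equation of \<open>v\<close>. Parents along other
  edges of \<open>D\<close> are ignored, so that dependence is carried by the trail and its tails
  only.\<close>

definition T :: "'v \<Rightarrow> 'v set" where
  "T v = {u. (u, v) \<in> trail_edges \<union> tail_edges}"

lemma tail_edge_off_trail:
  assumes "(u, v) \<in> tail_edges"
  shows "v \<notin> set p" "(u, v) \<in> D" "u \<in> set p \<Longrightarrow> u \<in> Q"
proof -
  obtain q where q: "u \<notin> C" "v = nx u" "q \<in> Q" "tail nx C q u" using assms by (auto simp: tail_edges_def)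
  then have u: "u \<in> anc D C" "(q, u) \<in> D\<^sup>*" using tail_anc Q_anc by auto
  then show "(u, v) \<in> D" using nx q by auto
  then have "(q, v) \<in> D\<^sup>+" using u by auto
  then have "v \<noteq> q" using ac by (auto simp: acyclic_def)
  then show "v \<notin> set p" using tail_on_trail[of q v] q tail.step Q_set by metis
  show "u \<in> set p \<Longrightarrow> u \<in> Q" using tail_on_trail q Q_set by metis
qed

lemma T_parents: "T v \<subseteq> {u. (u, v) \<in> D}"
  using tail_edge_off_trail(2) by (auto simp: T_def trail_edges_def)

lemma T_trail:
  assumes "i < length p"
  shows "T (p ! i) = {p ! j | j. j < length p \<and> (j = Suc i \<or> i = Suc j) \<and> (p ! j, p ! i) \<in> D}"
proof -
  have "(u, p ! i) \<notin> tail_edges" for u using tail_edge_off_trail(1) assms by fastforce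
  moreover have "(u, p ! i) \<in> trail_edges \<longleftrightarrow>
      (\<exists>j. u = p ! j \<and> j < length p \<and> (j = Suc i \<or> i = Suc j) \<and> (p ! j, p ! i) \<in> D)" for u
  proof
    assume "(u, p ! i) \<in> trail_edges"
    then obtain j k where jk: "u = p ! j" "p ! i = p ! k" "j < length p" "k < length p"
      "k = Suc j \<or> j = Suc k" "(p ! j, p ! k) \<in> D" unfolding trail_edges_def by auto
    then have "k = i" using distinct assms nth_eq_iff_index_eq by metis
    then show "\<exists>j. u = p ! j \<and> j < length p \<and> (j = Suc i \<or> i = Suc j) \<and> (p ! j, p ! i) \<in> D"
      using jk by auto
  qed (use assms in \<open>auto simp: trail_edges_def\<close>)
  ultimately show ?thesis by (auto simp: T_def)
qed

lemma T_tail: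
  assumes "q \<in> Q" "tail nx C q u" "u \<notin> C"
  shows "T (nx u) = {u}"
proof -
  have e: "(u, nx u) \<in> tail_edges" using assms by (auto simp: tail_edges_def)
  have "(u', nx u) \<notin> trail_edges" for u'
    using tail_edge_off_trail(1)[OF e] by (auto simp: trail_edges_def)
  moreover have "u' = u" if u': "(u', nx u) \<in> tail_edges" for u'
  proof -
    obtain q' where q': "u' \<notin> C" "nx u' = nx u" "q' \<in> Q" "tail nx C q' u'"
      using u' by (auto simp: tail_edges_def)
    have "q' = q" using tails_meet[OF q'(3) assms(1), of "nx u"] q' assms tail.step by metis
    then show ?thesis using tail_nx_inj q' assms Q_anc by metis
  qed
  ultimately show ?thesis using e by (auto simp: T_def)
qed

lemma T_interior:
  assumes "Suc (Suc i) < length p"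
  shows "T (p ! Suc i) = {x. x \<in> {p ! i, p ! Suc (Suc i)} \<and> (x, p ! Suc i) \<in> D}"
proof -
  have "Suc i < length p" using assms by simp
  from T_trail[OF this] show ?thesis using assms by force
qed

lemma T_first: "T a = {x. x = p ! 1 \<and> (x, a) \<in> D}" if "1 < length p"
proof -
  have "p ! 0 = a" "0 < length p" using hd_p p_ne by (auto simp: hd_conv_nth)
  then show ?thesis using T_trail[of 0] that by auto
qed

lemma T_last:
  assumes "1 < length p"
  shows "T b = {x. x = p ! (length p - 2) \<and> (x, b) \<in> D}"
proof -
  obtain n where n: "length p = Suc (Suc n)" using assms by (cases p; cases "tl p") auto
  then have "p ! Suc n = b" using last_p p_ne by (simp add: last_conv_nth)
  then show ?thesis using T_trail[of "Suc n"] n by auto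
qed

lemma length_p: "1 < length p"
  using p_ne hd_p last_p ab(3) by (cases p; cases "tl p") auto

lemma adjacent_p: "Suc i < length p \<Longrightarrow> adjacent D (p ! i) (p ! Suc i)"
  using open_p by (simp add: open_walk_nth)

text \<open>A collider has the value at the end of its tail, which is a vertex of \<open>C\<close>,
  hence 0; so its two trail parents agree. At other interior vertices the value is copied from the
  single trail parent or shared by both sides.\<close>

lemma solution_transfer:
  fixes l :: "'v \<Rightarrow> bit"
  assumes eq: "\<And>v. T v \<noteq> {} \<Longrightarrow> l v = (\<Sum>u\<in>T v. l u)" and C: "\<And>c. c \<in> C \<Longrightarrow> l c = 0"
  shows "l a = l b"
proof -
  have Q0: "l q = 0" if "q \<in> Q" for q
  proof -
    have "l v = l q" if "tail nx C q v" for v using that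
    proof (induction rule: tail.induct)
      case (step v)
      have "T (nx v) = {v}" using T_tail \<open>q \<in> Q\<close> step by metis
      then show ?case using eq[of "nx v"] step.IH by simp
    qed simp
    then show ?thesis using tail_ends[OF Q_anc[OF that]] C by metis
  qed
  \<comment> \<open>The source of the \<open>i\<close>-th trail edge. Its value is constant along
    the trail, whereas the vertices themselves drop to 0 at colliders.\<close>
  define s where "s i = (if (p ! i, p ! Suc i) \<in> D then p ! i else p ! Suc i)" for i
  have st: "l (s (Suc i)) = l (s i)" if i: "Suc (Suc i) < length p" for i
  proof -
    let ?x = "p ! i" and ?v = "p ! Suc i" and ?z = "p ! Suc (Suc i)"
    have adj: "adjacent D ?x ?v" "adjacent D ?v ?z" using adjacent_p i by auto
    have ne: "?x \<noteq> ?z" using distinct i nth_eq_iff_index_eq[of p i "Suc (Suc i)"] by auto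
    have T: "T ?v = {x. x \<in> {?x, ?z} \<and> (x, ?v) \<in> D}" using T_interior[OF i] .
    consider "(?x, ?v) \<in> D" "(?z, ?v) \<in> D" | "(?x, ?v) \<in> D" "(?z, ?v) \<notin> D"
      | "(?x, ?v) \<notin> D" "(?z, ?v) \<in> D" | "(?x, ?v) \<notin> D" "(?z, ?v) \<notin> D" by blast
    then show ?thesis
    proof cases
      case 1
      then have "T ?v = {?x, ?z}" unfolding T by auto
      moreover have "?v \<in> Q" using 1 i by (auto simp: Q_def collider_def)
      ultimately have "l ?x + l ?z = 0" using eq[of ?v] Q0 ne by auto
      then show ?thesis using 1 asym by (auto simp: s_def bit_add_eq_0_iff)
    next
      case 2
      then have "T ?v = {?x}" unfolding T by auto
      then have "l ?v = l ?x" using eq[of ?v] by simp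
      then show ?thesis using 2 adj by (auto simp: s_def adjacent_def)
    next
      case 3
      then have "T ?v = {?z}" unfolding T by auto
      then have "l ?v = l ?z" using eq[of ?v] by simp
      then show ?thesis using 3 adj asym by (auto simp: s_def adjacent_def)
    next
      case 4
      then show ?thesis using adj by (auto simp: s_def adjacent_def)
    qed
  qed
  have "l (s i) = l (s 0)" if "Suc i < length p" for i
    using that by (induction i) (auto simp: st)
  from this[of "length p - 2"] have "l (s (length p - 2)) = l (s 0)" using length_p by simp
  moreover have "l (s 0) = l a"
  proof (cases "(p ! 0, p ! 1) \<in> D")
    case True
    then show ?thesis using hd_p p_ne by (simp add: s_def hd_conv_nth)
  next
    case False
    then have "(p ! 1, a) \<in> D" using adjacent_p[of 0] length_p hd_p p_ne
      by (auto simp: adjacent_def hd_conv_nth)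
    then have "T a = {p ! 1}" using T_first length_p by auto
    then show ?thesis using eq[of a] False by (simp add: s_def)
  qed
  moreover have "l (s (length p - 2)) = l b"
  proof -
    have i: "Suc (length p - 2) = length p - 1" "Suc (length p - 2) < length p" using length_p by auto
    have b: "p ! Suc (length p - 2) = b" using last_p p_ne i by (simp add: last_conv_nth)
    show ?thesis
    proof (cases "(p ! (length p - 2), b) \<in> D")
      case True
      then have "T b = {p ! (length p - 2)}" using T_last length_p by auto
      then show ?thesis using eq[of b] True b by (simp add: s_def)
    next
      case False
      then show ?thesis using b by (simp add: s_def)
    qed
  qed
  ultimately show ?thesis by simp
qed

text \<open>Over the two-element field the contributions of the two parents of a collider cancel, so
  the trail can carry 1 away from its colliders while the tails carry 0.\<close>

definition y :: "'v \<Rightarrow> bit" where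
  "y v = (if v \<in> set p - Q then 1 else 0)"

lemma trail_parent_y:
  assumes "v \<in> set p" "u \<in> T v"
  shows "y u = 1"
proof -
  obtain i where i: "v = p ! i" "i < length p" using assms(1) by (auto simp: in_set_conv_nth)
  then obtain j where j: "u = p ! j" "j < length p" "j = Suc i \<or> i = Suc j" "(u, v) \<in> D"
    using assms(2) T_trail by auto
  have "u \<notin> Q"
  proof
    assume "u \<in> Q"
    then obtain k where k: "u = p ! Suc k" "Suc (Suc k) < length p"
      "(p ! k, u) \<in> D" "(p ! Suc (Suc k), u) \<in> D" by (auto simp: Q_def collider_def)
    then have "j = Suc k" using j distinct nth_eq_iff_index_eq by (metis Suc_lessD)
    then have "(v, u) \<in> D" using j(3) i k by auto
    then show False using asym j(4) by auto
  qed
  then show ?thesis using j by (auto simp: y_def)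
qed

lemma y_solution:
  assumes "T v \<noteq> {}"
  shows "y v = (\<Sum>u\<in>T v. y u)"
proof (cases "v \<in> set p")
  case False
  have "y u = 0" if "u \<in> T v" for u
    using that False tail_edge_off_trail(3)[of u v] by (auto simp: T_def trail_edges_def y_def)
  then show ?thesis using False by (simp add: y_def)
next
  case True
  then obtain i where i: "v = p ! i" "i < length p" by (auto simp: in_set_conv_nth)
  have sum: "(\<Sum>u\<in>T v. y u) = (\<Sum>u\<in>T v. 1)" using trail_parent_y[OF True] by simp
  consider "i = 0" | "i = length p - 1" | k where "i = Suc k" "Suc (Suc k) < length p"
    using i(2) by (cases i) force+
  then show ?thesis
  proof cases
    case 1
    then have va: "v = a" using i hd_p p_ne by (simp add: hd_conv_nth)
    then have "T v = {p ! 1}" using T_first[OF length_p] assms by auto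
    moreover have "v \<notin> Q" using Q_split[of v "[]" "tl p"] va hd_p p_ne by (metis append_Nil list.collapse)
    ultimately show ?thesis using sum True by (simp add: y_def)
  next
    case 2
    then have vb: "v = b" using i last_p p_ne by (simp add: last_conv_nth)
    then have "T v = {p ! (length p - 2)}" using T_last[OF length_p] assms by auto
    moreover have "v \<notin> Q" using Q_split[of v "butlast p" "[]"] vb last_p p_ne by (metis append_butlast_last_id)
    ultimately show ?thesis using sum True by (simp add: y_def)
  next
    case 3
    let ?x = "p ! k" and ?z = "p ! Suc (Suc k)"
    have ne: "?x \<noteq> ?z" using distinct 3 nth_eq_iff_index_eq[of p k "Suc (Suc k)"] by auto
    have T: "T v = {x. x \<in> {?x, ?z} \<and> (x, v) \<in> D}" using T_interior[OF 3(2)] 3 i by simp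
    show ?thesis
    proof (cases "collider D ?x v ?z")
      case True
      then have "v \<in> Q" using 3 i by (auto simp: Q_def)
      moreover have "T v = {?x, ?z}" using True unfolding T by (auto simp: collider_def)
      ultimately show ?thesis using sum ne by (simp add: y_def bit_add_self)
    next
      case False
      have "v \<notin> Q"
      proof
        assume "v \<in> Q"
        then obtain m where m: "v = p ! Suc m" "Suc (Suc m) < length p"
          "collider D (p ! m) (p ! Suc m) (p ! Suc (Suc m))" by (auto simp: Q_def)
        then have "Suc m = Suc k" using 3 i distinct nth_eq_iff_index_eq by (metis Suc_lessD)
        then show False using m False by simp
      qed
      moreover have "T v = {?x} \<or> T v = {?z}" using False assms unfolding T by (auto simp: collider_def)
      ultimately show ?thesis using sum True by (auto simp: y_def)
    qed
  qed
qed

lemma y_C: "c \<in> C \<Longrightarrow> y c = 0"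
proof (cases "c \<in> set p")
  case True
  assume c: "c \<in> C"
  obtain xs ys where p: "p = xs @ c # ys" using True by (auto simp: in_set_conv_decomp)
  have "xs \<noteq> []" "ys \<noteq> []" using p c hd_p last_p ab by auto
  then have "open_at D C (last xs) c (hd ys)"
    using open_p open_walk_append[of D C xs c ys] p by auto
  then have "collider D (last xs) c (hd ys)" using c by (auto simp: open_at_def split: if_splits)
  moreover have "last xs = p ! (length xs - 1)" "hd ys = p ! Suc (length xs)" "c = p ! length xs"
    using p \<open>xs \<noteq> []\<close> \<open>ys \<noteq> []\<close> by (auto simp: last_conv_nth hd_conv_nth nth_append)
  moreover have "Suc (length xs) < length p" using p \<open>ys \<noteq> []\<close> by auto
  ultimately have "c \<in> Q" using \<open>xs \<noteq> []\<close> unfolding Q_def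
    by (intro CollectI exI[of _ "length xs - 1"]) auto
  then show ?thesis by (simp add: y_def)
qed (simp add: y_def)

lemma y_a: "y a = 1"
proof -
  have "a \<notin> Q" using Q_split[of a "[]" "tl p"] hd_p p_ne by (metis append_Nil list.collapse)
  then show ?thesis using hd_p p_ne by (auto simp: y_def)
qed

lemma y_outside: "D \<subseteq> V \<times> V \<Longrightarrow> v \<notin> V \<Longrightarrow> y v = 0"
proof -
  assume D: "D \<subseteq> V \<times> V" "v \<notin> V"
  have "v \<notin> set p"
  proof
    assume "v \<in> set p"
    then obtain i where i: "v = p ! i" "i < length p" by (auto simp: in_set_conv_nth)
    then have "adjacent D v (p ! Suc i) \<or> adjacent D (p ! (i - 1)) v"
      using adjacent_p[of i] adjacent_p[of "i - 1"] length_p by (cases "Suc i < length p") auto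
    then show False using D by (auto simp: adjacent_def)
  qed
  then show ?thesis by (simp add: y_def)
qed

end

text \<open>A vertex \<open>v\<close> with \<open>T v = {}\<close> is free; any other vertex is the sum of its chosen parents.\<close>

definition lin :: "'v set \<Rightarrow> ('v \<Rightarrow> 'v set) \<Rightarrow> ('v \<Rightarrow> bit) set" where
  "lin V T = {x. (\<forall>v. v \<notin> V \<longrightarrow> x v = 0) \<and> (\<forall>v. T v \<noteq> {} \<longrightarrow> x v = (\<Sum>u\<in>T v. x u))}"

lemma conn_linear_witness:
  assumes "finite V" "D \<in> dags V" "conn D C a b" "a \<notin> C" "b \<notin> C" "a \<noteq> b"
  obtains T y where "\<And>v. T v \<subseteq> {u. (u, v) \<in> D}"
    "\<And>l. l \<in> lin V T \<Longrightarrow> (\<And>c. c \<in> C \<Longrightarrow> l c = 0) \<Longrightarrow> l a = l b"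
    "y \<in> lin V T" "\<And>c. c \<in> C \<Longrightarrow> y c = 0" "y a = 1"
proof -
  have D: "acyclic D" "finite D" "D \<subseteq> V \<times> V" using assms(1,2) finite_dag by (auto simp: dags_def)
  obtain p where p: "minimal_walk D C a b p" using minimal_walk_exists[OF D(1) assms(3)] .
  have "\<exists>w. v \<in> anc D C \<longrightarrow> v \<notin> C \<longrightarrow> (v, w) \<in> D \<and> w \<in> anc D C" for v
    by (auto simp: anc_def elim: converse_rtranclE)
  then obtain nx where "\<And>v. v \<in> anc D C \<Longrightarrow> v \<notin> C \<Longrightarrow> (v, nx v) \<in> D \<and> nx v \<in> anc D C" by metis
  then interpret open_trail D C a b p nx using D p assms by unfold_locales auto
  show ?thesis
    by (rule that[of T y]) (use T_parents solution_transfer y_solution y_C y_a y_outside[OF D(3)] in \<open>auto simp: lin_def\<close>)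
qed

section \<open>Separation and independence in the linear model\<close>

lemma lin_0: "(\<lambda>_. 0) \<in> lin V T"
  by (simp add: lin_def)

lemma lin_add: "x \<in> lin V T \<Longrightarrow> y \<in> lin V T \<Longrightarrow> (\<lambda>v. x v + y v) \<in> lin V T"
  by (auto simp: lin_def sum.distrib)

lemma finite_lin:
  assumes "finite V"
  shows "finite (lin V T)"
proof (rule finite_subset)
  show "lin V T \<subseteq> {f. \<forall>x. (x \<in> V \<longrightarrow> f x \<in> {0, 1}) \<and> (x \<notin> V \<longrightarrow> f x = 0)}"
    by (auto simp: lin_def)
  show "finite {f. \<forall>x. (x \<in> V \<longrightarrow> f x \<in> {0, 1 :: bit}) \<and> (x \<notin> V \<longrightarrow> f x = 0)}"
    using assms by (intro finite_set_of_finite_funs) auto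
qed

text \<open>Outside \<open>C\<close>, where \<open>l\<close> vanishes, a vertex of \<open>S\<close>
  and its chosen parents form a clique of the moral graph. Keeping \<open>l\<close> on the moral
  component of \<open>A\<close> and putting 0 on the rest of \<open>S\<close> therefore respects
  every equation within \<open>S\<close>, and separation keeps \<open>B\<close> out of that
  component.\<close>

lemma lin_separation:
  assumes V: "finite V" "D \<in> dags V" and T: "\<And>v. T v \<subseteq> {u. (u, v) \<in> D}"
    and disj: "A \<subseteq> V" "B \<subseteq> V" "C \<subseteq> V" "A \<inter> C = {}" "B \<inter> C = {}"
    and sep: "\<And>a b. a \<in> A \<Longrightarrow> b \<in> B \<Longrightarrow> \<not> conn D C a b"
    and l: "l \<in> lin V T" "\<And>c. c \<in> C \<Longrightarrow> l c = 0"
  obtains z where "z \<in> lin V T" "\<And>v. v \<in> A \<Longrightarrow> z v = l v" "\<And>v. v \<in> B \<union> C \<Longrightarrow> z v = 0"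
proof -
  define S where "S = anc D (A \<union> B \<union> C)"
  define M where "M = {v. \<exists>a\<in>A. (a, v) \<in> (moral D S C)\<^sup>*}"
  define z0 where "z0 v = (if v \<in> M then l v else 0)" for v
  have DV: "D \<subseteq> V \<times> V" "acyclic D" using V by (auto simp: dags_def)
  have wf: "wf D" using DV finite_dag[OF V] by (simp add: finite_acyclic_wf)
  \<comment> \<open>\<open>S\<close> is closed under parents, so the values outside \<open>S\<close>
    can be computed from the equations by recursion along \<open>D\<close>; free vertices there get
    0.\<close>
  define F where "F f v = (if v \<in> S then z0 v else if T v \<noteq> {} then (\<Sum>u\<in>T v. f u) else 0)" for f v
  define z where "z = wfrec D F"
  have z: "z v = F z v" for v
  proof -
    have "z v = F (cut z D v) v" unfolding z_def by (rule wfrec[OF wf])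
    moreover have "(\<Sum>u\<in>T v. cut z D v u) = (\<Sum>u\<in>T v. z u)"
      using T by (intro sum.cong) (auto simp: cut_def)
    ultimately show ?thesis by (simp add: F_def)
  qed
  have par: "u \<in> S" if "v \<in> S" "u \<in> T v" for u v
    using that T anc_parent unfolding S_def by fastforce
  have SV: "S \<subseteq> V"
  proof
    fix v assume "v \<in> S"
    then obtain c where "c \<in> V" "(v, c) \<in> D\<^sup>*" using disj by (auto simp: S_def anc_def)
    then show "v \<in> V" using DV by (auto elim: converse_rtranclE)
  qed
  have A: "A \<subseteq> M" by (auto simp: M_def)
  have MC: "v \<notin> C" if v: "v \<in> M" for v
  proof -
    obtain a where "a \<in> A" "(a, v) \<in> (moral D S C)\<^sup>*" using v by (auto simp: M_def)
    then show ?thesis using disj by (auto simp: moral_def elim: rtranclE)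
  qed
  have Mstep: "w \<in> M" if "v \<in> M" "(v, w) \<in> moral D S C" for v w
    using that unfolding M_def by (auto intro: rtrancl_into_rtrancl)
  have MB: "v \<notin> M" if "v \<in> B" for v
    using that moral_imp_conn[of _ v D A B C] sep disj by (auto simp: M_def S_def)
  have lT: "l v = (\<Sum>u\<in>T v. l u)" if "T v \<noteq> {}" for v using l(1) that by (auto simp: lin_def)
  \<comment> \<open>In the first case all chosen parents outside \<open>C\<close> lie in
    \<open>M\<close>, and the equation is that of \<open>l\<close>; in the second case none does and
    both sides are 0.\<close>
  have z0: "z0 v = (\<Sum>u\<in>T v. z0 u)" if v: "v \<in> S" "T v \<noteq> {}" for v
  proof (cases "v \<in> M \<or> (v \<in> C \<and> (\<exists>u\<in>T v. u \<in> M))")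
    case True
    have "z0 u = l u" if u: "u \<in> T v" for u
    proof (cases "u \<in> C")
      case False
      have "u \<in> M"
      proof (cases "v \<in> M")
        case True
        then show ?thesis using Mstep[OF True, of u] False MC[OF True] v u par[OF v(1) u] T
          by (auto simp: moral_def)
      next
        case vM: False
        then obtain u' where u': "u' \<in> T v" "u' \<in> M" using True by auto
        then show ?thesis using Mstep[OF u'(2), of u] False MC[OF u'(2)] v u par[OF v(1)] T
          by (auto simp: moral_def)
      qed
      then show ?thesis by (simp add: z0_def)
    qed (use l in \<open>simp add: z0_def\<close>)
    moreover have "z0 v = l v" using True l by (auto simp: z0_def)
    ultimately show ?thesis using lT[OF v(2)] by simp
  next
    case False
    have "u \<notin> M" if u: "u \<in> T v" for u
    proof
      assume uM: "u \<in> M"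
      then have "v \<notin> C" using False u by auto
      then have "(u, v) \<in> moral D S C"
        using v u par[OF v(1) u] MC[OF uM] T by (auto simp: moral_def)
      then show False using Mstep[OF uM] False by auto
    qed
    then show ?thesis using False by (simp add: z0_def)
  qed
  have zS: "z v = z0 v" if "v \<in> S" for v using that z[of v] by (simp add: F_def)
  have "z \<in> lin V T"
  proof -
    have "z v = 0" if "v \<notin> V" for v
    proof -
      have "T v = {}" using that T[of v] DV by auto
      moreover have "v \<notin> S" using SV that by auto
      ultimately show ?thesis using z[of v] by (simp add: F_def)
    qed
    moreover have "z v = (\<Sum>u\<in>T v. z u)" if "T v \<noteq> {}" for v
    proof (cases "v \<in> S")
      case True
      then have "(\<Sum>u\<in>T v. z u) = (\<Sum>u\<in>T v. z0 u)" using zS par by (intro sum.cong) auto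
      then show ?thesis using zS[OF True] z0[OF True that] by simp
    next
      case False
      then show ?thesis using z[of v] that by (simp add: F_def)
    qed
    ultimately show ?thesis by (auto simp: lin_def)
  qed
  moreover have "A \<union> B \<union> C \<subseteq> S" unfolding S_def by (rule subset_anc)
  then have "z v = l v" if "v \<in> A" for v
    using zS[of v] that subsetD[OF A that] by (auto simp: z0_def)
  moreover have "z v = 0" if "v \<in> B \<union> C" for v
  proof -
    have "v \<notin> M" using that MB MC by blast
    then show ?thesis using zS[of v] that \<open>A \<union> B \<union> C \<subseteq> S\<close> by (auto simp: z0_def)
  qed
  ultimately show ?thesis using that by blast
qed

text \<open>The involution that swaps the \<open>A\<close>-coordinates of two elements of a fibre shows that,
  for the uniform distribution on the fibre, functions of the \<open>A\<close>- and \<open>B\<close>-coordinates are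
  uncorrelated.\<close>

lemma swap_product_sum:
  fixes e f :: "('v \<Rightarrow> bit) \<Rightarrow> real"
  assumes fin: "finite L" and add: "\<And>x y. x \<in> L \<Longrightarrow> y \<in> L \<Longrightarrow> (\<lambda>v. x v + y v) \<in> L"
    and sep: "\<And>l. l \<in> L \<Longrightarrow> (\<And>c. c \<in> C \<Longrightarrow> l c = 0) \<Longrightarrow>
      \<exists>z\<in>L. (\<forall>v\<in>A. z v = l v) \<and> (\<forall>v\<in>B \<union> C. z v = 0)"
    and e: "\<And>x y. (\<And>v. v \<in> A \<Longrightarrow> x v = y v) \<Longrightarrow> e x = e y"
    and f: "\<And>x y. (\<And>v. v \<in> B \<Longrightarrow> x v = y v) \<Longrightarrow> f x = f y"
    and Lk: "Lk = {x \<in> L. \<forall>c\<in>C. x c = k c}"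
  shows "real (card Lk) * (\<Sum>x\<in>Lk. e x * f x) = (\<Sum>x\<in>Lk. e x) * (\<Sum>x\<in>Lk. f x)"
proof -
  have finLk: "finite Lk" using fin Lk by simp
  define s where "s l = (SOME z. z \<in> L \<and> (\<forall>v\<in>A. z v = l v) \<and> (\<forall>v\<in>B \<union> C. z v = 0))" for l
  have s: "s l \<in> L \<and> (\<forall>v\<in>A. s l v = l v) \<and> (\<forall>v\<in>B \<union> C. s l v = 0)"
    if "l \<in> L" "\<And>c. c \<in> C \<Longrightarrow> l c = 0" for l
  proof -
    from sep[OF that] have "\<exists>z. z \<in> L \<and> (\<forall>v\<in>A. z v = l v) \<and> (\<forall>v\<in>B \<union> C. z v = 0)" by blast
    from someI_ex[OF this] show ?thesis unfolding s_def .
  qed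
  \<comment> \<open>The correction \<open>d\<close> agrees with the sum of the two vectors on
    \<open>A\<close> and vanishes on \<open>B \<union> C\<close>. It depends on this sum only, and
    adding \<open>d\<close> to both vectors leaves the sum unchanged; hence \<open>P\<close> is an
    involution.\<close>
  define P where "P = (\<lambda>x :: ('v \<Rightarrow> bit) \<times> ('v \<Rightarrow> bit).
    let d = s (\<lambda>v. fst x v + snd x v) in ((\<lambda>v. fst x v + d v), (\<lambda>v. snd x v + d v)))"
  have cancel: "x + y + y = x" "x + y + (z + y) = x + z" for x y z :: bit
    by (cases "x = 0"; cases "y = 0"; cases "z = 0"; simp)+
  have d: "s (\<lambda>v. x v + y v) \<in> L \<and> (\<forall>v\<in>A. s (\<lambda>v. x v + y v) v = x v + y v) \<and>
      (\<forall>v\<in>B \<union> C. s (\<lambda>v. x v + y v) v = 0)" if "x \<in> Lk" "y \<in> Lk" for x y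
    using that s[of "\<lambda>v. x v + y v"] add by (auto simp: Lk bit_add_self)
  have P_in: "P x \<in> Lk \<times> Lk" if "x \<in> Lk \<times> Lk" for x
    using that d add by (auto simp: P_def Let_def Lk)
  have P_P: "P (P x) = x" for x
    by (cases x) (simp add: P_def Let_def cancel)
  have bij: "bij_betw P (Lk \<times> Lk) (Lk \<times> Lk)"
  proof (rule bij_betw_byWitness[where f' = P])
    show "P ` (Lk \<times> Lk) \<subseteq> Lk \<times> Lk" "P ` (Lk \<times> Lk) \<subseteq> Lk \<times> Lk" using P_in by blast+
  qed (simp_all add: P_P)
  have "(\<Sum>x\<in>Lk. e x) * (\<Sum>x\<in>Lk. f x) = (\<Sum>(x, y)\<in>Lk \<times> Lk. e x * f y)"
    by (simp add: sum_product sum.cartesian_product)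
  also have "\<dots> = (\<Sum>x\<in>Lk \<times> Lk. (\<lambda>(x, y). e x * f y) (P x))"
    by (rule sum.reindex_bij_betw[OF bij, symmetric])
  also have "\<dots> = (\<Sum>(x, y)\<in>Lk \<times> Lk. e y * f y)"
  proof (rule sum.cong[OF refl])
    fix xy assume "xy \<in> Lk \<times> Lk"
    then obtain x y where xy: "xy = (x, y)" "x \<in> Lk" "y \<in> Lk" by auto
    have "e (\<lambda>v. x v + s (\<lambda>v. x v + y v) v) = e y"
    proof (rule e)
      fix v assume "v \<in> A"
      then have "s (\<lambda>v. x v + y v) v = x v + y v" using d xy by blast
      then show "x v + s (\<lambda>v. x v + y v) v = y v" by (cases "x v = 0"; cases "y v = 0") auto
    qed
    moreover have "f (\<lambda>v. y v + s (\<lambda>v. x v + y v) v) = f y"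
      by (rule f) (use d xy in auto)
    ultimately show "(\<lambda>(x, y). e x * f y) (P xy) = (\<lambda>(x, y). e y * f y) xy"
      using xy by (simp add: P_def Let_def)
  qed
  also have "\<dots> = real (card Lk) * (\<Sum>x\<in>Lk. e x * f x)"
    by (simp add: sum.cartesian_product[symmetric])
  finally show ?thesis by simp
qed

text \<open>Each component \<open>Q x\<close> gives \<open>G i\<close> probability 1 or 0 according
  to its key \<open>k x\<close>, and on \<open>F\<close> only the key matters. Conditioning the
  uniform mixture on \<open>F\<close> thus averages \<open>measure (Q x) H\<close> over the
  components with the observed key.\<close>

lemma mixture_cond_exp:
  fixes Q :: "'b \<Rightarrow> 'a measure" and k :: "'b \<Rightarrow> 'k"
  assumes P: "prob_space P" and sub: "subalgebra P F"
    and L: "finite L" "L \<noteq> {}"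
    and Q: "\<And>x. x \<in> L \<Longrightarrow> prob_space (Q x)" "\<And>x. x \<in> L \<Longrightarrow> sets (Q x) = sets P"
    and mix: "\<And>S. S \<in> sets P \<Longrightarrow> measure P S = (\<Sum>x\<in>L. measure (Q x) S) / card L"
    and G: "\<And>i. i \<in> k ` L \<Longrightarrow> G i \<in> sets F"
      "\<And>i x. i \<in> k ` L \<Longrightarrow> x \<in> L \<Longrightarrow> measure (Q x) (G i) = (if k x = i then 1 else 0)"
    and QF: "\<And>S x y. S \<in> sets F \<Longrightarrow> x \<in> L \<Longrightarrow> y \<in> L \<Longrightarrow> k x = k y \<Longrightarrow> measure (Q x) S = measure (Q y) S"
    and H: "H \<in> sets P"
      "\<And>S x. S \<in> sets F \<Longrightarrow> x \<in> L \<Longrightarrow> measure (Q x) (H \<inter> S) = measure (Q x) H * measure (Q x) S"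
  shows "AE \<omega> in P. real_cond_exp P F (indicator H) \<omega> =
    (\<Sum>i\<in>k ` L. (\<Sum>x\<in>{x\<in>L. k x = i}. measure (Q x) H) / card {x\<in>L. k x = i} * indicator (G i) \<omega>)"
proof -
  interpret P: prob_space P by fact
  interpret finite_measure_subalgebra P F by unfold_locales (rule sub)
  have FP: "S \<in> sets P" if "S \<in> sets F" for S using sub that by (auto simp: subalgebra_def)
  define c where "c i = (\<Sum>x\<in>{x\<in>L. k x = i}. measure (Q x) H) / card {x\<in>L. k x = i}" for i
  let ?g = "\<lambda>\<omega>. \<Sum>i\<in>k ` L. c i * indicator (G i) \<omega>"
  have [measurable]: "G i \<in> sets P" if "i \<in> k ` L" for i using G FP that by auto
  have "AE \<omega> in P. real_cond_exp P F (indicator H) \<omega> = ?g \<omega>"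
  proof (rule real_cond_exp_charact)
    fix S assume S: "S \<in> sets F"
    have [measurable]: "S \<in> sets P" "H \<in> sets P" using FP S H by auto
    have one: "measure P (S \<inter> G i) = (\<Sum>x\<in>{x\<in>L. k x = i}. measure (Q x) S) / card L" if i: "i \<in> k ` L" for i
    proof -
      have "measure (Q x) (S \<inter> G i) = (if k x = i then measure (Q x) S else 0)" if x: "x \<in> L" for x
      proof -
        interpret Qx: prob_space "Q x" using Q x by auto
        have m: "S \<in> Qx.events" "G i \<in> Qx.events" using Q(2)[OF x] i by auto
        show ?thesis
        proof (cases "k x = i")
          case True
          then have "AE \<omega> in Q x. \<omega> \<in> G i" using G(2)[OF i x] m by (simp add: Qx.prob_eq_1)
          then have "Qx.prob (S \<inter> G i) = Qx.prob S" using m by (intro Qx.finite_measure_eq_AE) auto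
          then show ?thesis using True by simp
        next
          case False
          then have "Qx.prob (S \<inter> G i) \<le> 0"
            using G(2)[OF i x] m Qx.finite_measure_mono[of "S \<inter> G i" "G i"] by auto
          then show ?thesis using False by (simp add: measure_le_0_iff)
        qed
      qed
      then have "(\<Sum>x\<in>L. measure (Q x) (S \<inter> G i)) = (\<Sum>x\<in>{x\<in>L. k x = i}. measure (Q x) S)"
        using L by (simp add: sum.If_cases Int_def)
      then show ?thesis using mix[of "S \<inter> G i"] i by simp
    qed
    have fib: "(\<Sum>x\<in>{x\<in>L. k x = i}. measure (Q x) H * measure (Q x) S) =
        c i * (\<Sum>x\<in>{x\<in>L. k x = i}. measure (Q x) S)" if i: "i \<in> k ` L" for i
    proof -
      obtain x0 where x0: "x0 \<in> L" "k x0 = i" using i by auto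
      have e: "measure (Q x) S = measure (Q x0) S" if "x \<in> {x\<in>L. k x = i}" for x
        using QF[OF S, of x x0] that x0 by auto
      have "card {x\<in>L. k x = i} \<noteq> 0" using L x0 by auto
      then show ?thesis using e by (simp add: c_def sum_distrib_right[symmetric])
    qed
    have "(\<integral>\<omega>\<in>S. ?g \<omega> \<partial>P) = (\<integral>\<omega>. (\<Sum>i\<in>k ` L. c i * indicator (S \<inter> G i) \<omega>) \<partial>P)"
      unfolding set_lebesgue_integral_def
      by (intro Bochner_Integration.integral_cong) (auto simp: indicator_def sum_distrib_left intro!: sum.cong)
    also have "\<dots> = (\<Sum>i\<in>k ` L. c i * measure P (S \<inter> G i))"
    proof (subst Bochner_Integration.integral_sum)
      fix i assume "i \<in> k ` L"
      then have "S \<inter> G i \<in> P.events" by measurable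
      then have "integrable P (indicator (S \<inter> G i) :: 'a \<Rightarrow> real)"
        by (intro integrable_real_indicator) (auto simp: P.emeasure_eq_measure)
      then show "integrable P (\<lambda>\<omega>. c i * indicator (S \<inter> G i) \<omega>)" by simp
    qed simp
    also have "\<dots> = (\<Sum>i\<in>k ` L. (\<Sum>x\<in>{x\<in>L. k x = i}. measure (Q x) H * measure (Q x) S) / card L)"
      by (intro sum.cong refl) (simp add: one fib)
    also have "\<dots> = (\<Sum>i\<in>k ` L. (\<Sum>x\<in>{x\<in>L. k x = i}. measure (Q x) H * measure (Q x) S)) / card L"
      by (rule sum_divide_distrib[symmetric])
    also have "\<dots> = (\<Sum>x\<in>L. measure (Q x) (H \<inter> S)) / card L"
      using L H(2)[OF S] by (subst sum.image_gen[of L _ k]) (auto intro!: sum.cong)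
    also have "\<dots> = measure P (H \<inter> S)" using mix[of "H \<inter> S"] by simp
    also have "\<dots> = (\<integral>\<omega>\<in>S. indicator H \<omega> \<partial>P)"
      unfolding set_lebesgue_integral_def by (simp add: indicator_inter_arith[symmetric] Int_commute)
    finally show "(\<integral>\<omega>\<in>S. indicator H \<omega> \<partial>P) = (\<integral>\<omega>\<in>S. ?g \<omega> \<partial>P)" by simp
  next
    show "integrable P (indicator H :: 'a \<Rightarrow> real)"
      using H(1) by (intro integrable_real_indicator) (auto simp: P.emeasure_eq_measure)
    show "integrable P ?g"
      by (intro Bochner_Integration.integrable_sum integrable_mult_right integrable_real_indicator)
        (auto simp: P.emeasure_eq_measure)
    show "?g \<in> borel_measurable F"
      using G(1) by (intro borel_measurable_sum borel_measurable_times) auto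
  qed
  then show ?thesis by (simp add: c_def)
qed

section \<open>Mixtures of product measures\<close>

text \<open>Each coordinate encodes a bit: \<open>\<nu> v i\<close> is its law given the bit
  \<open>i\<close>, and \<open>B v\<close> decodes the bit almost surely. \<open>prob_\<nu>\<close>
  ranges over all indices because \<open>product_prob_space\<close> does.\<close>

locale bit_mixture =
  fixes V :: "'v set" and \<mu> :: "'v \<Rightarrow> 'x measure" and \<nu> :: "'v \<Rightarrow> bit \<Rightarrow> 'x measure" and B :: "'v \<Rightarrow> 'x set"
  assumes finV: "finite V"
    and sigma_finite: "\<And>v. v \<in> V \<Longrightarrow> sigma_finite_measure (\<mu> v)"
    and prob_\<nu>: "\<And>v i. prob_space (\<nu> v i)"
    and density_\<nu>: "\<And>v i. v \<in> V \<Longrightarrow> \<exists>f\<in>borel_measurable (\<mu> v). \<nu> v i = density (\<mu> v) f"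
    and B: "\<And>v. v \<in> V \<Longrightarrow> B v \<in> sets (\<mu> v)"
    and AE_B: "\<And>v i. v \<in> V \<Longrightarrow> AE t in \<nu> v i. t \<in> B v \<longleftrightarrow> i = 1"
begin

definition Q :: "('v \<Rightarrow> bit) \<Rightarrow> ('v \<Rightarrow> 'x) measure" where
  "Q \<beta> = PiM V (\<lambda>v. \<nu> v (\<beta> v))"

abbreviation N where "N \<equiv> PiM V \<mu>"

definition \<sigma> :: "'v set \<Rightarrow> ('v \<Rightarrow> 'x) measure" where
  "\<sigma> A = vimage_algebra (space N) (\<lambda>x. restrict x A) (PiM A \<mu>)"

lemma sets_\<nu>: "v \<in> V \<Longrightarrow> sets (\<nu> v i) = sets (\<mu> v)"
  using density_\<nu>[of v i] by auto

lemma product_\<nu>: "product_prob_space (\<lambda>v. \<nu> v (\<beta> v))"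
  by (intro product_prob_space.intro product_sigma_finite.intro product_prob_space_axioms.intro
      prob_space_imp_sigma_finite prob_\<nu>)

lemma sets_Q: "sets (Q \<beta>) = sets N"
  unfolding Q_def by (intro sets_PiM_cong refl sets_\<nu>)

lemma space_Q: "space (Q \<beta>) = space N"
  by (rule sets_eq_imp_space_eq[OF sets_Q])

lemma prob_Q: "prob_space (Q \<beta>)"
  unfolding Q_def by (intro prob_space_PiM prob_\<nu>)

lemma Q_absolutely_continuous: "absolutely_continuous N (Q \<beta>)"
proof -
  \<comment> \<open>\<open>product_sigma_finite\<close> ranges over all indices, so
    \<open>\<mu>\<close> is replaced by a probability measure outside \<open>V\<close>; the product
    over \<open>V\<close> does not change.\<close>
  define \<mu>' where "\<mu>' v = (if v \<in> V then \<mu> v else \<nu> v 0)" for v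
  have N: "N = PiM V \<mu>'" by (intro PiM_cong) (auto simp: \<mu>'_def)
  interpret M: product_sigma_finite \<mu>'
    by (rule product_sigma_finite.intro)
      (simp add: \<mu>'_def sigma_finite prob_\<nu> prob_space_imp_sigma_finite)
  have "\<forall>v\<in>V. \<exists>f. f \<in> borel_measurable (\<mu>' v) \<and> \<nu> v (\<beta> v) = density (\<mu>' v) f"
  proof
    fix v assume "v \<in> V"
    then show "\<exists>f. f \<in> borel_measurable (\<mu>' v) \<and> \<nu> v (\<beta> v) = density (\<mu>' v) f"
      using density_\<nu>[of v "\<beta> v"] by (auto simp: \<mu>'_def)
  qed
  from bchoice[OF this] obtain f where f: "\<And>v. v \<in> V \<Longrightarrow> f v \<in> borel_measurable (\<mu>' v)"
    "\<And>v. v \<in> V \<Longrightarrow> \<nu> v (\<beta> v) = density (\<mu>' v) (f v)" by blast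
  have [measurable]: "(\<lambda>x. \<Prod>v\<in>V. f v (x v)) \<in> borel_measurable (PiM V \<mu>')"
    using f by (intro borel_measurable_prod_ennreal) (auto intro: measurable_compose[OF measurable_component_singleton])
  interpret P: product_prob_space "\<lambda>v. \<nu> v (\<beta> v)" V by (rule product_\<nu>)
  have "density (PiM V \<mu>') (\<lambda>x. \<Prod>v\<in>V. f v (x v)) = Q \<beta>"
    unfolding Q_def
  proof (rule P.PiM_eqI[OF finV])
    show "sets (density (PiM V \<mu>') (\<lambda>x. \<Prod>v\<in>V. f v (x v))) = sets (PiM V (\<lambda>v. \<nu> v (\<beta> v)))"
      using sets_Q[of \<beta>] N by (simp add: Q_def)
    fix A assume "\<And>v. v \<in> V \<Longrightarrow> A v \<in> sets (\<nu> v (\<beta> v))"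
    then have A: "A v \<in> sets (\<mu>' v)" if "v \<in> V" for v using sets_\<nu> that by (simp add: \<mu>'_def)
    have "emeasure (density (PiM V \<mu>') (\<lambda>x. \<Prod>v\<in>V. f v (x v))) (Pi\<^sub>E V A)
      = (\<integral>\<^sup>+x. (\<Prod>v\<in>V. f v (x v)) * indicator (Pi\<^sub>E V A) x \<partial>PiM V \<mu>')"
      using A finV by (intro emeasure_density) (auto intro!: sets_PiM_I_finite)
    also have "\<dots> = (\<integral>\<^sup>+x. (\<Prod>v\<in>V. f v (x v) * indicator (A v) (x v)) \<partial>PiM V \<mu>')"
    proof (rule nn_integral_cong)
      fix x assume x: "x \<in> space (PiM V \<mu>')"
      show "(\<Prod>v\<in>V. f v (x v)) * indicator (Pi\<^sub>E V A) x = (\<Prod>v\<in>V. f v (x v) * indicator (A v) (x v))"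
      proof (cases "x \<in> Pi\<^sub>E V A")
        case True
        then show ?thesis by (auto simp: PiE_iff intro!: prod.cong)
      next
        case False
        then obtain v where "v \<in> V" "x v \<notin> A v" using x by (auto simp: space_PiM PiE_iff)
        then have "(\<Prod>v\<in>V. f v (x v) * indicator (A v) (x v)) = 0"
          by (intro prod_zero[OF finV] bexI[of _ v]) auto
        then show ?thesis using False by simp
      qed
    qed
    also have "\<dots> = (\<Prod>v\<in>V. \<integral>\<^sup>+t. f v t * indicator (A v) t \<partial>\<mu>' v)"
      using f A finV by (intro M.product_nn_integral_prod) auto
    also have "\<dots> = (\<Prod>v\<in>V. emeasure (\<nu> v (\<beta> v)) (A v))"
      using f A by (intro prod.cong refl) (simp add: emeasure_density)
    finally show "emeasure (density (PiM V \<mu>') (\<lambda>x. \<Prod>v\<in>V. f v (x v))) (Pi\<^sub>E V A)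
      = (\<Prod>v\<in>V. emeasure (\<nu> v (\<beta> v)) (A v))" .
  qed
  moreover have "absolutely_continuous (PiM V \<mu>') (density (PiM V \<mu>') (\<lambda>x. \<Prod>v\<in>V. f v (x v)))"
    by (rule absolutely_continuousI_density) measurable
  ultimately show ?thesis unfolding N by simp
qed

lemma restrict_measurable: "A \<subseteq> V \<Longrightarrow> (\<lambda>x. restrict x A) \<in> N \<rightarrow>\<^sub>M PiM A \<mu>"
  by (rule measurable_restrict_subset)

lemma sets_\<sigma>: "A \<subseteq> V \<Longrightarrow> sets (\<sigma> A) = {(\<lambda>x. restrict x A) -` E \<inter> space N | E. E \<in> sets (PiM A \<mu>)}"
  unfolding \<sigma>_def using measurable_space[OF restrict_measurable] by (intro sets_vimage_algebra2) auto

lemma \<sigma>_subset: "A \<subseteq> V \<Longrightarrow> sets (\<sigma> A) \<subseteq> sets N"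
  using measurable_sets[OF restrict_measurable] by (auto simp: sets_\<sigma>)

lemma \<sigma>_mono:
  assumes "A \<subseteq> A'" "A' \<subseteq> V"
  shows "sets (\<sigma> A) \<subseteq> sets (\<sigma> A')"
proof
  fix X assume "X \<in> sets (\<sigma> A)"
  then obtain E where E: "E \<in> sets (PiM A \<mu>)" "X = (\<lambda>x. restrict x A) -` E \<inter> space N"
    using assms sets_\<sigma>[of A] by auto
  have "(\<lambda>x. restrict x A) -` E \<inter> space (PiM A' \<mu>) \<in> sets (PiM A' \<mu>)"
    using E(1) assms(1) by (intro measurable_sets[OF measurable_restrict_subset]) auto
  moreover have "X = (\<lambda>x. restrict x A') -` ((\<lambda>x. restrict x A) -` E \<inter> space (PiM A' \<mu>)) \<inter> space N"
    using assms measurable_space[OF restrict_measurable[OF assms(2)]]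
    by (auto simp: E(2) Int_absorb1 restrict_restrict)
  ultimately show "X \<in> sets (\<sigma> A')" using sets_\<sigma>[OF assms(2)] by blast
qed

lemma Q_cong:
  assumes "A \<subseteq> V" "X \<in> sets (\<sigma> A)" "\<And>v. v \<in> A \<Longrightarrow> \<beta> v = \<beta>' v"
  shows "measure (Q \<beta>) X = measure (Q \<beta>') X"
proof -
  obtain E where E: "E \<in> sets (PiM A \<mu>)" "X = (\<lambda>x. restrict x A) -` E \<inter> space N"
    using assms sets_\<sigma>[of A] by auto
  have "measure (Q \<beta>) X = measure (PiM A (\<lambda>v. \<nu> v (\<beta> v))) E" for \<beta>
  proof -
    interpret P: product_prob_space "\<lambda>v. \<nu> v (\<beta> v)" V by (rule product_\<nu>)
    have s: "sets (PiM A (\<lambda>v. \<nu> v (\<beta> v))) = sets (PiM A \<mu>)"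
      using assms(1) by (intro sets_PiM_cong refl sets_\<nu>) auto
    have "measure (PiM A (\<lambda>v. \<nu> v (\<beta> v))) E = measure (Q \<beta>) ((\<lambda>x. restrict x A) -` E \<inter> space (Q \<beta>))"
      unfolding Q_def using E(1) s assms(1)
      by (subst P.distr_restrict[OF assms(1) finV], subst measure_distr)
        (auto intro!: measurable_restrict_subset)
    then show ?thesis by (simp add: E(2) space_Q)
  qed
  moreover have "PiM A (\<lambda>v. \<nu> v (\<beta> v)) = PiM A (\<lambda>v. \<nu> v (\<beta>' v))"
    using assms(3) by (intro PiM_cong) auto
  ultimately show ?thesis by simp
qed

lemma Q_indep:
  assumes "A \<subseteq> V" "A' \<subseteq> V" "A \<inter> A' = {}" "X \<in> sets (\<sigma> A)" "Y \<in> sets (\<sigma> A')"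
  shows "measure (Q \<beta>) (X \<inter> Y) = measure (Q \<beta>) X * measure (Q \<beta>) Y"
proof -
  interpret P: product_prob_space "\<lambda>v. \<nu> v (\<beta> v)" V by (rule product_\<nu>)
  interpret Q: prob_space "Q \<beta>" by (rule prob_Q)
  have "Q.indep_vars (\<lambda>v. \<nu> v (\<beta> v)) (\<lambda>v x. x v) V"
  proof (cases "V = {}")
    case True
    then show ?thesis unfolding Q.indep_vars_def Q.indep_sets_def by auto
  next
    case False
    have "distr (Q \<beta>) (PiM V (\<lambda>v. \<nu> v (\<beta> v))) (\<lambda>x. \<lambda>v\<in>V. x v) = Q \<beta>"
      unfolding Q_def by (rule distr_id2[OF refl, THEN trans[rotated]], rule distr_cong)
        (auto simp: space_PiM PiE_iff extensional_restrict)
    also have "\<dots> = PiM V (\<lambda>v. distr (Q \<beta>) (\<nu> v (\<beta> v)) (\<lambda>x. x v))"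
      unfolding Q_def by (intro PiM_cong refl distr_PiM_component[symmetric] prob_\<nu>) auto
    finally show ?thesis using False
      by (subst Q.indep_vars_iff_distr_eq_PiM') (auto simp: Q_def)
  qed
  from Q.indep_var_restrict[OF this assms(3,1,2)]
  have ind: "Q.indep_var (PiM A (\<lambda>v. \<nu> v (\<beta> v))) (\<lambda>x. restrict x A)
     (PiM A' (\<lambda>v. \<nu> v (\<beta> v))) (\<lambda>x. restrict x A')" by simp
  have s: "sets (PiM A (\<lambda>v. \<nu> v (\<beta> v))) = sets (PiM A \<mu>)" if "A \<subseteq> V" for A
    using that by (intro sets_PiM_cong refl sets_\<nu>) auto
  obtain E where E: "E \<in> sets (PiM A \<mu>)" "X = (\<lambda>x. restrict x A) -` E \<inter> space N"
    using assms sets_\<sigma>[of A] by auto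
  obtain F where F: "F \<in> sets (PiM A' \<mu>)" "Y = (\<lambda>x. restrict x A') -` F \<inter> space N"
    using assms sets_\<sigma>[of A'] by auto
  have "X \<inter> Y = (\<lambda>x. (restrict x A, restrict x A')) -` (E \<times> F) \<inter> space (Q \<beta>)"
    by (auto simp: E F space_Q)
  moreover have "E \<in> sets (PiM A (\<lambda>v. \<nu> v (\<beta> v)))" "F \<in> sets (PiM A' (\<lambda>v. \<nu> v (\<beta> v)))"
    using E F s assms(1,2) by blast+
  ultimately show ?thesis using Q.indep_varD[OF ind] by (simp only: E(2) F(2) space_Q)
qed

section \<open>Uniform mixtures over sets of bit vectors\<close>

definition mix :: "('v \<Rightarrow> bit) set \<Rightarrow> ('v \<Rightarrow> 'x) measure" where
  "mix L = measure_pmf (pmf_of_set L) \<bind> Q"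

lemma Q_measurable: "Q \<in> measure_pmf p \<rightarrow>\<^sub>M subprob_algebra N"
  using prob_Q sets_Q by (auto simp: space_subprob_algebra intro: prob_space_imp_subprob_space)

lemma sets_mix: "sets (mix L) = sets N"
  unfolding mix_def by (rule sets_bind) (auto simp: sets_Q)

lemma space_mix: "space (mix L) = space N"
  by (rule sets_eq_imp_space_eq[OF sets_mix])

lemma prob_mix: "prob_space (mix L)"
  unfolding mix_def by (rule prob_space.prob_space_bind[OF prob_space_measure_pmf _ Q_measurable])
    (auto simp: prob_Q)

lemma measure_mix:
  assumes "finite L" "L \<noteq> {}" "S \<in> sets N"
  shows "measure (mix L) S = (\<Sum>\<beta>\<in>L. measure (Q \<beta>) S) / card L"
proof -
  have "measure (mix L) S = (\<integral>\<beta>. measure (Q \<beta>) S \<partial>measure_pmf (pmf_of_set L))"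
    unfolding mix_def
    by (rule subprob_space.measure_bind[OF subprob_space_measure_pmf Q_measurable assms(3)])
  then show ?thesis using assms by (simp add: integral_pmf_of_set)
qed

lemma mix_absolutely_continuous:
  assumes "finite L" "L \<noteq> {}"
  shows "absolutely_continuous N (mix L)"
  unfolding absolutely_continuous_def
proof
  fix S assume S: "S \<in> null_sets N"
  interpret M: prob_space "mix L" by (rule prob_mix)
  have "measure (Q \<beta>) S = 0" for \<beta>
  proof -
    interpret Q: prob_space "Q \<beta>" by (rule prob_Q)
    have "S \<in> null_sets (Q \<beta>)" using Q_absolutely_continuous S by (auto simp: absolutely_continuous_def)
    then show ?thesis by (simp add: measure_def null_sets_def)
  qed
  then have "measure (mix L) S = 0" using measure_mix[OF assms, of S] S by auto
  then show "S \<in> null_sets (mix L)"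
    using S by (auto simp: null_sets_def sets_mix M.emeasure_eq_measure)
qed

text \<open>The key of a fibre: padding with 0 gives equal keys to vectors with equal bits on
  \<open>C\<close>.\<close>

definition \<kappa> :: "'v set \<Rightarrow> ('v \<Rightarrow> bit) \<Rightarrow> 'v \<Rightarrow> bit" where
  "\<kappa> C \<beta> v = (if v \<in> C then \<beta> v else 0)"

text \<open>The event that the bits decoded from the coordinates in \<open>C\<close> are those of
  \<open>k\<close>. Up to null sets it recovers the key from the observed values.\<close>

definition G :: "'v set \<Rightarrow> ('v \<Rightarrow> bit) \<Rightarrow> ('v \<Rightarrow> 'x) set" where
  "G C k = {x \<in> space N. \<forall>v\<in>C. x v \<in> B v \<longleftrightarrow> k v = 1}"

lemma G_\<sigma>:
  assumes "C \<subseteq> V"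
  shows "G C k \<in> sets (\<sigma> C)"
proof -
  have fC: "finite C" using assms finV finite_subset by auto
  have [measurable]: "v \<in> C \<Longrightarrow> B v \<in> sets (\<mu> v)" for v using B assms by auto
  have "{y \<in> space (PiM C \<mu>). \<forall>v\<in>C. y v \<in> B v \<longleftrightarrow> k v = 1} \<in> sets (PiM C \<mu>)"
    using fC by measurable
  moreover have "G C k = (\<lambda>x. restrict x C) -` {y \<in> space (PiM C \<mu>). \<forall>v\<in>C. y v \<in> B v \<longleftrightarrow> k v = 1} \<inter> space N"
    using measurable_space[OF restrict_measurable[OF assms]] by (auto simp: G_def)
  ultimately show ?thesis using sets_\<sigma>[OF assms] by blast
qed

lemma AE_Q: "v \<in> V \<Longrightarrow> AE x in Q \<beta>. x v \<in> B v \<longleftrightarrow> \<beta> v = 1"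
  unfolding Q_def by (rule AE_PiM_component[OF prob_\<nu> _ AE_B])

lemma Q_G:
  assumes "C \<subseteq> V"
  shows "measure (Q \<beta>) (G C k) = (if \<forall>v\<in>C. k v = \<beta> v then 1 else 0)"
proof -
  interpret Q: prob_space "Q \<beta>" by (rule prob_Q)
  have ev: "G C k \<in> Q.events" using G_\<sigma> \<sigma>_subset sets_Q assms by auto
  have AE: "AE x in Q \<beta>. \<forall>v\<in>C. x v \<in> B v \<longleftrightarrow> \<beta> v = 1"
    using assms finV AE_Q by (intro AE_finite_allI) (auto intro: finite_subset)
  show ?thesis
  proof (cases "\<forall>v\<in>C. k v = \<beta> v")
    case True
    have "AE x in Q \<beta>. x \<in> G C k"
      using AE AE_space by eventually_elim (use True in \<open>auto simp: G_def space_Q\<close>)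
    then show ?thesis using True ev by (simp add: Q.prob_eq_1)
  next
    case False
    then obtain v where v: "v \<in> C" "k v \<noteq> \<beta> v" by auto
    have "AE x in Q \<beta>. x \<notin> G C k"
      using AE
    proof eventually_elim
      case (elim x)
      then show ?case using v bit_not_zero_iff by (auto simp: G_def) (metis bit_not_zero_iff)+
    qed
    then show ?thesis using False ev by (auto simp: Q.prob_eq_0)
  qed
qed

definition fibre :: "('v \<Rightarrow> bit) set \<Rightarrow> 'v set \<Rightarrow> ('v \<Rightarrow> bit) \<Rightarrow> ('v \<Rightarrow> bit) set" where
  "fibre L C k = {x \<in> L. \<kappa> C x = k}"

lemma mix_cond_exp:
  assumes L: "finite L" "L \<noteq> {}" and A: "A \<subseteq> V" "C \<subseteq> V" "A \<inter> C = {}" and H: "H \<in> sets (\<sigma> A)"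
  shows "AE \<omega> in mix L. real_cond_exp (mix L) (\<sigma> C) (indicator H) \<omega> =
    (\<Sum>k\<in>\<kappa> C ` L. (\<Sum>x\<in>fibre L C k. measure (Q x) H) / card (fibre L C k) * indicator (G C k) \<omega>)"
  unfolding fibre_def
proof (rule mixture_cond_exp[where Q = Q])
  show "subalgebra (mix L) (\<sigma> C)"
    using \<sigma>_subset A by (auto simp: subalgebra_def space_mix sets_mix \<sigma>_def)
  show "H \<in> sets (mix L)" using H \<sigma>_subset A sets_mix by auto
  show "measure (Q x) (G C k) = (if \<kappa> C x = k then 1 else 0)" if "k \<in> \<kappa> C ` L" for k x
  proof -
    have "(\<forall>v\<in>C. k v = x v) \<longleftrightarrow> \<kappa> C x = k" using that unfolding \<kappa>_def fun_eq_iff image_iff by metis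
    then show ?thesis using Q_G[OF A(2), of x k] by simp
  qed
  show "measure (Q x) S = measure (Q y) S" if "S \<in> sets (\<sigma> C)" "\<kappa> C x = \<kappa> C y" for S x y
    using that A by (intro Q_cong[of C]) (auto simp: \<kappa>_def fun_eq_iff split: if_splits)
  show "measure (Q x) (H \<inter> S) = measure (Q x) H * measure (Q x) S" if "S \<in> sets (\<sigma> C)" for S x
    using Q_indep[OF A H that] .
qed (use L A in \<open>auto simp: prob_mix prob_Q sets_Q sets_mix measure_mix G_\<sigma>\<close>)

lemma disjoint_G: "k \<in> \<kappa> C ` L \<Longrightarrow> k' \<in> \<kappa> C ` L \<Longrightarrow> \<omega> \<in> G C k \<Longrightarrow> \<omega> \<in> G C k' \<Longrightarrow> k = k'"
proof
  fix v assume "k \<in> \<kappa> C ` L" "k' \<in> \<kappa> C ` L" "\<omega> \<in> G C k" "\<omega> \<in> G C k'"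
  then show "k v = k' v"
    by (cases "v \<in> C"; cases "k v = 0"; cases "k' v = 0") (auto simp: G_def \<kappa>_def)
qed

lemma sum_G:
  assumes "finite L" "k \<in> \<kappa> C ` L" "\<omega> \<in> G C k"
  shows "(\<Sum>j\<in>\<kappa> C ` L. c j * indicator (G C j) \<omega>) = (c k :: real)"
proof -
  have "(\<Sum>j\<in>\<kappa> C ` L. c j * indicator (G C j) \<omega>) = (\<Sum>j\<in>\<kappa> C ` L. if j = k then c k else 0)"
  proof (rule sum.cong[OF refl])
    fix j assume j: "j \<in> \<kappa> C ` L"
    show "c j * indicator (G C j) \<omega> = (if j = k then c k else 0)"
      using disjoint_G[OF assms(2) j assms(3)] assms(3) by (cases "\<omega> \<in> G C j") auto
  qed
  also have "\<dots> = c k" using assms(1,2) by (subst sum.delta) auto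
  finally show ?thesis .
qed

text \<open>The conditional probabilities given \<open>C\<close> are constant on the events
  \<open>G C k\<close>, which are disjoint and have positive probability for the keys of
  \<open>L\<close>. An almost sure identity is thus one finite identity per fibre, written here
  without division.\<close>

lemma cond_indep_mix_iff:
  assumes L: "finite L" "L \<noteq> {}" and ABC: "A1 \<subseteq> V" "A2 \<subseteq> V" "C \<subseteq> V" "A1 \<inter> A2 = {}" "A1 \<inter> C = {}" "A2 \<inter> C = {}"
  shows "cond_indep_var (mix L) (PiM A1 \<mu>) (\<lambda>x. restrict x A1) (PiM A2 \<mu>) (\<lambda>x. restrict x A2)
      (PiM C \<mu>) (\<lambda>x. restrict x C) \<longleftrightarrow>
    (\<forall>E\<in>sets (\<sigma> A1). \<forall>F\<in>sets (\<sigma> A2). \<forall>k\<in>\<kappa> C ` L.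
       real (card (fibre L C k)) * (\<Sum>x\<in>fibre L C k. measure (Q x) E * measure (Q x) F) =
       (\<Sum>x\<in>fibre L C k. measure (Q x) E) * (\<Sum>x\<in>fibre L C k. measure (Q x) F))"
proof -
  interpret M: prob_space "mix L" by (rule prob_mix)
  define c where "c H k = (\<Sum>x\<in>fibre L C k. measure (Q x) H) / card (fibre L C k)" for H k
  have pt: "(AE \<omega> in mix L. real_cond_exp (mix L) (\<sigma> C) (indicator (E \<inter> F)) \<omega> =
        real_cond_exp (mix L) (\<sigma> C) (indicator E) \<omega> * real_cond_exp (mix L) (\<sigma> C) (indicator F) \<omega>) \<longleftrightarrow>
      (\<forall>k\<in>\<kappa> C ` L. real (card (fibre L C k)) * (\<Sum>x\<in>fibre L C k. measure (Q x) E * measure (Q x) F) =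
       (\<Sum>x\<in>fibre L C k. measure (Q x) E) * (\<Sum>x\<in>fibre L C k. measure (Q x) F))"
    if E: "E \<in> sets (\<sigma> A1)" and F: "F \<in> sets (\<sigma> A2)" for E F
  proof -
    have EF: "E \<in> sets (\<sigma> (A1 \<union> A2))" "F \<in> sets (\<sigma> (A1 \<union> A2))"
      using E F \<sigma>_mono[of A1 "A1 \<union> A2"] \<sigma>_mono[of A2 "A1 \<union> A2"] ABC by auto
    have ce: "AE \<omega> in mix L. real_cond_exp (mix L) (\<sigma> C) (indicator H) \<omega> =
        (\<Sum>k\<in>\<kappa> C ` L. c H k * indicator (G C k) \<omega>)" if "H \<in> sets (\<sigma> (A1 \<union> A2))" for H
      unfolding c_def using that ABC by (intro mix_cond_exp[OF L, of "A1 \<union> A2"]) auto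
    have ae: "AE \<omega> in mix L. (\<forall>H\<in>{E, F, E \<inter> F}. real_cond_exp (mix L) (\<sigma> C) (indicator H) \<omega> =
        (\<Sum>k\<in>\<kappa> C ` L. c H k * indicator (G C k) \<omega>))"
      using ce EF by (intro AE_finite_allI) auto
    have cm: "c (E \<inter> F) k = (\<Sum>x\<in>fibre L C k. measure (Q x) E * measure (Q x) F) / card (fibre L C k)" for k
      unfolding c_def using Q_indep[OF ABC(1,2,4) E F] by simp
    have card: "card (fibre L C k) \<noteq> 0" if "k \<in> \<kappa> C ` L" for k
      using that L by (auto simp: fibre_def)
    have alg: "c (E \<inter> F) k = c E k * c F k \<longleftrightarrow>
        real (card (fibre L C k)) * (\<Sum>x\<in>fibre L C k. measure (Q x) E * measure (Q x) F) =
       (\<Sum>x\<in>fibre L C k. measure (Q x) E) * (\<Sum>x\<in>fibre L C k. measure (Q x) F)" if "k \<in> \<kappa> C ` L" for k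
      unfolding cm using card[OF that] by (auto simp: c_def field_simps)
    have "(AE \<omega> in mix L. real_cond_exp (mix L) (\<sigma> C) (indicator (E \<inter> F)) \<omega> =
        real_cond_exp (mix L) (\<sigma> C) (indicator E) \<omega> * real_cond_exp (mix L) (\<sigma> C) (indicator F) \<omega>) \<longleftrightarrow>
      (\<forall>k\<in>\<kappa> C ` L. c (E \<inter> F) k = c E k * c F k)" (is "?l = ?r")
    proof
      assume l: ?l
      show ?r
      proof
        fix k assume k: "k \<in> \<kappa> C ` L"
        then obtain x where x: "x \<in> L" "k = \<kappa> C x" by auto
        \<comment> \<open>The component of a vector with key \<open>k\<close> gives
          \<open>G C k\<close> full mass, so \<open>G C k\<close> is not null in the mixture, and
          the almost sure identity can be tested on it.\<close>
        have "measure (Q x) (G C k) = 1" using x Q_G[OF ABC(3), of x k] by (auto simp: \<kappa>_def)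
        moreover have "measure (Q x) (G C k) \<le> (\<Sum>x\<in>L. measure (Q x) (G C k))"
          using L x by (intro member_le_sum) auto
        moreover have "G C k \<in> sets N" using G_\<sigma>[OF ABC(3)] \<sigma>_subset[OF ABC(3)] by blast
        moreover have "card L > 0" using L by (simp add: card_gt_0_iff)
        ultimately have "measure (mix L) (G C k) > 0"
          using measure_mix[OF L, of "G C k"] by simp
        then have "\<not> (AE \<omega> in mix L. \<omega> \<notin> G C k)"
          using M.prob_eq_0[of "G C k"] G_\<sigma>[OF ABC(3)] \<sigma>_subset[OF ABC(3)] sets_mix by auto
        moreover have "AE \<omega> in mix L. \<omega> \<in> G C k \<longrightarrow> c (E \<inter> F) k = c E k * c F k"
          using ae l
        proof eventually_elim
          case (elim \<omega>)
          show ?case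
          proof
            assume "\<omega> \<in> G C k"
            then have "(\<Sum>j\<in>\<kappa> C ` L. c H j * indicator (G C j) \<omega>) = c H k" for H
              by (rule sum_G[OF L(1) k])
            then show "c (E \<inter> F) k = c E k * c F k" using elim by auto
          qed
        qed
        ultimately show "c (E \<inter> F) k = c E k * c F k"
          by (cases "c (E \<inter> F) k = c E k * c F k") simp_all
      qed
    next
      assume r: ?r
      show ?l using ae
      proof eventually_elim
        case (elim \<omega>)
        have "(\<Sum>k\<in>\<kappa> C ` L. c (E \<inter> F) k * indicator (G C k) \<omega>) =
          (\<Sum>k\<in>\<kappa> C ` L. c E k * indicator (G C k) \<omega>) * (\<Sum>k\<in>\<kappa> C ` L. c F k * indicator (G C k) \<omega>)"
        proof (cases "\<exists>k\<in>\<kappa> C ` L. \<omega> \<in> G C k")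
          case True
          then obtain k where k: "k \<in> \<kappa> C ` L" "\<omega> \<in> G C k" by blast
          then show ?thesis using r by (simp only: sum_G[OF L(1) k])
        next
          case False
          then have "(\<Sum>k\<in>\<kappa> C ` L. c H k * indicator (G C k) \<omega>) = 0" for H
            by (intro sum.neutral) auto
          then show ?thesis by simp
        qed
        then show ?case using elim by simp
      qed
    qed
    also have "\<dots> \<longleftrightarrow> (\<forall>k\<in>\<kappa> C ` L.
       real (card (fibre L C k)) * (\<Sum>x\<in>fibre L C k. measure (Q x) E * measure (Q x) F) =
       (\<Sum>x\<in>fibre L C k. measure (Q x) E) * (\<Sum>x\<in>fibre L C k. measure (Q x) F))"
      using alg by auto
    finally show ?thesis .
  qed
  have \<sigma>: "vimage_algebra (space (mix L)) (\<lambda>x. restrict x A) (PiM A \<mu>) = \<sigma> A" for A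
    by (simp add: \<sigma>_def space_mix)
  show ?thesis unfolding cond_indep_var_def Let_def \<sigma> using pt by blast
qed

end

context bit_mixture
begin

lemma mix_lin_cond_indep:
  assumes D: "D \<in> dags V" and T: "\<And>v. T v \<subseteq> {u. (u, v) \<in> D}"
    and ABC: "(A1, A2, C) \<in> disjoint_triples V"
    and sep: "\<And>a b. a \<in> A1 \<Longrightarrow> b \<in> A2 \<Longrightarrow> \<not> conn D C a b"
  shows "cond_indep_var (mix (lin V T)) (PiM A1 \<mu>) (\<lambda>x. restrict x A1) (PiM A2 \<mu>) (\<lambda>x. restrict x A2)
      (PiM C \<mu>) (\<lambda>x. restrict x C)"
proof -
  have d: "A1 \<subseteq> V" "A2 \<subseteq> V" "C \<subseteq> V" "A1 \<inter> A2 = {}" "A1 \<inter> C = {}" "A2 \<inter> C = {}"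
    using ABC by (auto simp: disjoint_triples_def)
  have ne: "lin V T \<noteq> {}" using lin_0 by blast
  show ?thesis
    unfolding cond_indep_mix_iff[OF finite_lin[OF finV] ne d]
  proof (intro ballI)
    fix E F k assume E: "E \<in> sets (\<sigma> A1)" and F: "F \<in> sets (\<sigma> A2)" and k: "k \<in> \<kappa> C ` lin V T"
    show "real (card (fibre (lin V T) C k)) * (\<Sum>x\<in>fibre (lin V T) C k. measure (Q x) E * measure (Q x) F)
      = (\<Sum>x\<in>fibre (lin V T) C k. measure (Q x) E) * (\<Sum>x\<in>fibre (lin V T) C k. measure (Q x) F)"
    proof (rule swap_product_sum[OF finite_lin[OF finV, of T]])
      show "fibre (lin V T) C k = {x \<in> lin V T. \<forall>c\<in>C. x c = k c}"
      proof -
        have "\<kappa> C x = k \<longleftrightarrow> (\<forall>c\<in>C. x c = k c)" for x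
          using k unfolding \<kappa>_def fun_eq_iff image_iff by metis
        then show ?thesis by (simp add: fibre_def)
      qed
      show "\<exists>z\<in>lin V T. (\<forall>v\<in>A1. z v = l v) \<and> (\<forall>v\<in>A2 \<union> C. z v = 0)"
        if "l \<in> lin V T" "\<And>c. c \<in> C \<Longrightarrow> l c = 0" for l
        using lin_separation[OF finV D T d(1,2,3,5,6) sep that] by metis
      show "measure (Q x) E = measure (Q y) E" if "\<And>v. v \<in> A1 \<Longrightarrow> x v = y v" for x y
        using Q_cong[OF d(1) E that] .
      show "measure (Q x) F = measure (Q y) F" if "\<And>v. v \<in> A2 \<Longrightarrow> x v = y v" for x y
        using Q_cong[OF d(2) F that] .
    qed (rule lin_add)
  qed
qed

text \<open>On the fibre where the bits on \<open>C\<close> vanish, the bits of \<open>a\<close> and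
  \<open>b\<close> agree. Bit 1 at \<open>a\<close> together with bit 0 at \<open>b\<close> is
  impossible there, although each occurs by itself: the first for \<open>y\<close>, the second for
  the zero vector.\<close>

lemma mix_lin_not_cond_indep:
  assumes "a \<in> V" "b \<in> V" "C \<subseteq> V" "a \<notin> C" "b \<notin> C" "a \<noteq> b"
    and eq: "\<And>l. l \<in> lin V T \<Longrightarrow> (\<And>c. c \<in> C \<Longrightarrow> l c = 0) \<Longrightarrow> l a = l b"
    and y: "y \<in> lin V T" "\<And>c. c \<in> C \<Longrightarrow> y c = 0" "y a = 1"
  shows "\<not> cond_indep_var (mix (lin V T)) (PiM {a} \<mu>) (\<lambda>x. restrict x {a}) (PiM {b} \<mu>) (\<lambda>x. restrict x {b})
      (PiM C \<mu>) (\<lambda>x. restrict x C)"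
proof -
  let ?L = "lin V T" and ?z = "\<lambda>_ :: 'v. 0 :: bit"
  let ?E = "G {a} (\<lambda>_. 1)" and ?F = "G {b} (\<lambda>_. 0)"
  have ne: "?L \<noteq> {}" using lin_0 by blast
  have fin: "finite (fibre ?L C ?z)" using finite_lin[OF finV] by (simp add: fibre_def)
  have \<kappa>0: "\<kappa> C x = ?z \<longleftrightarrow> (\<forall>c\<in>C. x c = 0)" for x by (auto simp: \<kappa>_def fun_eq_iff)
  have k: "?z \<in> \<kappa> C ` ?L" by (rule image_eqI[OF _ lin_0]) (simp add: \<kappa>_def fun_eq_iff)
  have mE: "measure (Q x) ?E = (if x a = 1 then 1 else 0)" for x
    using assms(1) by (subst Q_G) auto
  have mF: "measure (Q x) ?F = (if x b = 0 then 1 else 0)" for x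
    using assms(2) by (subst Q_G) auto
  have "measure (Q x) ?E * measure (Q x) ?F = 0" if "x \<in> fibre ?L C ?z" for x
    using that eq[of x] by (auto simp: fibre_def \<kappa>0 mE mF)
  then have 0: "(\<Sum>x\<in>fibre ?L C ?z. measure (Q x) ?E * measure (Q x) ?F) = 0"
    by (intro sum.neutral) blast
  have "measure (Q y) ?E \<le> (\<Sum>x\<in>fibre ?L C ?z. measure (Q x) ?E)"
    using y fin by (intro member_le_sum) (auto simp: fibre_def \<kappa>0)
  then have E: "1 \<le> (\<Sum>x\<in>fibre ?L C ?z. measure (Q x) ?E)" using y mE[of y] by simp
  have "measure (Q ?z) ?F \<le> (\<Sum>x\<in>fibre ?L C ?z. measure (Q x) ?F)"
    using lin_0 fin by (intro member_le_sum) (auto simp: fibre_def \<kappa>0)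
  then have F: "1 \<le> (\<Sum>x\<in>fibre ?L C ?z. measure (Q x) ?F)" using mF[of ?z] by simp
  show ?thesis
  proof
    assume "cond_indep_var (mix ?L) (PiM {a} \<mu>) (\<lambda>x. restrict x {a}) (PiM {b} \<mu>) (\<lambda>x. restrict x {b})
      (PiM C \<mu>) (\<lambda>x. restrict x C)"
    moreover have "?E \<in> sets (\<sigma> {a})" "?F \<in> sets (\<sigma> {b})" using assms by (auto intro: G_\<sigma>)
    ultimately have "real (card (fibre ?L C ?z)) * (\<Sum>x\<in>fibre ?L C ?z. measure (Q x) ?E * measure (Q x) ?F)
      = (\<Sum>x\<in>fibre ?L C ?z. measure (Q x) ?E) * (\<Sum>x\<in>fibre ?L C ?z. measure (Q x) ?F)"
      using assms k by (subst (asm) cond_indep_mix_iff[OF finite_lin[OF finV] ne]) auto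
    then show False using E F unfolding 0 by auto
  qed
qed

end

text \<open>Uniform measures need finite total mass, while the sets provided by nondegeneracy may
  have infinite measure; sigma-finiteness cuts out a suitable part.\<close>

lemma finite_positive_subset:
  assumes "sigma_finite_measure M" "A \<in> sets M" "emeasure M A > 0"
  obtains S where "S \<in> sets M" "S \<subseteq> A" "emeasure M S \<noteq> 0" "emeasure M S \<noteq> \<infinity>"
proof -
  obtain F :: "nat \<Rightarrow> _" where F: "range F \<subseteq> sets M" "(\<Union>i. F i) = space M" "\<And>i. emeasure M (F i) \<noteq> \<infinity>"
    using sigma_finite_measure.sigma_finite[OF assms(1)] by metis
  have "\<exists>i. emeasure M (A \<inter> F i) \<noteq> 0"
  proof (rule ccontr)
    assume "\<not> ?thesis"
    then have "emeasure M (\<Union>i. A \<inter> F i) = 0"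
      using F assms by (intro emeasure_UN_eq_0) auto
    moreover have "(\<Union>i. A \<inter> F i) = A" using F(2) sets.sets_into_space[OF assms(2)] by auto
    ultimately show False using assms by simp
  qed
  then obtain i where i: "emeasure M (A \<inter> F i) \<noteq> 0" by blast
  have "emeasure M (A \<inter> F i) \<le> emeasure M (F i)" using F by (intro emeasure_mono) auto
  then have "emeasure M (A \<inter> F i) \<noteq> \<infinity>" using F(3)[of i] by (auto simp: top_unique)
  then show ?thesis using that[of "A \<inter> F i"] i F assms by auto
qed

lemma bit_mixture_exists:
  assumes "finite V" "\<And>v. v \<in> V \<Longrightarrow> sigma_finite_measure (\<mu> v)" "\<And>v. v \<in> V \<Longrightarrow> nondegenerate (\<mu> v)"
  shows "\<exists>\<nu> B. bit_mixture V \<mu> \<nu> B"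
proof -
  have "\<forall>v\<in>V. \<exists>S :: bit \<Rightarrow> _. S 0 \<inter> S 1 = {} \<and> (\<forall>i. S i \<in> sets (\<mu> v) \<and> emeasure (\<mu> v) (S i) \<noteq> 0 \<and> emeasure (\<mu> v) (S i) \<noteq> \<infinity>)"
  proof
    fix v assume v: "v \<in> V"
    then obtain A B where AB: "A \<in> sets (\<mu> v)" "B \<in> sets (\<mu> v)" "A \<inter> B = {}"
      "emeasure (\<mu> v) A > 0" "emeasure (\<mu> v) B > 0" using assms(3) unfolding nondegenerate_def by blast
    obtain S0 where S0: "S0 \<in> sets (\<mu> v)" "S0 \<subseteq> A" "emeasure (\<mu> v) S0 \<noteq> 0" "emeasure (\<mu> v) S0 \<noteq> \<infinity>"
      using finite_positive_subset[OF assms(2)[OF v] AB(1,4)] .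
    obtain S1 where S1: "S1 \<in> sets (\<mu> v)" "S1 \<subseteq> B" "emeasure (\<mu> v) S1 \<noteq> 0" "emeasure (\<mu> v) S1 \<noteq> \<infinity>"
      using finite_positive_subset[OF assms(2)[OF v] AB(2,5)] .
    show "\<exists>S :: bit \<Rightarrow> _. S 0 \<inter> S 1 = {} \<and> (\<forall>i. S i \<in> sets (\<mu> v) \<and> emeasure (\<mu> v) (S i) \<noteq> 0 \<and> emeasure (\<mu> v) (S i) \<noteq> \<infinity>)"
      using S0 S1 AB(3) by (intro exI[of _ "\<lambda>i. if i = 0 then S0 else S1"]) auto
  qed
  from bchoice[OF this] obtain S :: "'a \<Rightarrow> bit \<Rightarrow> 'b set" where S: "\<And>v. v \<in> V \<Longrightarrow> S v 0 \<inter> S v 1 = {}"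
    "\<And>v i. v \<in> V \<Longrightarrow> S v i \<in> sets (\<mu> v) \<and> emeasure (\<mu> v) (S v i) \<noteq> 0 \<and> emeasure (\<mu> v) (S v i) \<noteq> \<infinity>" by blast
  \<comment> \<open>Nothing is assumed about \<open>\<mu> v\<close> outside \<open>V\<close>; a
    point mass is the default that keeps every \<open>\<nu> v i\<close> a probability
    measure.\<close>
  define \<nu> where "\<nu> v i = (if v \<in> V then uniform_measure (\<mu> v) (S v i) else return (count_space UNIV) undefined)" for v i
  have "bit_mixture V \<mu> \<nu> (\<lambda>v. S v 1)"
  proof (rule bit_mixture.intro)
    show "prob_space (\<nu> v i)" for v i
      using S(2)[of v i] by (auto simp: \<nu>_def intro: prob_space_uniform_measure prob_space_return)
    show "\<exists>f\<in>borel_measurable (\<mu> v). \<nu> v i = density (\<mu> v) f" if "v \<in> V" for v i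
      using S(2)[OF that, of i] that unfolding \<nu>_def uniform_measure_def
      by (intro bexI[of _ "\<lambda>x. indicator (S v i) x / emeasure (\<mu> v) (S v i)"]) auto
    show "AE t in \<nu> v i. (t \<in> S v 1) = (i = 1)" if "v \<in> V" for v i
    proof -
      have "AE t in uniform_measure (\<mu> v) (S v i). (t \<in> S v 1) = (i = 1)"
        using S[OF that] by (intro AE_uniform_measureI AE_I2) (cases "i = 0"; auto)+
      moreover have "\<nu> v i = uniform_measure (\<mu> v) (S v i)" using that by (simp add: \<nu>_def)
      ultimately show ?thesis by (simp only:)
    qed
  qed (use assms S in auto)
  then show ?thesis by blast
qed

text \<open>Induction on the number of edges directed differently: for the first vertex \<open>y\<close> of \<open>D\<close> with a
  reversed incoming edge and its last parent \<open>x\<close> of this kind, the edge \<open>x \<rightarrow> y\<close> is covered in \<open>D\<close>.\<close>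

lemma markov_equiv_same_structure:
  assumes "finite V" "D \<in> dags V" "D' \<in> dags V"
    and "\<And>a b. adjacent D a b \<longleftrightarrow> adjacent D' a b"
    and "\<And>a b c. a \<noteq> c \<Longrightarrow> \<not> adjacent D a c \<Longrightarrow> (a, b) \<in> D \<and> (c, b) \<in> D \<longleftrightarrow> (a, b) \<in> D' \<and> (c, b) \<in> D'"
  shows "conn_le U D D'"
  using assms(2-)
proof (induction "card (D - D')" arbitrary: D rule: less_induct)
  case less
  have fin: "finite (D - D')" using finite_dag[OF assms(1) less.prems(1)] by simp
  show ?case
  proof (cases "D - D' = {}")
    case True
    then show ?thesis by (intro conn_le_mono) auto
  next
    case False
    obtain f :: "'a \<Rightarrow> nat" where f: "inj_on f V" "\<And>u v. (u, v) \<in> D \<Longrightarrow> f u < f v"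
      using dag_topological[OF assms(1) less.prems(1)] by metis
    have ac: "acyclic D" "D \<subseteq> V \<times> V" and ac': "acyclic D'" using less.prems by (auto simp: dags_def)
    have asym: "(u, v) \<in> D \<Longrightarrow> (v, u) \<notin> D" for u v using f(2) by (meson less_asym)
    have asym': "(u, v) \<in> D' \<Longrightarrow> (v, u) \<notin> D'" for u v
      using ac' by (meson acyclic_def r_into_trancl trancl_trans)
    obtain y where y: "y \<in> snd ` (D - D')" "\<And>z. z \<in> snd ` (D - D') \<Longrightarrow> f y \<le> f z"
      using Min_in[of "f ` snd ` (D - D')"] Min_le[of "f ` snd ` (D - D')"] fin False by fastforce
    have "finite {x. (x, y) \<in> D - D'}" "{x. (x, y) \<in> D - D'} \<noteq> {}"
      using y(1) finite_subset[OF _ finite_imageI[OF fin, of fst], of "{x. (x, y) \<in> D - D'}"]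
      by (force simp: image_iff)+
    then obtain x where x: "(x, y) \<in> D - D'" "\<And>z. (z, y) \<in> D - D' \<Longrightarrow> f z \<le> f x"
      using Max_in[of "f ` {x. (x, y) \<in> D - D'}"] Max_ge[of "f ` {x. (x, y) \<in> D - D'}"] by fastforce
    have xy: "(x, y) \<in> D" "(y, x) \<in> D'" "x \<noteq> y"
      using x(1) less.prems(3)[of x y] asym[of x x] by (auto simp: adjacent_def)
    \<comment> \<open>By the choice of \<open>y\<close>, edges of \<open>D\<close> into earlier
      vertices are also edges of \<open>D'\<close>.\<close>
    have keep: "(u, v) \<in> D'" if "(u, v) \<in> D" "f v < f y" for u v
      using that y(2)[of v] by force
    have adjD: "(u, v) \<in> D \<or> (v, u) \<in> D" if "(u, v) \<in> D'" for u v
      using that less.prems(3)[of u v] by (auto simp: adjacent_def)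
    have cov: "{u. (u, y) \<in> D} = insert x {u. (u, x) \<in> D}"
    proof (intro set_eqI iffI)
      fix z assume "z \<in> insert x {u. (u, x) \<in> D}"
      then consider "z = x" | "(z, x) \<in> D" by auto
      then show "z \<in> {u. (u, y) \<in> D}"
      proof cases
        case 2
        have zx: "(z, x) \<in> D'" using keep[OF 2] f(2)[OF xy(1)] by simp
        have zy: "z \<noteq> y" using 2 xy asym by auto
        \<comment> \<open>Otherwise z \<rightarrow> x \<leftarrow> y would be a v-structure of
          \<open>D'\<close> that \<open>D\<close> lacks.\<close>
        have "adjacent D z y"
          using less.prems(4)[of z y x] zx xy asym zy by auto
        moreover have "(y, z) \<notin> D" using f(2)[OF 2] f(2)[OF xy(1)] f(2)[of y z] by force
        ultimately show ?thesis by (simp add: adjacent_def)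
      qed (use xy in simp)
    next
      fix z assume "z \<in> {u. (u, y) \<in> D}"
      then have zy: "(z, y) \<in> D" by simp
      show "z \<in> insert x {u. (u, x) \<in> D}"
      proof (cases "z = x")
        case False
        \<comment> \<open>Otherwise z \<rightarrow> y \<leftarrow> x would be a v-structure of
          \<open>D\<close> that \<open>D'\<close> lacks. The edge cannot point to \<open>z\<close>,
          since by the choice of \<open>y\<close> and \<open>x\<close> the path x \<rightarrow> z
          \<rightarrow> y would persist in \<open>D'\<close> and close a cycle with y \<rightarrow>
          x.\<close>
        have "adjacent D z x"
          using less.prems(4)[of z x y] zy xy x(1) False by auto
        moreover have "(x, z) \<notin> D"
        proof
          assume xz: "(x, z) \<in> D"
          have "(x, z) \<in> D'" using keep[OF xz] f(2)[OF zy] by simp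
          moreover have "(z, y) \<in> D'" using x(2)[of z] zy f(2)[OF xz] by force
          ultimately show False using xy(2) ac' by (meson acyclic_def r_into_trancl trancl_trans)
        qed
        ultimately show ?thesis by (simp add: adjacent_def)
      qed simp
    qed
    define D1 where "D1 = insert (y, x) (D - {(x, y)})"
    have "(x, y) \<notin> (D - {(x, y)})\<^sup>*"
    proof
      assume "(x, y) \<in> (D - {(x, y)})\<^sup>*"
      then obtain z where "(z, y) \<in> D" "z \<noteq> x" "(x, z) \<in> D\<^sup>*" using rtrancl_avoid_edge xy(3) by metis
      moreover from this have "(z, x) \<in> D" using cov by blast
      ultimately show False using ac by (meson acyclic_def rtrancl_into_trancl1)
    qed
    then have "acyclic D1" using ac by (auto simp: D1_def intro: acyclic_subset)
    then have D1: "D1 \<in> dags V" using ac xy by (auto simp: dags_def D1_def)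
    have adj1: "adjacent D1 a b \<longleftrightarrow> adjacent D a b" for a b
      using xy by (auto simp: adjacent_def D1_def)
    have c1: "(a, b) \<in> D1 \<and> (c, b) \<in> D1 \<longleftrightarrow> (a, b) \<in> D \<and> (c, b) \<in> D"
      if ac: "a \<noteq> c" "\<not> adjacent D a c" for a b c
    proof -
      have px: "(u, x) \<in> D \<Longrightarrow> adjacent D u y \<and> adjacent D y u" for u using cov by (auto simp: adjacent_def)
      have py: "(u, y) \<in> D \<Longrightarrow> u \<noteq> x \<Longrightarrow> adjacent D u x \<and> adjacent D x u" for u
        using cov by (auto simp: adjacent_def)
      show ?thesis using px py ac xy asym unfolding D1_def by blast
    qed
    have "D1 - D' = (D - D') - {(x, y)}" using xy by (auto simp: D1_def)
    then have "card (D1 - D') < card (D - D')" using fin x(1) by (metis card_Diff1_less)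
    then have "conn_le U D1 D'"
      by (rule less.hyps) (use D1 less.prems adj1 c1 in auto)
    moreover have "conn_le U D D1"
      using graph_step_conn_le[OF graph_step_reverse[OF less.prems(1) D1 xy(1) cov D1_def]] .
    ultimately show ?thesis using conn_le_trans by blast
  qed
qed

section \<open>CPDAGs and their models\<close>

definition cpdag :: "'v set \<Rightarrow> ('v \<times> 'v) set \<Rightarrow> 'v mixed_graph" where
  "cpdag V D = cpdag_of_class (markov_equiv V `` {D})"

lemma cpdags_eq: "cpdags V = cpdag V ` dags V"
proof -
  have "dags V // markov_equiv V = (\<lambda>D. markov_equiv V `` {D}) ` dags V" by (auto simp: quotient_def)
  then show ?thesis by (simp add: cpdags_def cpdag_def image_image)
qed

lemma markov_equiv_iff:
  "(D, D') \<in> markov_equiv V \<longleftrightarrow> D \<in> dags V \<and> D' \<in> dags V \<and> conn_le V D D' \<and> conn_le V D' D"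
proof (cases "D \<in> dags V \<and> D' \<in> dags V")
  case True
  then have ac: "acyclic D" "acyclic D'" by (auto simp: dags_def)
  have sep: "d_separated D A B C \<longleftrightarrow> (\<forall>a\<in>A. \<forall>b\<in>B. \<not> conn D C a b)"
    "d_separated D' A B C \<longleftrightarrow> (\<forall>a\<in>A. \<forall>b\<in>B. \<not> conn D' C a b)"
    if "(A, B, C) \<in> disjoint_triples V" for A B C
    using d_separated_iff_conn ac that by (auto simp: disjoint_triples_def)
  have "(\<forall>(A, B, C)\<in>disjoint_triples V. d_separated D A B C \<longleftrightarrow> d_separated D' A B C) \<longleftrightarrow>
      conn_le V D D' \<and> conn_le V D' D"
  proof
    assume l: "\<forall>(A, B, C)\<in>disjoint_triples V. d_separated D A B C \<longleftrightarrow> d_separated D' A B C"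
    have "conn D C a b \<longleftrightarrow> conn D' C a b"
      if "C \<subseteq> V" "a \<in> V - C" "b \<in> V - C" "a \<noteq> b" for C a b
    proof -
      have t: "({a}, {b}, C) \<in> disjoint_triples V" using that by (auto simp: disjoint_triples_def)
      then show ?thesis using l sep[OF t] by auto
    qed
    then show "conn_le V D D' \<and> conn_le V D' D" unfolding conn_le_def by blast
  next
    assume r: "conn_le V D D' \<and> conn_le V D' D"
    show "\<forall>(A, B, C)\<in>disjoint_triples V. d_separated D A B C \<longleftrightarrow> d_separated D' A B C"
    proof clarify
      fix A B C assume t: "(A, B, C) \<in> disjoint_triples V"
      have "conn D C a b \<longleftrightarrow> conn D' C a b" if "a \<in> A" "b \<in> B" for a b
      proof -
        have "C \<subseteq> V" "a \<in> V - C" "b \<in> V - C" "a \<noteq> b"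
          using t that by (auto simp: disjoint_triples_def)
        then show ?thesis using r unfolding conn_le_def by blast
      qed
      then show "d_separated D A B C \<longleftrightarrow> d_separated D' A B C" unfolding sep[OF t] by blast
    qed
  qed
  then show ?thesis using True by (simp add: markov_equiv_def)
qed (auto simp: markov_equiv_def)

section \<open>Skeletons and v-structures under inclusion of d-connections\<close>

lemma graph_step_adjacent:
  "(D, D') \<in> graph_step V \<Longrightarrow> adjacent D a b \<Longrightarrow> adjacent D' a b"
  by (auto simp: graph_step_def adjacent_def)

lemma conn_le_adjacent:
  assumes "finite V" "D \<in> dags V" "D' \<in> dags V" "conn_le V D D'" "adjacent D a b"
  shows "adjacent D' a b"
  using conn_le_graph_steps[OF assms(1-4)] assms(5)
  by (induction rule: rtrancl_induct) (auto intro: graph_step_adjacent)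

text \<open>By acyclicity one of the two vertices is no ancestor of the other; its parents separate
  them by the local Markov property.\<close>

lemma nonadjacent_separated:
  assumes "D \<in> dags V" "a \<in> V" "c \<in> V" "a \<noteq> c" "\<not> adjacent D a c"
  obtains C where "C \<subseteq> V" "a \<notin> C" "c \<notin> C" "\<not> conn D C a c"
proof -
  have ac: "acyclic D" and DV: "D \<subseteq> V \<times> V" using assms(1) by (auto simp: dags_def)
  have n: "(a, c) \<notin> D" "(c, a) \<notin> D" and irr: "(v, v) \<notin> D" for v
    using assms(5) ac by (auto simp: adjacent_def acyclic_def)
  show ?thesis
  proof (cases "(c, a) \<in> D\<^sup>*")
    case False
    let ?C = "{u. (u, c) \<in> D}"
    have "a \<notin> ?C" "c \<notin> ?C" "?C \<subseteq> V" using n irr DV by auto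
    moreover have "\<not> conn D ?C a c"
      using not_conn_parents[OF ac False n(1)] conn_sym calculation(1,2) by metis
    ultimately show ?thesis using that by blast
  next
    case True
    then have "(a, c) \<notin> D\<^sup>*" using ac assms(4) by (metis acyclic_def rtranclD rtrancl_trancl_trancl)
    then show ?thesis using not_conn_parents[OF ac _ n(2)] that[of "{u. (u, a) \<in> D}"] n irr DV by auto
  qed
qed

lemma unshielded_collider_iff:
  assumes ac: "acyclic D" and adj: "adjacent D a b" "adjacent D b c"
    and C: "a \<notin> C" "\<not> conn D C a c"
  shows "(a, b) \<in> D \<and> (c, b) \<in> D \<longleftrightarrow> b \<notin> C"
proof
  assume col: "(a, b) \<in> D \<and> (c, b) \<in> D"
  show "b \<notin> C"
  proof
    assume "b \<in> C"
    then have "b \<in> anc D C" using subset_anc by fastforce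
    moreover have "reach D C a b True" using reach.down[OF reach.start C(1)] col by simp
    ultimately have "reach D C a c False" using col reach.collide by metis
    then show False using C by (auto simp: conn_def)
  qed
next
  assume b: "b \<notin> C"
  have asym: "(u, v) \<in> D \<Longrightarrow> (v, u) \<notin> D" for u v
    using ac by (meson acyclic_def r_into_trancl trancl_trans)
  have s: "reach D C a a False" by (rule reach.start)
  have noc: "\<not> reach D C a c d" for d using C by (auto simp: conn_def)
  have "(b, c) \<notin> D"
  proof
    assume bc: "(b, c) \<in> D"
    obtain d where "reach D C a b d"
      using adj(1) reach.down[OF s C(1)] reach.up[OF s C(1)] unfolding adjacent_def by blast
    then show False using noc reach.down[OF _ b bc] by blast
  qed
  then have cb: "(c, b) \<in> D" using adj by (auto simp: adjacent_def)
  have "(b, a) \<notin> D"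
  proof
    assume "(b, a) \<in> D"
    then have "reach D C a b False" using reach.up[OF s C(1)] by simp
    then show False using noc reach.up[OF _ b cb] by blast
  qed
  then show "(a, b) \<in> D \<and> (c, b) \<in> D" using cb adj by (auto simp: adjacent_def)
qed

text \<open>A set that separates the end points in \<open>D'\<close> also separates them in
  \<open>D\<close>, and this common set decides the status of \<open>b\<close> in both
  graphs.\<close>

lemma conn_le_collider_iff:
  assumes D: "D \<in> dags V" "D' \<in> dags V" "conn_le V D D'"
    and adj: "adjacent D a b" "adjacent D b c" "adjacent D' a b" "adjacent D' b c" "\<not> adjacent D' a c" "a \<noteq> c"
  shows "(a, b) \<in> D \<and> (c, b) \<in> D \<longleftrightarrow> (a, b) \<in> D' \<and> (c, b) \<in> D'"
proof -
  have ac: "acyclic D" "acyclic D'" and V: "a \<in> V" "c \<in> V"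
    using D adj by (auto simp: dags_def adjacent_def)
  obtain C where C: "C \<subseteq> V" "a \<notin> C" "c \<notin> C" "\<not> conn D' C a c"
    using nonadjacent_separated[OF D(2) V adj(6,5)] .
  then have "\<not> conn D C a c" using conn_leD[OF D(3) _ C(1) V C(2,3) adj(6)] by blast
  then show ?thesis
    using unshielded_collider_iff[OF ac(1) adj(1,2) C(2)] unshielded_collider_iff[OF ac(2) adj(3,4) C(2,4)] by simp
qed

lemma sk_cpdag:
  assumes "finite V" "D \<in> dags V"
  shows "sk (cpdag V D) = {{a, b} | a b. (a, b) \<in> D}"
proof -
  let ?K = "markov_equiv V `` {D}"
  have DK: "D \<in> ?K" using assms by (simp add: markov_equiv_iff conn_le_refl)
  have adj: "adjacent D' a b" if "adjacent D a b" "D' \<in> ?K" for a b D'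
    using that conn_le_adjacent[OF assms] by (auto simp: markov_equiv_iff)
  show ?thesis
  proof (intro set_eqI iffI)
    fix e assume "e \<in> sk (cpdag V D)"
    then obtain a b where "e = {a, b}" "adjacent D a b"
      using DK by (auto simp: sk_def cpdag_def cpdag_of_class_def adjacent_def)
    then show "e \<in> {{a, b} | a b. (a, b) \<in> D}" by (auto simp: adjacent_def insert_commute)
  next
    fix e assume "e \<in> {{a, b} | a b. (a, b) \<in> D}"
    then obtain a b where ab: "e = {a, b}" "(a, b) \<in> D" by auto
    then have "\<forall>D'\<in>?K. adjacent D' a b" using adj by (auto simp: adjacent_def)
    then consider "\<forall>D'\<in>?K. (a, b) \<in> D'" | "\<forall>D'\<in>?K. (b, a) \<in> D'"
      | "(\<forall>D'\<in>?K. adjacent D' a b) \<and> \<not> (\<forall>D'\<in>?K. (a, b) \<in> D') \<and> \<not> (\<forall>D'\<in>?K. (b, a) \<in> D')" by blast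
    then show "e \<in> sk (cpdag V D)"
    proof cases
      case 1
      then have "(a, b) \<in> directed (cpdag V D)" by (simp add: cpdag_def cpdag_of_class_def)
      then show ?thesis using ab(1) unfolding sk_def by blast
    next
      case 2
      then have "(b, a) \<in> directed (cpdag V D)" by (simp add: cpdag_def cpdag_of_class_def)
      moreover have "e = {b, a}" using ab(1) by auto
      ultimately show ?thesis unfolding sk_def by blast
    next
      case 3
      then have "{a, b} \<in> undirected (cpdag V D)"
        unfolding cpdag_def cpdag_of_class_def mixed_graph.select_convs by blast
      then show ?thesis using ab(1) unfolding sk_def by blast
    qed
  qed
qed

lemma edge_in_sk: "finite V \<Longrightarrow> D \<in> dags V \<Longrightarrow> {a, b} \<in> sk (cpdag V D) \<longleftrightarrow> adjacent D a b"
  by (auto simp: sk_cpdag adjacent_def doubleton_eq_iff)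

text \<open>A v-structure of one member occurs in every member of the class, so both of its edges
  are directed in the CPDAG.\<close>

lemma v_str_cpdag:
  assumes "finite V" "D \<in> dags V"
  shows "v_str (cpdag V D) = {triplet a b c | a b c. a \<noteq> c \<and> (a, b) \<in> D \<and> (c, b) \<in> D \<and> \<not> adjacent D a c}"
proof -
  let ?K = "markov_equiv V `` {D}"
  have DK: "D \<in> ?K" using assms by (simp add: markov_equiv_iff conn_le_refl)
  have "(a, b) \<in> D' \<and> (c, b) \<in> D'"
    if "a \<noteq> c" "(a, b) \<in> D" "(c, b) \<in> D" "\<not> adjacent D a c" "D' \<in> ?K" for a b c D'
  proof -
    have D': "D' \<in> dags V" "conn_le V D D'" "conn_le V D' D" using that by (auto simp: markov_equiv_iff)
    have "adjacent D' a b" "adjacent D' b c" "\<not> adjacent D' a c"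
      using that D' conn_le_adjacent[OF assms(1)] assms(2) by (meson adjacent_def)+
    then show ?thesis
      using conn_le_collider_iff[OF assms(2) D'(1,2), of a b c] that by (auto simp: adjacent_def)
  qed
  moreover have dir: "(u, v) \<in> directed (cpdag V D) \<longleftrightarrow> (\<forall>D'\<in>?K. (u, v) \<in> D')" for u v
    by (simp add: cpdag_def cpdag_of_class_def)
  ultimately have "(a, b) \<in> directed (cpdag V D) \<and> (c, b) \<in> directed (cpdag V D) \<longleftrightarrow> (a, b) \<in> D \<and> (c, b) \<in> D"
    if "a \<noteq> c" "\<not> adjacent D a c" for a b c
    using that DK unfolding dir by blast
  then have "(a \<noteq> c \<and> (a, b) \<in> directed (cpdag V D) \<and> (c, b) \<in> directed (cpdag V D) \<and> {a, c} \<notin> sk (cpdag V D))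
    \<longleftrightarrow> (a \<noteq> c \<and> (a, b) \<in> D \<and> (c, b) \<in> D \<and> \<not> adjacent D a c)" for a b c
    unfolding edge_in_sk[OF assms] by blast
  then show ?thesis unfolding v_str_def by simp
qed

lemma triplet_eq_iff: "triplet a b c = triplet a' b' c' \<longleftrightarrow> b = b' \<and> (a = a' \<and> c = c' \<or> a = c' \<and> c = a')"
  by (auto simp: triplet_def doubleton_eq_iff)

lemma triplet_in_v_str:
  assumes "finite V" "D \<in> dags V" "a \<noteq> c" "\<not> adjacent D a c"
  shows "triplet a b c \<in> v_str (cpdag V D) \<longleftrightarrow> (a, b) \<in> D \<and> (c, b) \<in> D"
  using assms(3,4) unfolding v_str_cpdag[OF assms(1,2)] by (auto simp: triplet_eq_iff)

text \<open>Membership in \<open>dag_class\<close> only says that the CPDAGs agree. Skeleton and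
  v-structures can be recovered from the CPDAG, and they determine the d-connections, so no DAG from
  another equivalence class slips in.\<close>

lemma dag_class_conn:
  assumes "finite V" "D \<in> dags V" "D' \<in> dag_class V (cpdag V D)"
  shows "D' \<in> dags V" "conn_le V D D'" "conn_le V D' D"
proof -
  show D': "D' \<in> dags V" using assms(3) by (simp add: dag_class_def)
  have eq: "cpdag V D' = cpdag V D" using assms(3) by (simp add: dag_class_def cpdag_def)
  have adj: "adjacent D a b \<longleftrightarrow> adjacent D' a b" for a b
    using edge_in_sk[OF assms(1,2)] edge_in_sk[OF assms(1) D'] eq by simp
  have "(a, b) \<in> D \<and> (c, b) \<in> D \<longleftrightarrow> (a, b) \<in> D' \<and> (c, b) \<in> D'"
    if "a \<noteq> c" "\<not> adjacent D a c" for a b c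
    using triplet_in_v_str[OF assms(1,2) that] triplet_in_v_str[OF assms(1) D', of a c b] that adj eq by simp
  then show "conn_le V D D'" "conn_le V D' D"
    using markov_equiv_same_structure[OF assms(1) assms(2) D' adj]
      markov_equiv_same_structure[OF assms(1) D' assms(2)] adj by auto
qed

lemma in_dag_class: "D \<in> dags V \<Longrightarrow> D \<in> dag_class V (cpdag V D)"
  by (simp add: dag_class_def cpdag_def)

lemma cpdag_model_iff:
  assumes "finite V" "D \<in> dags V"
  shows "P \<in> cpdag_model V \<mu> (cpdag V D) \<longleftrightarrow> prob_space P \<and> sets P = sets (PiM V \<mu>) \<and>
     absolutely_continuous (PiM V \<mu>) P \<and>
     (\<forall>(A, B, C)\<in>disjoint_triples V. (\<forall>a\<in>A. \<forall>b\<in>B. \<not> conn D C a b) \<longrightarrow>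
        cond_indep_var P (PiM A \<mu>) (\<lambda>x. restrict x A) (PiM B \<mu>) (\<lambda>x. restrict x B)
          (PiM C \<mu>) (\<lambda>x. restrict x C))"
proof -
  have "d_separated D' A B C \<longleftrightarrow> (\<forall>a\<in>A. \<forall>b\<in>B. \<not> conn D C a b)"
    if D': "D' \<in> dag_class V (cpdag V D)" and t: "(A, B, C) \<in> disjoint_triples V" for D' A B C
  proof -
    have "acyclic D'" using dag_class_conn(1)[OF assms D'] by (simp add: dags_def)
    then have "d_separated D' A B C \<longleftrightarrow> (\<forall>a\<in>A. \<forall>b\<in>B. \<not> conn D' C a b)"
      using d_separated_iff_conn t by (auto simp: disjoint_triples_def)
    moreover have "conn D C a b \<longleftrightarrow> conn D' C a b" if "a \<in> A" "b \<in> B" for a b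
    proof -
      have "C \<subseteq> V" "a \<in> V - C" "b \<in> V - C" "a \<noteq> b"
        using t that by (auto simp: disjoint_triples_def)
      then show ?thesis using dag_class_conn(2,3)[OF assms D'] unfolding conn_le_def by blast
    qed
    ultimately show ?thesis by blast
  qed
  note eq = this
  have "(\<forall>D'\<in>dag_class V (cpdag V D). \<forall>(A, B, C)\<in>disjoint_triples V. d_separated D' A B C \<longrightarrow> R A B C) \<longleftrightarrow>
     (\<forall>(A, B, C)\<in>disjoint_triples V. (\<forall>a\<in>A. \<forall>b\<in>B. \<not> conn D C a b) \<longrightarrow> R A B C)" for R
    using eq in_dag_class[OF assms(2)] by fastforce
  then show ?thesis unfolding cpdag_model_def mem_Collect_eq by simp
qed

text \<open>From models to graphs, one law per d-connection suffices: the mixture built for a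
  d-connection of \<open>D\<close> lies in the model of \<open>D\<close>, hence in that of
  \<open>D'\<close>, and its dependence rules out the corresponding separation in
  \<open>D'\<close>.\<close>

lemma cpdag_le_iff:
  assumes V: "finite V" and \<mu>: "\<And>v. v \<in> V \<Longrightarrow> sigma_finite_measure (\<mu> v)"
    "\<And>v. v \<in> V \<Longrightarrow> nondegenerate (\<mu> v)" and D: "D \<in> dags V" "D' \<in> dags V"
  shows "cpdag_le V \<mu> (cpdag V D) (cpdag V D') \<longleftrightarrow> conn_le V D D'"
proof
  assume le: "conn_le V D D'"
  have sub: "\<forall>a\<in>A. \<forall>b\<in>B. \<not> conn D C a b"
    if t: "(A, B, C) \<in> disjoint_triples V" and s: "\<forall>a\<in>A. \<forall>b\<in>B. \<not> conn D' C a b" for A B C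
  proof (intro ballI)
    fix a b assume "a \<in> A" "b \<in> B"
    moreover from this have "C \<subseteq> V" "a \<in> V - C" "b \<in> V - C" "a \<noteq> b"
      using t by (auto simp: disjoint_triples_def)
    ultimately show "\<not> conn D C a b" using le s unfolding conn_le_def by blast
  qed
  show "cpdag_le V \<mu> (cpdag V D) (cpdag V D')"
    unfolding cpdag_le_def
  proof
    fix P assume P: "P \<in> cpdag_model V \<mu> (cpdag V D)"
    have "cond_indep_var P (PiM A \<mu>) (\<lambda>x. restrict x A) (PiM B \<mu>) (\<lambda>x. restrict x B)
          (PiM C \<mu>) (\<lambda>x. restrict x C)"
      if t: "(A, B, C) \<in> disjoint_triples V" and s: "\<forall>a\<in>A. \<forall>b\<in>B. \<not> conn D' C a b" for A B C
      using P[unfolded cpdag_model_iff[OF V D(1)]] sub[OF t s] t by fast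
    then show "P \<in> cpdag_model V \<mu> (cpdag V D')"
      using P unfolding cpdag_model_iff[OF V D(1)] cpdag_model_iff[OF V D(2)] by blast
  qed
next
  assume le: "cpdag_le V \<mu> (cpdag V D) (cpdag V D')"
  have "\<exists>\<nu> B. bit_mixture V \<mu> \<nu> B" by (rule bit_mixture_exists) (use V \<mu> in auto)
  then obtain \<nu> B where bm: "bit_mixture V \<mu> \<nu> B" by blast
  interpret bit_mixture V \<mu> \<nu> B by (rule bm)
  show "conn_le V D D'"
    unfolding conn_le_def
  proof (intro allI impI, rule ccontr)
    fix C a b assume C: "C \<subseteq> V" "a \<in> V - C" "b \<in> V - C" "a \<noteq> b" "conn D C a b" "\<not> conn D' C a b"
    obtain T y where T: "\<And>v. T v \<subseteq> {u. (u, v) \<in> D}"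
      "\<And>l. l \<in> lin V T \<Longrightarrow> (\<And>c. c \<in> C \<Longrightarrow> l c = 0) \<Longrightarrow> l a = l b"
      "y \<in> lin V T" "\<And>c. c \<in> C \<Longrightarrow> y c = 0" "y a = 1"
      using conn_linear_witness[OF V D(1) C(5)] C by auto
    have "mix (lin V T) \<in> cpdag_model V \<mu> (cpdag V D)"
      unfolding cpdag_model_iff[OF V D(1)]
    proof (intro conjI prob_mix sets_mix mix_absolutely_continuous finite_lin finV)
      show "lin V T \<noteq> {}" using T(3) by blast
      show "\<forall>(A, B, C)\<in>disjoint_triples V. (\<forall>a\<in>A. \<forall>b\<in>B. \<not> conn D C a b) \<longrightarrow>
        cond_indep_var (mix (lin V T)) (PiM A \<mu>) (\<lambda>x. restrict x A) (PiM B \<mu>) (\<lambda>x. restrict x B)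
          (PiM C \<mu>) (\<lambda>x. restrict x C)"
        by clarify (rule mix_lin_cond_indep[OF D(1) T(1)], auto)
    qed
    then have "mix (lin V T) \<in> cpdag_model V \<mu> (cpdag V D')" using le by (auto simp: cpdag_le_def)
    moreover have "({a}, {b}, C) \<in> disjoint_triples V" using C by (auto simp: disjoint_triples_def)
    ultimately have "cond_indep_var (mix (lin V T)) (PiM {a} \<mu>) (\<lambda>x. restrict x {a}) (PiM {b} \<mu>) (\<lambda>x. restrict x {b})
      (PiM C \<mu>) (\<lambda>x. restrict x C)"
      unfolding cpdag_model_iff[OF V D(2)] using C(6) by fastforce
    moreover have "\<not> cond_indep_var (mix (lin V T)) (PiM {a} \<mu>) (\<lambda>x. restrict x {a}) (PiM {b} \<mu>) (\<lambda>x. restrict x {b})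
      (PiM C \<mu>) (\<lambda>x. restrict x C)"
      using C T by (intro mix_lin_not_cond_indep[where y = y]) auto
    ultimately show False by blast
  qed
qed

section \<open>Paths in the poset of CPDAGs\<close>

lemma graph_step_sk:
  assumes V: "finite V" and st: "(D, D') \<in> graph_step V"
  shows "sk (cpdag V D) \<subseteq> sk (cpdag V D')" "\<exists>e. sk (cpdag V D') \<subseteq> insert e (sk (cpdag V D))"
proof -
  have D: "D \<in> dags V" "D' \<in> dags V" using st by (auto simp: graph_step_def)
  note sk = sk_cpdag[OF V D(1)] sk_cpdag[OF V D(2)]
  show "sk (cpdag V D) \<subseteq> sk (cpdag V D')"
  proof
    fix e assume "e \<in> sk (cpdag V D)"
    then obtain a b where ab: "e = {a, b}" "adjacent D a b" unfolding sk by (auto simp: adjacent_def)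
    then have "adjacent D' a b" using graph_step_adjacent[OF st] by blast
    then show "e \<in> sk (cpdag V D')" using edge_in_sk[OF V D(2)] ab(1) by simp
  qed
  from st consider u v where "D' = insert (u, v) D"
    | x y where "(x, y) \<in> D" "D' = insert (y, x) (D - {(x, y)})" by (auto simp: graph_step_def)
  then show "\<exists>e. sk (cpdag V D') \<subseteq> insert e (sk (cpdag V D))"
  proof cases
    case 1
    then show ?thesis unfolding sk by (intro exI[of _ "{u, v}"]) auto
  next
    case 2
    then show ?thesis unfolding sk by (intro exI[of _ "{y, x}"]) auto
  qed
qed

text \<open>A step enlarges the skeleton by at most one edge, so the first change in a sequence of
  steps yields a DAG with exactly one edge more.\<close>

lemma graph_steps_one_edge:
  assumes V: "finite V" and st: "(D, D') \<in> (graph_step V)\<^sup>*" and D: "D \<in> dags V"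
  shows "sk (cpdag V D) \<subseteq> sk (cpdag V D') \<and> (sk (cpdag V D') = sk (cpdag V D) \<or>
    (\<exists>E. (D, E) \<in> (graph_step V)\<^sup>* \<and> (E, D') \<in> (graph_step V)\<^sup>* \<and> E \<in> dags V \<and>
       card (sk (cpdag V E) - sk (cpdag V D)) = 1))"
  using st
proof (induction rule: rtrancl_induct)
  case (step E E')
  note sk = graph_step_sk[OF V step.hyps(2)]
  have E': "E' \<in> dags V" using step.hyps(2) by (auto simp: graph_step_def)
  have st': "(D, E') \<in> (graph_step V)\<^sup>*" using step.hyps by (rule rtrancl_into_rtrancl)
  have sub: "sk (cpdag V D) \<subseteq> sk (cpdag V E')" using step.IH sk(1) by blast
  from step.IH consider "sk (cpdag V E) = sk (cpdag V D)"
    | F where "(D, F) \<in> (graph_step V)\<^sup>*" "(F, E) \<in> (graph_step V)\<^sup>*" "F \<in> dags V"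
        "card (sk (cpdag V F) - sk (cpdag V D)) = 1" by blast
  then show ?case
  proof cases
    case 1
    obtain e where e: "sk (cpdag V E') \<subseteq> insert e (sk (cpdag V D))" using sk(2) 1 by auto
    show ?thesis
    proof (cases "sk (cpdag V E') = sk (cpdag V D)")
      case False
      then have "sk (cpdag V E') - sk (cpdag V D) = {e}" using sub e by blast
      then have "card (sk (cpdag V E') - sk (cpdag V D)) = 1" by simp
      then show ?thesis using sub st' E' by blast
    qed (use sub in blast)
  next
    case 2
    then have "(F, E') \<in> (graph_step V)\<^sup>*" using step.hyps(2) by (meson rtrancl_into_rtrancl)
    then show ?thesis using sub 2 by blast
  qed
qed simp

lemma finite_sk: "finite V \<Longrightarrow> G \<in> cpdags V \<Longrightarrow> finite (sk G)"
proof -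
  assume "finite V" "G \<in> cpdags V"
  then obtain D where D: "D \<in> dags V" "G = cpdag V D" by (auto simp: cpdags_eq)
  have "sk G = (\<lambda>(a, b). {a, b}) ` D" unfolding D(2) sk_cpdag[OF \<open>finite V\<close> D(1)] by auto
  then show ?thesis using finite_dag[OF \<open>finite V\<close> D(1)] by simp
qed

lemma sk_subset: "finite V \<Longrightarrow> G \<in> cpdags V \<Longrightarrow> e \<in> sk G \<Longrightarrow> \<exists>i\<in>V. \<exists>j\<in>V. e = {i, j}"
proof -
  assume "finite V" "G \<in> cpdags V" "e \<in> sk G"
  then obtain D a b where "D \<in> dags V" "(a, b) \<in> D" "e = {a, b}"
    by (auto simp: cpdags_eq sk_cpdag)
  then show ?thesis unfolding dags_def by blast
qed

text \<open>If the skeletons differed in two or more edges, the DAG with exactly one edge more than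
  \<open>D1\<close> would represent a CPDAG strictly in between.\<close>

lemma cover_structure:
  assumes V: "finite V" and \<mu>: "\<And>v. v \<in> V \<Longrightarrow> sigma_finite_measure (\<mu> v)"
    "\<And>v. v \<in> V \<Longrightarrow> nondegenerate (\<mu> v)"
    and cov: "covered_by (cpdags V) (cpdag_le V \<mu>) G1 G2"
  shows "card (sym_diff (sk G1) (sk G2)) \<le> 1"
    and "\<And>a b c. a \<noteq> c \<Longrightarrow> {a, b} \<in> sk G1 \<inter> sk G2 \<Longrightarrow> {b, c} \<in> sk G1 \<inter> sk G2 \<Longrightarrow> {a, c} \<notin> sk G1 \<union> sk G2 \<Longrightarrow>
      triplet a b c \<in> v_str G1 \<longleftrightarrow> triplet a b c \<in> v_str G2"
proof -
  obtain D1 D2 where D: "D1 \<in> dags V" "D2 \<in> dags V" "G1 = cpdag V D1" "G2 = cpdag V D2"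
    using cov by (auto simp: covered_by_def cpdags_eq)
  have le: "cpdag_le V \<mu> (cpdag V D) (cpdag V D') \<longleftrightarrow> conn_le V D D'" if "D \<in> dags V" "D' \<in> dags V" for D D'
    by (rule cpdag_le_iff) (use V \<mu> that in auto)
  have c12: "conn_le V D1 D2" using cov le D by (auto simp: covered_by_def)
  have st: "(D1, D2) \<in> (graph_step V)\<^sup>*" using conn_le_graph_steps[OF V D(1,2) c12] .
  have sub: "sk G1 \<subseteq> sk G2" using graph_steps_one_edge[OF V st D(1)] D by simp
  then have sd: "sym_diff (sk G1) (sk G2) = sk G2 - sk G1" by auto
  show "card (sym_diff (sk G1) (sk G2)) \<le> 1"
  proof (rule ccontr)
    assume "\<not> ?thesis"
    then have big: "card (sk G2 - sk G1) > 1" by (simp add: sd)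
    then have "sk G2 \<noteq> sk G1" by auto
    then obtain E where E: "(D1, E) \<in> (graph_step V)\<^sup>*" "(E, D2) \<in> (graph_step V)\<^sup>*" "E \<in> dags V"
      "card (sk (cpdag V E) - sk G1) = 1"
      using graph_steps_one_edge[OF V st D(1)] D by auto
    have "conn_le V D1 E" "conn_le V E D2" using graph_steps_conn_le E by blast+
    then have "cpdag_le V \<mu> G1 (cpdag V E)" "cpdag_le V \<mu> (cpdag V E) G2" using le D E by auto
    moreover have "cpdag V E \<noteq> G1" "cpdag V E \<noteq> G2" using E(4) big by auto
    moreover have "cpdag V E \<in> cpdags V" using E(3) by (simp add: cpdags_eq)
    ultimately show False using cov unfolding covered_by_def by metis
  qed
  fix a b c assume "a \<noteq> c" "{a, b} \<in> sk G1 \<inter> sk G2" "{b, c} \<in> sk G1 \<inter> sk G2" "{a, c} \<notin> sk G1 \<union> sk G2"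
  then have t: "a \<noteq> c" "adjacent D1 a b" "adjacent D1 b c" "adjacent D2 a b" "adjacent D2 b c"
    "\<not> adjacent D1 a c" "\<not> adjacent D2 a c"
    using edge_in_sk[OF V D(1)] edge_in_sk[OF V D(2)] D by auto
  then show "triplet a b c \<in> v_str G1 \<longleftrightarrow> triplet a b c \<in> v_str G2"
    using triplet_in_v_str[OF V D(1) t(1,6)] triplet_in_v_str[OF V D(2) t(1,7)]
      conn_le_collider_iff[OF D(1,2) c12 t(2,3,4,5,7,1)] D by simp
qed

section \<open>Counting changes along a path\<close>

lemma alternation_parity:
  fixes S :: "nat \<Rightarrow> 'a set"
  shows "e \<in> S n \<longleftrightarrow> (e \<in> S 0) \<noteq> odd (card {i. i < n \<and> e \<in> sym_diff (S i) (S (Suc i))})"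
proof (induction n)
  case (Suc n)
  let ?I = "\<lambda>n. {i. i < n \<and> e \<in> sym_diff (S i) (S (Suc i))}"
  have "?I (Suc n) = (if e \<in> sym_diff (S n) (S (Suc n)) then insert n (?I n) else ?I n)"
    by (auto simp: less_Suc_eq)
  then have "card (?I (Suc n)) = (if e \<in> sym_diff (S n) (S (Suc n)) then Suc (card (?I n)) else card (?I n))"
    by simp
  then show ?case using Suc.IH by auto
qed simp

text \<open>Double counting of the pairs of a step and an element that it changes. The number of
  changes of an element is odd exactly on the symmetric difference of the two ends, so it is at
  least 1 there and at least 2 for any other element that changes; each step contributes at most one
  pair.\<close>

lemma sym_diff_path_bound:
  fixes S :: "nat \<Rightarrow> 'a set"
  assumes fin: "\<And>i. i \<le> d \<Longrightarrow> finite (S i)"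
    and one: "\<And>i. i < d \<Longrightarrow> card (sym_diff (S i) (S (Suc i))) \<le> 1"
  shows "card (sym_diff (S 0) (S d)) + 2 * card ((\<Union>i<d. sym_diff (S i) (S (Suc i))) - sym_diff (S 0) (S d)) \<le> d"
proof -
  let ?c = "\<lambda>i. sym_diff (S i) (S (Suc i))"
  define E where "E = (\<Union>i<d. ?c i)"
  define \<Delta> where "\<Delta> = sym_diff (S 0) (S d)"
  let ?I = "\<lambda>e. {i. i < d \<and> e \<in> ?c i}"
  have finE: "finite E" unfolding E_def using fin by (intro finite_UN_I) auto
  have par: "e \<in> \<Delta> \<longleftrightarrow> odd (card (?I e))" for e using alternation_parity[of e S d] by (auto simp: \<Delta>_def)
  have \<Delta>E: "\<Delta> \<subseteq> E"
  proof
    fix e assume "e \<in> \<Delta>"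
    then have "odd (card (?I e))" using par by blast
    then have "?I e \<noteq> {}" by (metis card.empty even_zero)
    then show "e \<in> E" by (auto simp: E_def)
  qed
  have "(\<Sum>e\<in>E. card (?I e)) = (\<Sum>e\<in>E. \<Sum>i\<in>{i\<in>{..<d}. e \<in> ?c i}. 1)" by simp
  also have "\<dots> = (\<Sum>i<d. \<Sum>e\<in>{e\<in>E. e \<in> ?c i}. 1)" using finE by (intro sum.swap_restrict) auto
  also have "\<dots> = (\<Sum>i<d. card (?c i))"
  proof (rule sum.cong[OF refl])
    fix i assume "i \<in> {..<d}"
    then have "{e \<in> E. e \<in> ?c i} = ?c i" by (auto simp: E_def)
    then show "(\<Sum>e\<in>{e\<in>E. e \<in> ?c i}. 1) = card (?c i)" by simp
  qed
  also have "\<dots> \<le> (\<Sum>i<d. 1)" using one by (intro sum_mono) auto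
  finally have total: "(\<Sum>e\<in>E. card (?I e)) \<le> d" by simp
  have "card \<Delta> \<le> (\<Sum>e\<in>\<Delta>. card (?I e))"
  proof -
    have "1 \<le> card (?I e)" if "e \<in> \<Delta>" for e
    proof -
      have "odd (card (?I e))" using par that by blast
      then show ?thesis by presburger
    qed
    then have "(\<Sum>e\<in>\<Delta>. 1) \<le> (\<Sum>e\<in>\<Delta>. card (?I e))" by (intro sum_mono)
    then show ?thesis by simp
  qed
  moreover have "2 * card (E - \<Delta>) \<le> (\<Sum>e\<in>E - \<Delta>. card (?I e))"
  proof -
    have "2 \<le> card (?I e)" if e: "e \<in> E - \<Delta>" for e
    proof -
      have "even (card (?I e))" using par e by blast
      moreover obtain i where "i < d" "e \<in> ?c i" using e unfolding E_def by blast
      then have "?I e \<noteq> {}" by blast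
      then have "card (?I e) \<noteq> 0" by simp
      ultimately show ?thesis by presburger
    qed
    then have "(\<Sum>e\<in>E - \<Delta>. 2) \<le> (\<Sum>e\<in>E - \<Delta>. card (?I e))" by (intro sum_mono)
    then show ?thesis by simp
  qed
  moreover have "(\<Sum>e\<in>E. card (?I e)) = (\<Sum>e\<in>\<Delta>. card (?I e)) + (\<Sum>e\<in>E - \<Delta>. card (?I e))"
    using sum.subset_diff[OF \<Delta>E finE, of "\<lambda>e. card (?I e)"] by simp
  ultimately show ?thesis using total unfolding E_def \<Delta>_def by linarith
qed

lemma foldr_removals:
  assumes "\<And>e T. op e T = T - R e"
  shows "foldr (\<circ>) (map op es) id T = T - (\<Union>e\<in>set es. R e)"
  by (induction es) (use assms in auto)

text \<open>One operation per pair in \<open>N\<close>, of a kind read off from \<open>K\<close>: a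
  pair in \<open>K\<close> can only be one of the two edges of a triplet and calls for
  \<open>OP_ER\<close>, a pair outside \<open>K\<close> can only consist of its end points and calls
  for \<open>OP_CE\<close>.\<close>

lemma m_op_le_card:
  assumes N: "finite N" "\<And>e. e \<in> N \<Longrightarrow> \<exists>i\<in>V. \<exists>j\<in>V. e = {i, j}"
    and T: "\<And>t. t \<in> T \<Longrightarrow> \<exists>a\<in>V. \<exists>b\<in>V. \<exists>c\<in>V. t = triplet a b c \<and> {a, b} \<in> K \<and> {b, c} \<in> K \<and> {a, c} \<notin> K \<and>
      ({a, b} \<in> N \<or> {b, c} \<in> N \<or> {a, c} \<in> N)"
  shows "m_op V T \<le> card N"
proof -
  have "\<forall>e\<in>N. \<exists>ij. fst ij \<in> V \<and> snd ij \<in> V \<and> e = {fst ij, snd ij}" using N(2) by fastforce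
  from bchoice[OF this] obtain p where p: "\<And>e. e \<in> N \<Longrightarrow> fst (p e) \<in> V \<and> snd (p e) \<in> V \<and> e = {fst (p e), snd (p e)}" by blast
  define op where "op e = (if e \<in> K then OP_ER V (fst (p e)) (snd (p e)) else OP_CE V (fst (p e)) (snd (p e)))" for e
  define R where "R e = (if e \<in> K then {triplet (fst (p e)) (snd (p e)) k | k. k \<in> V} \<union> {triplet (snd (p e)) (fst (p e)) k | k. k \<in> V}
      else {triplet (fst (p e)) k (snd (p e)) | k. k \<in> V})" for e
  obtain es where es: "set es = N" "distinct es" using finite_distinct_list[OF N(1)] by blast
  have "op e T = T - R e" for e T by (simp add: op_def R_def OP_ER_def OP_CE_def)
  then have fold: "foldr (\<circ>) (map op es) id T = T - (\<Union>e\<in>N. R e)" using foldr_removals es by metis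
  have "t \<in> (\<Union>e\<in>N. R e)" if t: "t \<in> T" for t
  proof -
    obtain a b c where abc: "a \<in> V" "b \<in> V" "c \<in> V" "t = triplet a b c" "{a, b} \<in> K" "{b, c} \<in> K" "{a, c} \<notin> K"
      "{a, b} \<in> N \<or> {b, c} \<in> N \<or> {a, c} \<in> N" using T[OF t] by blast
    have ER: "triplet x y z \<in> R {x, y}" if "{x, y} \<in> N" "{x, y} \<in> K" "z \<in> V" for x y z
    proof -
      have "{x, y} = {fst (p {x, y}), snd (p {x, y})}" using p that(1) by blast
      then have "x = fst (p {x, y}) \<and> y = snd (p {x, y}) \<or> x = snd (p {x, y}) \<and> y = fst (p {x, y})"
        by (simp only: doubleton_eq_iff)
      then show ?thesis using that(2,3) unfolding R_def by auto
    qed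
    have CE: "triplet x y z \<in> R {x, z}" if "{x, z} \<in> N" "{x, z} \<notin> K" "y \<in> V" for x y z
    proof -
      have "{x, z} = {fst (p {x, z}), snd (p {x, z})}" using p that(1) by blast
      then have "triplet x y z = triplet (fst (p {x, z})) y (snd (p {x, z}))" by (simp add: triplet_def)
      then show ?thesis using that(2,3) unfolding R_def by auto
    qed
    have sym: "triplet a b c = triplet c b a" "{b, c} = {c, b}" by (auto simp: triplet_def)
    from abc(8) show ?thesis
    proof (elim disjE)
      assume "{a, b} \<in> N"
      then show ?thesis using ER[of a b c] abc by blast
    next
      assume "{b, c} \<in> N"
      then show ?thesis using ER[of c b a] abc sym by (metis UN_I)
    next
      assume "{a, c} \<in> N"
      then show ?thesis using CE[of a c b] abc by blast
    qed
  qed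
  then have "foldr (\<circ>) (map op es) id T = {}" using fold by auto
  moreover have "set (map op es) \<subseteq> {OP_CE V i j | i j. i \<in> V \<and> j \<in> V} \<union> {OP_ER V i j | i j. i \<in> V \<and> j \<in> V}"
  proof
    fix g assume "g \<in> set (map op es)"
    then obtain e where "e \<in> N" "g = op e" using es by auto
    then show "g \<in> {OP_CE V i j | i j. i \<in> V \<and> j \<in> V} \<union> {OP_ER V i j | i j. i \<in> V \<and> j \<in> V}"
      using p[of e] by (cases "e \<in> K") (auto simp: op_def)
  qed
  moreover have "length (map op es) = card N" using es distinct_card by fastforce
  ultimately show ?thesis unfolding m_op_def by (intro Least_le) blast
qed

lemma path_length_bound:
  assumes V: "finite V" and \<mu>: "\<And>v. v \<in> V \<Longrightarrow> sigma_finite_measure (\<mu> v)"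
    "\<And>v. v \<in> V \<Longrightarrow> nondegenerate (\<mu> v)"
    and x: "\<And>i. i \<le> d \<Longrightarrow> x i \<in> cpdags V"
    and st: "\<And>i. i < d \<Longrightarrow> covered_by (cpdags V) (cpdag_le V \<mu>) (x i) (x (Suc i)) \<or>
       covered_by (cpdags V) (cpdag_le V \<mu>) (x (Suc i)) (x i)"
  shows "card (sym_diff (sk (x 0)) (sk (x d))) + 2 * m_op V (S_triplets V (x 0) (x d)) \<le> d"
proof -
  let ?cov = "covered_by (cpdags V) (cpdag_le V \<mu>)"
  have one': "card (sym_diff (sk G1) (sk G2)) \<le> 1" if "?cov G1 G2" for G1 G2
    by (rule cover_structure(1)[OF V _ _ that]) (use \<mu> in auto)
  have one: "card (sym_diff (sk (x i)) (sk (x (Suc i)))) \<le> 1" if "i < d" for i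
    using st[OF that] one'[of "x i" "x (Suc i)"] one'[of "x (Suc i)" "x i"] by (auto simp: Un_commute)
  have vs': "triplet a b c \<in> v_str G1 \<longleftrightarrow> triplet a b c \<in> v_str G2"
    if "?cov G1 G2" "a \<noteq> c" "{a, b} \<in> sk G1 \<inter> sk G2" "{b, c} \<in> sk G1 \<inter> sk G2"
      "{a, c} \<notin> sk G1 \<union> sk G2" for G1 G2 a b c
    by (rule cover_structure(2)[OF V _ _ that]) (use \<mu> in auto)
  have vs: "triplet a b c \<in> v_str (x i) \<longleftrightarrow> triplet a b c \<in> v_str (x (Suc i))"
    if "i < d" "a \<noteq> c" "{a, b} \<in> sk (x i) \<inter> sk (x (Suc i))" "{b, c} \<in> sk (x i) \<inter> sk (x (Suc i))"
      "{a, c} \<notin> sk (x i) \<union> sk (x (Suc i))" for i a b c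
    using st[OF that(1)]
  proof
    assume "?cov (x i) (x (Suc i))"
    then show ?thesis by (rule vs') (use that in auto)
  next
    assume "?cov (x (Suc i)) (x i)"
    then have "triplet a b c \<in> v_str (x (Suc i)) \<longleftrightarrow> triplet a b c \<in> v_str (x i)"
      by (rule vs') (use that in auto)
    then show ?thesis by simp
  qed
  define N where "N = (\<Union>i<d. sym_diff (sk (x i)) (sk (x (Suc i)))) - sym_diff (sk (x 0)) (sk (x d))"
  have bound: "card (sym_diff (sk (x 0)) (sk (x d))) + 2 * card N \<le> d"
    unfolding N_def by (rule sym_diff_path_bound) (use finite_sk[OF V] x one in auto)
  have "m_op V (S_triplets V (x 0) (x d)) \<le> card N"
  proof (rule m_op_le_card[where K = "sk (x 0)"])
    show "finite N" unfolding N_def using finite_sk[OF V] x by (intro finite_Diff finite_UN_I) auto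
    show "\<exists>i\<in>V. \<exists>j\<in>V. e = {i, j}" if e: "e \<in> N" for e
    proof -
      obtain i where "i < d" "e \<in> sk (x i) \<or> e \<in> sk (x (Suc i))" using e by (auto simp: N_def)
      then show ?thesis using sk_subset[OF V x[of i]] sk_subset[OF V x[of "Suc i"]] by auto
    qed
    fix t assume "t \<in> S_triplets V (x 0) (x d)"
    then obtain a b c where t: "t = triplet a b c" "a \<in> V" "b \<in> V" "c \<in> V"
      "{a, b} \<in> sk (x 0)" "{a, b} \<in> sk (x d)" "{b, c} \<in> sk (x 0)" "{b, c} \<in> sk (x d)"
      "{a, c} \<notin> sk (x 0)" "{a, c} \<notin> sk (x d)"
      "t \<in> sym_diff (v_str (x 0)) (v_str (x d))" by (auto simp: S_triplets_def)
    \<comment> \<open>\<open>S_triplets\<close> does not say that the end points differ; this comes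
      from the v-structure at one end of the path.\<close>
    have "\<exists>i. t \<in> v_str (x i)" using t(11) by blast
    then have ac: "a \<noteq> c" unfolding v_str_def t(1) by (auto simp: triplet_eq_iff)
    have "{a, b} \<in> N \<or> {b, c} \<in> N \<or> {a, c} \<in> N"
    proof (rule ccontr)
      assume no: "\<not> ?thesis"
      \<comment> \<open>The three pairs of \<open>t\<close> have the same status at both ends of the
        path. If none of them lies in \<open>N\<close>, they never change, so \<open>t\<close> stays
        unshielded all along and no cover can alter its status.\<close>
      have const: "e \<in> sk (x i) \<longleftrightarrow> e \<in> sk (x 0)"
        if e: "e \<notin> N" "e \<notin> sym_diff (sk (x 0)) (sk (x d))" and i: "i \<le> d" for e i
        using i
      proof (induction i)
        case (Suc i)
        have "e \<notin> sym_diff (sk (x i)) (sk (x (Suc i)))" using e Suc.prems by (auto simp: N_def)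
        then show ?case using Suc by auto
      qed simp
      have "{a, b} \<in> sk (x i)" "{b, c} \<in> sk (x i)" "{a, c} \<notin> sk (x i)" if "i \<le> d" for i
        using const[of _ i] that no t by auto
      then have "t \<in> v_str (x i) \<longleftrightarrow> t \<in> v_str (x 0)" if "i \<le> d" for i
        using that
      proof (induction i)
        case (Suc i)
        then show ?case using vs[of i a c b] ac t(1) by auto
      qed simp
      from this[of d] show False using t(11) by blast
    qed
    then show "\<exists>a\<in>V. \<exists>b\<in>V. \<exists>c\<in>V. t = triplet a b c \<and> {a, b} \<in> sk (x 0) \<and> {b, c} \<in> sk (x 0) \<and> {a, c} \<notin> sk (x 0) \<and>
      ({a, b} \<in> N \<or> {b, c} \<in> N \<or> {a, c} \<in> N)" using t by blast
  qed
  then show ?thesis using bound by simp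
qed

theorem propositionS13:
  fixes V :: "'v set" and \<mu> :: "'v \<Rightarrow> 'x measure" and Gs Gt :: "'v mixed_graph"
  assumes "finite V"
    and "\<And>v. v \<in> V \<Longrightarrow> sigma_finite_measure (\<mu> v)"
    and "\<And>v. v \<in> V \<Longrightarrow> nondegenerate (\<mu> v)"
    and "Gs \<in> cpdags V" and "Gt \<in> cpdags V"
  shows "dist_L (cpdags V) (cpdag_le V \<mu>) Gs Gt
           \<le> min (dist_down_up (cpdags V) (cpdag_le V \<mu>) Gs Gt)
                 (dist_up_down (cpdags V) (cpdag_le V \<mu>) Gs Gt) \<and>
         dist_L (cpdags V) (cpdag_le V \<mu>) Gs Gt
           \<ge> enat (card (sym_diff (sk Gs) (sk Gt)) + 2 * m_op V (S_triplets V Gs Gt))"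
proof (intro conjI min.boundedI)
  show "dist_L (cpdags V) (cpdag_le V \<mu>) Gs Gt \<le> dist_down_up (cpdags V) (cpdag_le V \<mu>) Gs Gt"
    unfolding dist_L_def dist_down_up_def
  proof (rule Inf_superset_mono, clarify)
    fix d x k assume "\<forall>i\<le>d. x i \<in> cpdags V" "Gs = x 0" "Gt = x d"
      "\<forall>i<k. covered_by (cpdags V) (cpdag_le V \<mu>) (x (Suc i)) (x i)"
      "\<forall>i. k \<le> i \<and> i < d \<longrightarrow> covered_by (cpdags V) (cpdag_le V \<mu>) (x i) (x (Suc i))"
    then show "\<exists>d' x'. enat d = enat d' \<and> (\<forall>i\<le>d'. x' i \<in> cpdags V) \<and> x' 0 = x 0 \<and> x' d' = x d \<and>
      (\<forall>i<d'. covered_by (cpdags V) (cpdag_le V \<mu>) (x' i) (x' (Suc i)) \<or>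
        covered_by (cpdags V) (cpdag_le V \<mu>) (x' (Suc i)) (x' i))"
      by (intro exI[of _ d] exI[of _ x]) (meson not_less)
  qed
  show "dist_L (cpdags V) (cpdag_le V \<mu>) Gs Gt \<le> dist_up_down (cpdags V) (cpdag_le V \<mu>) Gs Gt"
    unfolding dist_L_def dist_up_down_def
  proof (rule Inf_superset_mono, clarify)
    fix d x k assume "\<forall>i\<le>d. x i \<in> cpdags V" "Gs = x 0" "Gt = x d"
      "\<forall>i<k. covered_by (cpdags V) (cpdag_le V \<mu>) (x i) (x (Suc i))"
      "\<forall>i. k \<le> i \<and> i < d \<longrightarrow> covered_by (cpdags V) (cpdag_le V \<mu>) (x (Suc i)) (x i)"
    then show "\<exists>d' x'. enat d = enat d' \<and> (\<forall>i\<le>d'. x' i \<in> cpdags V) \<and> x' 0 = x 0 \<and> x' d' = x d \<and>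
      (\<forall>i<d'. covered_by (cpdags V) (cpdag_le V \<mu>) (x' i) (x' (Suc i)) \<or>
        covered_by (cpdags V) (cpdag_le V \<mu>) (x' (Suc i)) (x' i))"
      by (intro exI[of _ d] exI[of _ x]) (meson not_less)
  qed
  show "enat (card (sym_diff (sk Gs) (sk Gt)) + 2 * m_op V (S_triplets V Gs Gt))
      \<le> dist_L (cpdags V) (cpdag_le V \<mu>) Gs Gt"
    unfolding dist_L_def
  proof (rule Inf_greatest, clarify)
    fix d x assume x: "\<forall>i\<le>d. x i \<in> cpdags V" "Gs = x 0" "Gt = x d"
      "\<forall>i<d. covered_by (cpdags V) (cpdag_le V \<mu>) (x i) (x (Suc i)) \<or>
        covered_by (cpdags V) (cpdag_le V \<mu>) (x (Suc i)) (x i)"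
    show "enat (card (sym_diff (sk (x 0)) (sk (x d))) + 2 * m_op V (S_triplets V (x 0) (x d))) \<le> enat d"
      unfolding enat_ord_simps by (rule path_length_bound) (use assms(1-3) x in auto)
  qed
qed

end
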